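(* Let $G$ be a locally compact Hausdorff group with left Haar measure $\mu$ and let $1\leqslant p<\infty$. A family $\mathcal{F}\subset L^p(G)$ is relatively compact in $L^p(G)$ if and only if (i) $\mathcal{F}$ is $L^p$-bounded, (ii) $\mathcal{F}$ is $L^p$-equicontinuous, and (iii) $\mathcal{F}$ is $L^p$-equivanishing. Furthermore, suppose that $G$ is such that for every open neighbourhood $U$ of the neutral element there exists an element $x\in U$ such that the sequence $(x^n)_{n\in\mathbb{N}}$ is not contained in any compact subset of $G$. Then the condition of $L^p$-boundedness is redundant, i.e. a family $\mathcal{F}\subset L^p(G)$ is relatively compact if and only if it satisfies (ii) and (iii).
   Context: $\mu$ is a left Haar measure on $G$: a nonzero left-invariant Borel measure, finite on compact sets, inner regular on open sets and outer regular on measurable sets; $dy$ denotes integration with respect to $\mu$. $L^p(G)=L^p(G,\mu)$ (complex-valued functions) with norm $\|\cdot\|_p$. Relatively compact means having compact closure. For $x\in G$, $L_xf(y):=f(xy)$ and $R_xf(y):=f(yx)$. A family $\mathcal{F}\subset L^p(G)$ is: - $L^p$-bounded if there exists $M>0$ such that $\|f\|_p\leqslant M$ for all $f\in\mathcal{F}$; - $L^p$-equicontinuous if for every $\varepsilon>0$ there exists an open neighbourhood $U_e$ of the neutral element $e$ such that for all $f\in\mathcal{F}$: $\sup_{x\in U_e}\|L_xf-f\|_p\leqslant\varepsilon$ and $\sup_{x\in U_e}\|R_xf-f\|_p\leqslant\varepsilon$; - $L^p$-equivanishing if for every $\varepsilon>0$ there exists a compact set $K\subset G$ such that $\int_{G\setminus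 K}|f(y)|^p\,dy\leqslant\varepsilon$ for all $f\in\mathcal{F}$. *)

theory Defs
  imports "HOL-Analysis.Analysis"
begin

text \<open>
  Groups are written additively: the class \<open>topological_group_add\<close> is the library's (not necessarily
  commutative) topological group, so \<open>x + y\<close> is the group product, \<open>0\<close> the neutral element and
  \<open>((+) x ^^ n) 0\<close> the \<open>n\<close>-th power of \<open>x\<close>.
\<close>

section \<open>Left Haar measures\<close>

definition left_haar_measure :: "'a::{topological_group_add,t2_space} measure \<Rightarrow> bool" where
  "left_haar_measure \<mu> \<longleftrightarrow>
     sets \<mu> = sets borel \<and>
     emeasure \<mu> UNIV \<noteq> 0 \<and>
     (\<forall>x. \<forall>A\<in>sets borel. emeasure \<mu> ((+) x ` A) = emeasure \<mu> A) \<and>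
     (\<forall>K. compact K \<longrightarrow> emeasure \<mu> K < \<infinity>) \<and>
     (\<forall>U. open U \<longrightarrow> emeasure \<mu> U = (SUP K\<in>{K. compact K \<and> K \<subseteq> U}. emeasure \<mu> K)) \<and>
     (\<forall>A\<in>sets borel. emeasure \<mu> A = (INF U\<in>{U. open U \<and> A \<subseteq> U}. emeasure \<mu> U))"


section \<open>The space \<open>L\<^sup>p\<close>\<close>

definition Lp_fun :: "'a measure \<Rightarrow> real \<Rightarrow> ('a \<Rightarrow> complex) set" where
  "Lp_fun M p = {f \<in> borel_measurable M. integrable M (\<lambda>x. cmod (f x) powr p)}"

definition Lp_norm :: "'a measure \<Rightarrow> real \<Rightarrow> ('a \<Rightarrow> complex) \<Rightarrow> real" where
  "Lp_norm M p f = (LINT x|M. cmod (f x) powr p) powr (1 / p)"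

definition Lp_rel :: "'a measure \<Rightarrow> real \<Rightarrow> (('a \<Rightarrow> complex) \<times> ('a \<Rightarrow> complex)) set" where
  "Lp_rel M p = {(f, g). f \<in> Lp_fun M p \<and> g \<in> Lp_fun M p \<and> (AE x in M. f x = g x)}"

definition Lp_space :: "'a measure \<Rightarrow> real \<Rightarrow> ('a \<Rightarrow> complex) set set" where
  "Lp_space M p = Lp_fun M p // Lp_rel M p"

definition Lp_dist :: "'a measure \<Rightarrow> real \<Rightarrow> ('a \<Rightarrow> complex) set \<Rightarrow> ('a \<Rightarrow> complex) set \<Rightarrow> real" where
  "Lp_dist M p c d =
     Lp_norm M p (\<lambda>x. (SOME f. f \<in> c) x - (SOME g. g \<in> d) x)"

definition Lp_topology :: "'a measure \<Rightarrow> real \<Rightarrow> ('a \<Rightarrow> complex) set topology" where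
  "Lp_topology M p = Metric_space.mtopology (Lp_space M p) (Lp_dist M p)"

definition relatively_compact_in :: "'b topology \<Rightarrow> 'b set \<Rightarrow> bool" where
  "relatively_compact_in X S \<longleftrightarrow> S \<subseteq> topspace X \<and> compactin X (X closure_of S)"


section \<open>Conditions on families in \<open>L\<^sup>p\<close>\<close>

text \<open>
  A family is a set of almost-everywhere classes; the conditions below are imposed on all
  representatives, the quantities involved being the same for all representatives of a class.
\<close>

definition left_translate :: "'a::plus \<Rightarrow> ('a \<Rightarrow> complex) \<Rightarrow> 'a \<Rightarrow> complex" where
  "left_translate x f = (\<lambda>y. f (x + y))"

definition right_translate :: "'a::plus \<Rightarrow> ('a \<Rightarrow> complex) \<Rightarrow> 'a \<Rightarrow> complex" where
  "right_translate x f = (\<lambda>y. f (y + x))"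

definition Lp_bounded :: "'a measure \<Rightarrow> real \<Rightarrow> ('a \<Rightarrow> complex) set set \<Rightarrow> bool" where
  "Lp_bounded \<mu> p F \<longleftrightarrow> (\<exists>B>0. \<forall>c\<in>F. \<forall>f\<in>c. Lp_norm \<mu> p f \<le> B)"

text \<open>
  For a left Haar measure, left and right translations map \<open>Lp_fun\<close> into itself, so the Bochner
  integrals inside \<open>Lp_norm\<close> below are genuine.
\<close>

definition Lp_equicontinuous ::
  "'a::topological_group_add measure \<Rightarrow> real \<Rightarrow> ('a \<Rightarrow> complex) set set \<Rightarrow> bool" where
  "Lp_equicontinuous \<mu> p F \<longleftrightarrow>
     (\<forall>\<epsilon>>0. \<exists>U. open U \<and> 0 \<in> U \<and>
        (\<forall>c\<in>F. \<forall>f\<in>c.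
           (\<forall>x\<in>U. Lp_norm \<mu> p (\<lambda>y. left_translate x f y - f y) \<le> \<epsilon>) \<and>
           (\<forall>x\<in>U. Lp_norm \<mu> p (\<lambda>y. right_translate x f y - f y) \<le> \<epsilon>)))"

definition Lp_equivanishing ::
  "'a::topological_space measure \<Rightarrow> real \<Rightarrow> ('a \<Rightarrow> complex) set set \<Rightarrow> bool" where
  "Lp_equivanishing \<mu> p F \<longleftrightarrow>
     (\<forall>\<epsilon>>0. \<exists>K. compact K \<and>
        (\<forall>c\<in>F. \<forall>f\<in>c. (LINT y:- K|\<mu>. cmod (f y) powr p) \<le> \<epsilon>))"


section \<open>\<open>Lp_dist\<close> is a metric\<close>

lemma Lp_fun_add:
  assumes p: "p \<ge> 1" and f: "f \<in> Lp_fun M p" and g: "g \<in> Lp_fun M p"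
  shows "(\<lambda>x. f x + g x) \<in> Lp_fun M p"
proof -
  have [measurable]: "f \<in> borel_measurable M" "g \<in> borel_measurable M"
    using f g by (auto simp: Lp_fun_def)
  have bnd: "cmod (f x + g x) powr p \<le> 2 powr p * (cmod (f x) powr p + cmod (g x) powr p)" for x
  proof -
    define m where "m = max (cmod (f x)) (cmod (g x))"
    have m0: "0 \<le> m" by (simp add: m_def le_max_iff_disj)
    have "cmod (f x + g x) \<le> 2 * m"
      using norm_triangle_ineq[of "f x" "g x"] by (simp add: m_def)
    then have "cmod (f x + g x) powr p \<le> (2 * m) powr p"
      using p by (intro powr_mono2) auto
    also have "\<dots> = 2 powr p * m powr p"
      using m0 by (simp add: powr_mult)
    also have "m powr p \<le> cmod (f x) powr p + cmod (g x) powr p"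
      by (auto simp: m_def max_def)
    finally show ?thesis by simp
  qed
  have "integrable M (\<lambda>x. cmod (f x + g x) powr p)"
  proof (rule Bochner_Integration.integrable_bound)
    show "integrable M (\<lambda>x. 2 powr p * (cmod (f x) powr p + cmod (g x) powr p))"
      using f g by (auto simp: Lp_fun_def)
  qed (use bnd in auto)
  then show ?thesis by (simp add: Lp_fun_def)
qed

lemma Lp_fun_diff:
  assumes "p \<ge> 1" "f \<in> Lp_fun M p" "g \<in> Lp_fun M p"
  shows "(\<lambda>x. f x - g x) \<in> Lp_fun M p"
proof -
  have "(\<lambda>x. - g x) \<in> Lp_fun M p" using assms(3) by (auto simp: Lp_fun_def)
  from Lp_fun_add[OF assms(1,2) this] show ?thesis by simp
qed

lemma Lp_norm_nonneg [simp]: "0 \<le> Lp_norm M p f"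
  by (simp add: Lp_norm_def)

lemma Lp_norm_powr:
  assumes "p \<ge> 1"
  shows "Lp_norm M p f powr p = (LINT x|M. cmod (f x) powr p)"
  using assms by (simp add: Lp_norm_def powr_powr)

lemma Lp_norm_eq_0_iff:
  assumes p: "p \<ge> 1" and f: "f \<in> Lp_fun M p"
  shows "Lp_norm M p f = 0 \<longleftrightarrow> (AE x in M. f x = 0)"
proof -
  have "Lp_norm M p f = 0 \<longleftrightarrow> (LINT x|M. cmod (f x) powr p) = 0"
    by (simp add: Lp_norm_def)
  also have "\<dots> \<longleftrightarrow> (AE x in M. cmod (f x) powr p = 0)"
    using f by (intro integral_nonneg_eq_0_iff_AE) (auto simp: Lp_fun_def)
  finally show ?thesis by simp
qed

lemma Lp_norm_cong_AE:
  assumes "f \<in> borel_measurable M" "g \<in> borel_measurable M" "AE x in M. f x = g x"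
  shows "Lp_norm M p f = Lp_norm M p g"
proof -
  have "(LINT x|M. cmod (f x) powr p) = (LINT x|M. cmod (g x) powr p)"
    using assms by (intro integral_cong_AE) auto
  then show ?thesis by (simp add: Lp_norm_def)
qed

lemma powr_convex_ineq:
  fixes s t u v p :: real
  assumes "p \<ge> 1" "s \<ge> 0" "t \<ge> 0" "u \<ge> 0" "v \<ge> 0" "u + v = 1"
  shows "(u * s + v * t) powr p \<le> u * s powr p + v * t powr p"
proof -
  have scale: "(w * r) powr p \<le> w * r powr p" if "0 \<le> w" "w \<le> 1" "0 \<le> r" for w r :: real
  proof -
    have "w powr p \<le> w powr 1"
      using that assms(1) powr_mono'[of 1 p w] by simp
    then show ?thesis
      using that by (simp add: powr_mult mult_right_mono)
  qed
  show ?thesis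
  proof (cases "s = 0 \<or> t = 0")
    case True
    then show ?thesis using scale[of v t] scale[of u s] assms by auto
  next
    case False
    have u: "u = 1 - v" using assms by simp
    show ?thesis
      using convex_onD[OF powr_convex[OF assms(1)], of v s t] assms False
      unfolding u by simp
  qed
qed

lemma Lp_norm_triangle:
  assumes p: "p \<ge> 1" and f: "f \<in> Lp_fun M p" and g: "g \<in> Lp_fun M p"
  shows "Lp_norm M p (\<lambda>x. f x + g x) \<le> Lp_norm M p f + Lp_norm M p g"
proof -
  define a b where "a = Lp_norm M p f" and "b = Lp_norm M p g"
  have ab0: "a \<ge> 0" "b \<ge> 0" by (simp_all add: a_def b_def)
  have [measurable]: "f \<in> borel_measurable M" "g \<in> borel_measurable M"
    using f g by (auto simp: Lp_fun_def)
  show ?thesis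
  proof (cases "a = 0 \<or> b = 0")
    case True
    then show ?thesis
    proof
      assume "a = 0"
      then have "AE x in M. f x + g x = g x"
        using Lp_norm_eq_0_iff[OF p f] by (auto simp: a_def)
      then have "Lp_norm M p (\<lambda>x. f x + g x) = b"
        unfolding b_def by (intro Lp_norm_cong_AE) auto
      then show ?thesis using ab0 by (simp add: a_def b_def)
    next
      assume "b = 0"
      then have "AE x in M. f x + g x = f x"
        using Lp_norm_eq_0_iff[OF p g] by (auto simp: b_def)
      then have "Lp_norm M p (\<lambda>x. f x + g x) = a"
        unfolding a_def by (intro Lp_norm_cong_AE) auto
      then show ?thesis using ab0 by (simp add: a_def b_def)
    qed
  next
    case False
    with ab0 have pos: "a > 0" "b > 0" by auto
    define u v where "u = a / (a + b)" and "v = b / (a + b)"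
    have uv: "u \<ge> 0" "v \<ge> 0" "u + v = 1"
      using pos by (auto simp: u_def v_def add_divide_distrib[symmetric])
    let ?h = "\<lambda>x. (a + b) powr p *
      (u * (cmod (f x) powr p / a powr p) + v * (cmod (g x) powr p / b powr p))"
    have le: "cmod (f x + g x) powr p \<le> ?h x" for x
    proof -
      have "cmod (f x + g x) powr p \<le> (cmod (f x) + cmod (g x)) powr p"
        using p by (intro powr_mono2) (auto intro: norm_triangle_ineq)
      also have "cmod (f x) + cmod (g x) = (a + b) * (u * (cmod (f x) / a) + v * (cmod (g x) / b))"
      proof -
        have "(a + b) * u = a" "(a + b) * v = b"
          using pos by (simp_all add: u_def v_def)
        then show ?thesis
          using pos by (simp add: distrib_left mult.assoc[symmetric])
      qed
      also have "\<dots> powr p = (a + b) powr p * (u * (cmod (f x) / a) + v * (cmod (g x) / b)) powr p"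
        using pos uv by (intro powr_mult)
      also have "\<dots> \<le> (a + b) powr p * (u * (cmod (f x) / a) powr p + v * (cmod (g x) / b) powr p)"
        using pos uv p by (intro mult_left_mono powr_convex_ineq) auto
      finally show ?thesis using pos by (simp add: powr_divide)
    qed
    have intf: "integrable M (\<lambda>x. cmod (f x) powr p)" and intg: "integrable M (\<lambda>x. cmod (g x) powr p)"
      and intfg: "integrable M (\<lambda>x. cmod (f x + g x) powr p)"
      using f g Lp_fun_add[OF p f g] by (auto simp: Lp_fun_def)
    have "(LINT x|M. cmod (f x + g x) powr p) \<le> (LINT x|M. ?h x)"
      using intf intg intfg le by (intro integral_mono) auto
    also have "\<dots> = (a + b) powr p * (u * (a powr p / a powr p) + v * (b powr p / b powr p))"
      using intf intg by (simp add: a_def b_def Lp_norm_powr[OF p])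
    also have "\<dots> = (a + b) powr p"
      using pos uv by simp
    finally have "(LINT x|M. cmod (f x + g x) powr p) powr (1 / p) \<le> ((a + b) powr p) powr (1 / p)"
      using p by (intro powr_mono2) auto
    also have "\<dots> = a + b"
      using pos p by (simp add: powr_powr)
    finally show ?thesis by (simp add: Lp_norm_def a_def b_def)
  qed
qed

lemma equiv_Lp_rel: "equiv (Lp_fun M p) (Lp_rel M p)"
proof (rule equivI)
  show "Lp_rel M p \<subseteq> Lp_fun M p \<times> Lp_fun M p" by (auto simp: Lp_rel_def)
  show "refl_on (Lp_fun M p) (Lp_rel M p)" by (auto simp: refl_on_def Lp_rel_def)
  show "sym (Lp_rel M p)" by (auto simp: sym_def Lp_rel_def)
  show "trans (Lp_rel M p)" by (auto simp: trans_def Lp_rel_def)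
qed

lemma Metric_space_Lp:
  assumes p: "p \<ge> 1"
  shows "Metric_space (Lp_space M p) (Lp_dist M p)"
proof
  let ?r = "\<lambda>c. SOME f. f \<in> c"
  have rc: "?r c \<in> c" if "c \<in> Lp_space M p" for c
    using in_quotient_imp_non_empty[OF equiv_Lp_rel that[unfolded Lp_space_def]]
    by (simp add: some_in_eq)
  have r: "?r c \<in> Lp_fun M p" if "c \<in> Lp_space M p" for c
    using rc[OF that] in_quotient_imp_subset[OF equiv_Lp_rel that[unfolded Lp_space_def]] by blast
  fix c d e
  show "0 \<le> Lp_dist M p c d" by (simp add: Lp_dist_def)
  show "Lp_dist M p c d = Lp_dist M p d c" by (simp add: Lp_dist_def Lp_norm_def norm_minus_commute)
  assume c: "c \<in> Lp_space M p" and d: "d \<in> Lp_space M p"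
  have "Lp_dist M p c d = 0 \<longleftrightarrow> (?r c, ?r d) \<in> Lp_rel M p"
    using Lp_norm_eq_0_iff[OF p Lp_fun_diff[OF p r[OF c] r[OF d]]] r[OF c] r[OF d]
    by (simp add: Lp_dist_def Lp_rel_def)
  also have "\<dots> \<longleftrightarrow> c = d"
    using quotient_eq_iff[OF equiv_Lp_rel c[unfolded Lp_space_def] d[unfolded Lp_space_def] rc[OF c] rc[OF d]]
    by simp
  finally show "Lp_dist M p c d = 0 \<longleftrightarrow> c = d" .
  assume e: "e \<in> Lp_space M p"
  show "Lp_dist M p c e \<le> Lp_dist M p c d + Lp_dist M p d e"
    using Lp_norm_triangle[OF p Lp_fun_diff[OF p r[OF c] r[OF d]] Lp_fun_diff[OF p r[OF d] r[OF e]]]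
    by (simp add: Lp_dist_def)
qed

end

theory Submission
  imports Defs
begin

text \<open>
  Relative compactness in the complete space \<open>L\<^sup>p\<close> means total boundedness: for every \<open>\<epsilon>\<close>, the family
  is within \<open>\<epsilon>\<close> of a finite set of functions. A finite set of functions is bounded, equivanishing and
  equicontinuous, and these properties pass to nearby functions, since translations by elements near
  the neutral element are uniformly bounded operators
  (\<open>relatively_compact_imp_Lp_bounded\<close>, \<open>relatively_compact_imp_Lp_equivanishing\<close>,
  \<open>relatively_compact_imp_Lp_equicontinuous\<close>). For a single function, equivanishing and continuity of
  translations follow from the density of continuous functions with compact support
  (\<open>compactly_supported_dense\<close>). Left translations are isometries. Right translations
  multiply Haar measure by a constant, because a right translate of a left Haar measure is again a
  left Haar measure and Haar measure is unique up to a factor (\<open>left_haar_measure_unique\<close>).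

  Conversely, let a family be bounded, equicontinuous and equivanishing. By equivanishing, its
  functions may be restricted to a compact set \<open>K\<close>. Cut \<open>K\<close> into finitely many small Borel pieces
  and replace \<open>f\<close> on each piece by its mean over a translate \<open>z + U\<close> of a fixed compact neighbourhood
  \<open>U\<close> of \<open>0\<close>. If the pieces are small in comparison with \<open>U\<close>, then for \<open>x\<close> in the piece the set
  \<open>z + U\<close> is contained in \<open>x + V\<close> for some neighbourhood \<open>V\<close> of \<open>U\<close> of at most twice the measure, so
  that the error is dominated by an average of right differences \<open>f (x + w) - f x\<close> with \<open>w \<in> V\<close>, and
  is small by equicontinuity (\<open>smooth_close\<close>). The averaged functions are determined by finitely many
  bounded numbers, hence are totally bounded (\<open>smooth_finite_net\<close>).

  Boundedness is automatic when there are arbitrarily small elements with unbounded powers: some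
  power \<open>z\<close> of a small \<open>x\<close> moves \<open>K\<close> off itself, so that on \<open>K\<close> the translate of \<open>f\<close> by \<open>z\<close> is
  small; and the translate differs from \<open>f\<close> by at most the number of steps
  (\<open>Lp_bounded_if_escaping_powers\<close>).

  A Haar measure need not be sigma-finite, and on a group without a countable base the product of the
  Borel algebras can be smaller than the Borel algebra of the product. Interchanging integrals is
  therefore reduced to compactly supported continuous functions, where uniform continuity provides
  approximation by finite Borel partitions (\<open>finite_Borel_selection\<close>).
\<close>

section \<open>Neighbourhoods in topological groups\<close>

lemma open_left_translation:
  fixes U :: "'a::topological_group_add set"
  assumes "open U"
  shows "open ((+) x ` U)"
proof -
  have "y \<in> (+) x ` U \<longleftrightarrow> - x + y \<in> U" for y
    using add_minus_cancel[of x y] minus_add_cancel[of x] by (metis imageE imageI)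
  then have "(+) x ` U = (\<lambda>y. - x + y) -` U" by auto
  then show ?thesis
    using assms by (auto intro!: open_vimage continuous_intros)
qed

lemma compact_right_translation:
  fixes K :: "'a::topological_group_add set"
  shows "compact K \<Longrightarrow> compact ((\<lambda>y. y + x) ` K)"
  by (intro compact_continuous_image continuous_intros)

lemma open_right_translation:
  fixes U :: "'a::topological_group_add set"
  assumes "open U"
  shows "open ((\<lambda>y. y + x) ` U)"
proof -
  have "(\<lambda>y. y + x) ` U = (\<lambda>y. y - x) -` U"
    by (auto simp: image_iff) (metis diff_add_cancel)
  then show ?thesis
    using assms by (auto intro!: open_vimage continuous_intros)
qed

lemma compact_sumset:
  fixes K L :: "'a::topological_group_add set"
  assumes "compact K" "compact L"
  shows "compact ((\<lambda>(x, y). x + y) ` (K \<times> L))"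
  using assms by (intro compact_continuous_image compact_Times)
    (auto simp: split_beta' intro!: continuous_intros)

lemma compact_diffset:
  fixes K L :: "'a::topological_group_add set"
  assumes "compact K" "compact L"
  shows "compact ((\<lambda>(x, y). x - y) ` (K \<times> L))"
  using assms by (intro compact_continuous_image compact_Times)
    (auto simp: split_beta' intro!: continuous_intros)

lemma symmetric_nhd:
  fixes U :: "'a::topological_group_add set"
  assumes "open U" "0 \<in> U"
  obtains V where "open V" "0 \<in> V" "V \<subseteq> U" "\<And>v. v \<in> V \<Longrightarrow> - v \<in> V"
proof
  show "open (U \<inter> uminus -` U)"
    using assms by (auto intro!: open_Int open_vimage continuous_intros)
qed (use assms in auto)

lemma compact_in_open_translates:
  fixes C :: "'a::topological_group_add set"
  assumes "compact C" "open O'" "C \<subseteq> O'"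
  obtains V where "open V" "0 \<in> V" "\<And>v c. v \<in> V \<Longrightarrow> c \<in> C \<Longrightarrow> v + c \<in> O'"
proof -
  have op: "open ((\<lambda>(v, c). v + c) -` O')"
    using assms by (auto simp: split_beta' intro!: open_vimage continuous_intros)
  have sub: "{0} \<times> C \<subseteq> (\<lambda>(v, c). v + c) -` O'"
    using assms(3) by auto
  obtain V where "0 \<in> V" "open V" "V \<times> C \<subseteq> (\<lambda>(v, c). v + c) -` O'"
    using Elementary_Topology.tube_lemma[OF assms(1) op sub] by blast
  then show thesis by (intro that[of V]) auto
qed

text \<open>
  A compact set is covered by finitely many members of any neighbourhood assignment; making the
  cover disjoint turns it into a Borel function with finitely many values that moves each point of
  the compact set only within the neighbourhood assigned to its image. Such functions provide the
  Riemann sums below. Composed with one argument of a function of two variables they also make it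
  measurable for the product of the Borel algebras, which continuity alone does not ensure without a
  countable base of the topology.
\<close>
lemma finite_Borel_selection:
  fixes K :: "'a::topological_space set"
  assumes "compact K" and N: "\<And>x. x \<in> K \<Longrightarrow> open (N x) \<and> x \<in> N x"
  obtains P s where "finite P" "P \<subseteq> K" "\<And>x. x \<in> K \<Longrightarrow> s x \<in> P \<and> x \<in> N (s x)"
    "s \<in> borel \<rightarrow>\<^sub>M count_space UNIV"
proof -
  obtain P where P: "P \<subseteq> K" "finite P" "K \<subseteq> (\<Union>x\<in>P. N x)"
    using compactE_image[OF assms(1), of K N] N by blast
  have "\<exists>s. s \<in> borel \<rightarrow>\<^sub>M count_space UNIV \<and> (\<forall>x\<in>\<Union>(N ` P). s x \<in> P \<and> x \<in> N (s x))"
    using P(2,1)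
  proof (induction rule: finite_induct)
    case empty
    show ?case by (rule exI[of _ "\<lambda>_. undefined"]) auto
  next
    case (insert a P)
    then obtain s where s: "s \<in> borel \<rightarrow>\<^sub>M count_space UNIV"
      "\<forall>x\<in>\<Union>(N ` P). s x \<in> P \<and> x \<in> N (s x)" by auto
    have "N a \<in> sets borel" using N insert by auto
    then show ?case
      using s by (intro exI[of _ "\<lambda>x. if x \<in> N a then a else s x"]) auto
  qed
  then obtain s where "s \<in> borel \<rightarrow>\<^sub>M count_space UNIV" "\<forall>x\<in>\<Union>(N ` P). s x \<in> P \<and> x \<in> N (s x)"
    by blast
  with P show thesis by (intro that[of P s]) auto
qed

section \<open>Compactly supported continuous functions\<close>

definition compactly_supported :: "('a::topological_space \<Rightarrow> 'b::real_normed_vector) \<Rightarrow> bool" where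
  "compactly_supported f \<longleftrightarrow>
     continuous_on UNIV f \<and> (\<exists>K. compact K \<and> (\<forall>x. x \<notin> K \<longrightarrow> f x = 0))"

lemma compactly_supported_measurable [measurable_dest]:
  "compactly_supported f \<Longrightarrow> f \<in> borel_measurable borel"
  by (auto simp: compactly_supported_def intro!: borel_measurable_continuous_onI)

lemma compactly_supported_bounded:
  assumes "compactly_supported f"
  obtains B where "\<And>x. norm (f x) \<le> B" "B > 0"
proof -
  obtain K where K: "compact K" "\<And>x. x \<notin> K \<Longrightarrow> f x = 0"
    using assms by (auto simp: compactly_supported_def)
  have "compact (f ` K)"
    using assms K by (intro compact_continuous_image)
      (auto simp: compactly_supported_def intro: continuous_on_subset)
  then obtain B where B: "B > 0" "\<forall>x\<in>f ` K. norm x \<le> B"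
    using compact_imp_bounded bounded_pos by blast
  then have "norm (f x) \<le> B" for x
    using K by (cases "x \<in> K") auto
  then show thesis using B that by blast
qed

lemma compactly_supported_compose:
  assumes "compactly_supported f" "continuous_on UNIV h" "compact L"
    and "\<And>x. f (h x) \<noteq> 0 \<Longrightarrow> x \<in> L"
  shows "compactly_supported (\<lambda>x. f (h x))"
  using assms unfolding compactly_supported_def
  by (auto intro!: continuous_on_compose2[of UNIV f UNIV h])

lemma compactly_supported_add:
  assumes "compactly_supported f" "compactly_supported g"
  shows "compactly_supported (\<lambda>x. f x + g x)"
proof -
  obtain K L where "compact K" "compact L" "\<forall>x. x \<notin> K \<longrightarrow> f x = 0" "\<forall>x. x \<notin> L \<longrightarrow> g x = 0"
    using assms by (auto simp: compactly_supported_def)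
  then have "compact (K \<union> L) \<and> (\<forall>x. x \<notin> K \<union> L \<longrightarrow> f x + g x = 0)" by auto
  then show ?thesis
    using assms unfolding compactly_supported_def by (blast intro: continuous_intros)
qed

text \<open>
  Continuity in two variables and compactness of the support give uniformity over all points: if
  \<open>x\<close> is outside the support but \<open>v + x\<close> is not, then one translates back from \<open>v + x\<close> by \<open>- v\<close>.
\<close>
lemma compactly_supported_uniformly_continuous_left:
  fixes f :: "'a::topological_group_add \<Rightarrow> 'b::real_normed_vector"
  assumes "compactly_supported f" "\<epsilon> > 0"
  obtains V where "open V" "0 \<in> V" "\<And>v x. v \<in> V \<Longrightarrow> norm (f (v + x) - f x) \<le> \<epsilon>"
proof -
  obtain K where K: "compact K" "\<And>x. x \<notin> K \<Longrightarrow> f x = 0"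
    using assms by (auto simp: compactly_supported_def)
  have "continuous_on (UNIV \<times> K) (\<lambda>(v, x). f (v + x))"
    using assms(1) unfolding compactly_supported_def split_beta'
    by (auto intro!: continuous_on_compose2[of UNIV f] continuous_intros)
  from continuous_on_prod_compactE[OF this K(1) UNIV_I assms(2), of 0] obtain X where
    X: "0 \<in> X" "open X" and
    "\<forall>v\<in>X \<inter> UNIV. \<forall>x\<in>K. dist (case (v, x) of (v, x) \<Rightarrow> f (v + x)) (case (0, x) of (v, x) \<Rightarrow> f (v + x)) \<le> \<epsilon>"
    by blast
  then have X3: "norm (f (v + x) - f x) \<le> \<epsilon>" if "v \<in> X" "x \<in> K" for v x
    using that by (simp add: dist_norm)
  obtain V where V: "open V" "0 \<in> V" "V \<subseteq> X" "\<And>v. v \<in> V \<Longrightarrow> - v \<in> V"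
    using symmetric_nhd[OF X(2,1)] by blast
  have "norm (f (v + x) - f x) \<le> \<epsilon>" if v: "v \<in> V" for v x
  proof (cases "x \<in> K")
    case True
    then show ?thesis using X3 V v by blast
  next
    case False
    show ?thesis
    proof (cases "v + x \<in> K")
      case True
      then have "norm (f (- v + (v + x)) - f (v + x)) \<le> \<epsilon>" using X3 V v by blast
      then show ?thesis by (simp add: add.assoc[symmetric] norm_minus_commute)
    qed (use K False assms in auto)
  qed
  with V that show thesis by blast
qed

lemma compactly_supported_uniformly_continuous_right:
  fixes f :: "'a::topological_group_add \<Rightarrow> 'b::real_normed_vector"
  assumes "compactly_supported f" "\<epsilon> > 0"
  obtains V where "open V" "0 \<in> V" "\<And>v x. v \<in> V \<Longrightarrow> norm (f (x + v) - f x) \<le> \<epsilon>"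
proof -
  obtain K where K: "compact K" "\<And>x. x \<notin> K \<Longrightarrow> f x = 0"
    using assms by (auto simp: compactly_supported_def)
  have "continuous_on UNIV (\<lambda>x. f (- x))"
    using assms(1) unfolding compactly_supported_def
    by (auto intro!: continuous_on_compose2[of UNIV f] continuous_intros)
  moreover have "compact (uminus ` K)"
    using K by (intro compact_continuous_image continuous_intros)
  moreover have "\<forall>x. x \<notin> uminus ` K \<longrightarrow> f (- x) = 0"
    using K(2) by (metis image_eqI minus_minus)
  ultimately have "compactly_supported (\<lambda>x. f (- x))"
    unfolding compactly_supported_def by blast
  then obtain V where V: "open V" "0 \<in> V" "\<And>v x. v \<in> V \<Longrightarrow> norm (f (- (v + x)) - f (- x)) \<le> \<epsilon>"
    using compactly_supported_uniformly_continuous_left[OF _ assms(2)] by blast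
  show thesis
  proof
    show "open (uminus -` V)" using V by (intro open_vimage continuous_intros)
    show "0 \<in> uminus -` V" using V by simp
    show "norm (f (x + v) - f x) \<le> \<epsilon>" if "v \<in> uminus -` V" for v x
      using V(3)[of "- v" "- x"] that by (simp add: minus_add)
  qed
qed

context
  assumes lc: "locally_compact_space (euclidean :: 'a::{topological_group_add,t2_space} topology)"
begin

lemma Hausdorff_euclidean: "Hausdorff_space (euclidean :: 'a topology)"
  unfolding Hausdorff_space_def disjnt_def using hausdorff by fastforce

lemma regular_euclidean: "regular_space (euclidean :: 'a topology)"
  by (rule locally_compact_Hausdorff_imp_regular_space[OF lc Hausdorff_euclidean])

lemma compact_nhd:
  fixes U :: "'a set"
  assumes "open U" "x \<in> U"
  obtains V K where "open V" "compact K" "x \<in> V" "V \<subseteq> K" "K \<subseteq> U"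
proof -
  have "neighbourhood_base_of (compactin euclidean) (euclidean :: 'a topology)"
    using lc locally_compact_space_neighbourhood_base[OF disjI1[OF Hausdorff_euclidean]] by simp
  then show thesis
    using assms that unfolding neighbourhood_base_of
    by (simp add: open_openin[symmetric]) (metis (no_types))
qed

lemma compact_nhd_of_compact:
  fixes C :: "'a set"
  assumes "compact C" "open U" "C \<subseteq> U"
  obtains V K where "open V" "compact K" "C \<subseteq> V" "V \<subseteq> K" "K \<subseteq> U"
proof -
  have "\<forall>x\<in>C. \<exists>V K. open V \<and> compact K \<and> x \<in> V \<and> V \<subseteq> K \<and> K \<subseteq> U"
  proof
    fix x assume "x \<in> C"
    then have "x \<in> U" using assms(3) by blast
    from compact_nhd[OF assms(2) this]
    show "\<exists>V K. open V \<and> compact K \<and> x \<in> V \<and> V \<subseteq> K \<and> K \<subseteq> U" by metis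
  qed
  then obtain V K where VK: "\<forall>x\<in>C. open (V x) \<and> compact (K x) \<and> x \<in> V x \<and> V x \<subseteq> K x \<and> K x \<subseteq> U"
    by metis
  obtain P where P: "P \<subseteq> C" "finite P" "C \<subseteq> (\<Union>x\<in>P. V x)"
    using compactE_image[OF assms(1), of C V] VK by blast
  show thesis
  proof
    show "open (\<Union>x\<in>P. V x)" "compact (\<Union>x\<in>P. K x)"
      using VK P by (auto intro!: compact_UN)
    show "(\<Union>x\<in>P. V x) \<subseteq> (\<Union>x\<in>P. K x)" "(\<Union>x\<in>P. K x) \<subseteq> U"
      using VK P by blast+
  qed fact
qed

lemma compactly_supported_Urysohn:
  fixes C :: "'a set"
  assumes "compact C" "open U" "C \<subseteq> U"
  obtains \<phi> :: "'a \<Rightarrow> real" where "compactly_supported \<phi>" "\<And>x. 0 \<le> \<phi> x" "\<And>x. \<phi> x \<le> 1"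
    "\<And>x. x \<in> C \<Longrightarrow> \<phi> x = 1" "\<And>x. x \<notin> U \<Longrightarrow> \<phi> x = 0"
proof -
  obtain V K where VK: "open V" "compact K" "C \<subseteq> V" "V \<subseteq> K" "K \<subseteq> U"
    using compact_nhd_of_compact[OF assms] by blast
  have "completely_regular_space (euclidean :: 'a topology)"
    using locally_compact_regular_imp_completely_regular_space[OF lc] regular_euclidean by simp
  moreover have "closedin euclidean (- V)" "disjnt C (- V)"
    using VK by (auto simp: disjnt_def closed_closedin[symmetric])
  ultimately obtain \<phi> where \<phi>: "continuous_map euclidean (top_of_set {0..1::real}) \<phi>"
    "\<phi> ` (- V) \<subseteq> {0}" "\<phi> ` C \<subseteq> {1}"
    using Urysohn_completely_regular_compact_closed[of 0 1 euclidean C "- V"] assms(1) by auto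
  then have cont: "continuous_on UNIV \<phi>" and range: "\<phi> x \<in> {0..1}" for x
    by (auto simp: continuous_map_in_subtopology)
  have zero: "\<phi> x = 0" if "x \<notin> V" for x
    using \<phi>(2) that by (auto simp: image_subset_iff)
  show thesis
  proof
    show "compactly_supported \<phi>"
      unfolding compactly_supported_def
      using cont VK(2) zero VK(4) by (intro conjI exI[of _ K]) auto
    show "0 \<le> \<phi> x" "\<phi> x \<le> 1" for x using range[of x] by auto
    show "\<phi> x = 1" if "x \<in> C" for x using that \<phi>(3) by auto
    show "\<phi> x = 0" if "x \<notin> U" for x using that zero VK by auto
  qed
qed

end

section \<open>Haar measure and its uniqueness\<close>

locale locally_compact_haar =
  fixes \<mu> :: "'a::{topological_group_add,t2_space} measure"
  assumes lc: "locally_compact_space (euclidean :: 'a topology)"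
    and haar: "left_haar_measure \<mu>"
begin

lemma sets_eq [measurable_cong]: "sets \<mu> = sets borel"
  using haar by (simp add: left_haar_measure_def)

lemma space_eq [simp]: "space \<mu> = UNIV"
  using sets_eq_imp_space_eq[OF sets_eq] by simp

lemma borel_measurable_eq: "borel_measurable \<mu> = borel_measurable borel"
  by (rule measurable_cong_sets) (simp_all add: sets_eq)

lemma measurable_translation [measurable, simp]:
  "(+) x \<in> borel_measurable \<mu>" "(\<lambda>y. y + x) \<in> borel_measurable \<mu>"
  unfolding borel_measurable_eq by (auto intro!: borel_measurable_continuous_onI continuous_intros)

lemma emeasure_left_translation:
  "A \<in> sets borel \<Longrightarrow> emeasure \<mu> ((+) x ` A) = emeasure \<mu> A"
  using haar by (simp add: left_haar_measure_def)

lemma emeasure_compact_finite: "compact K \<Longrightarrow> emeasure \<mu> K < \<infinity>"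
  using haar by (simp add: left_haar_measure_def)

lemma inner_regular:
  "open U \<Longrightarrow> emeasure \<mu> U = (SUP K\<in>{K. compact K \<and> K \<subseteq> U}. emeasure \<mu> K)"
  using haar by (simp add: left_haar_measure_def)

lemma outer_regular:
  "A \<in> sets borel \<Longrightarrow> emeasure \<mu> A = (INF U\<in>{U. open U \<and> A \<subseteq> U}. emeasure \<mu> U)"
  using haar by (simp add: left_haar_measure_def)

lemma distr_left_translation: "distr \<mu> borel ((+) x) = \<mu>"
proof (rule measure_eqI)
  fix A assume "A \<in> sets (distr \<mu> borel ((+) x))"
  then have A: "A \<in> sets borel" by simp
  have "(+) x -` A = (+) (- x) ` A"
  proof (intro set_eqI iffI)
    fix y assume "y \<in> (+) x -` A"
    then show "y \<in> (+) (- x) ` A"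
      by (intro image_eqI[of _ _ "x + y"]) (simp_all add: add.assoc[symmetric])
  next
    fix y assume "y \<in> (+) (- x) ` A"
    then show "y \<in> (+) x -` A"
      by (auto simp: add.assoc[symmetric])
  qed
  then show "emeasure (distr \<mu> borel ((+) x)) A = emeasure \<mu> A"
    using emeasure_left_translation[OF A, of "- x"] A by (simp add: emeasure_distr)
qed (simp add: sets_eq)

lemma integral_left_translation:
  fixes f :: "'a \<Rightarrow> 'b::{banach, second_countable_topology}"
  assumes "f \<in> borel_measurable borel"
  shows "(LINT y|\<mu>. f (x + y)) = (LINT y|\<mu>. f y)"
  using integral_distr[of "(+) x" \<mu> borel f] assms by (simp add: distr_left_translation)

lemma integrable_left_translation:
  fixes f :: "'a \<Rightarrow> 'b::{banach, second_countable_topology}"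
  assumes "f \<in> borel_measurable borel"
  shows "integrable \<mu> (\<lambda>y. f (x + y)) \<longleftrightarrow> integrable \<mu> f"
  using integrable_distr_eq[of "(+) x" \<mu> borel f] assms by (simp add: distr_left_translation)

text \<open>
  Finitely many translates of a nonempty open set cover a given compact set, so if the open set were
  null, all compact sets would be null, and by inner regularity the whole group.
\<close>
lemma emeasure_open_pos:
  assumes "open U" "x \<in> U"
  shows "emeasure \<mu> U > 0"
proof (rule ccontr)
  assume "\<not> ?thesis"
  then have U0: "emeasure \<mu> U = 0" by simp
  have "emeasure \<mu> K = 0" if K: "compact K" for K
  proof -
    have op: "open ((+) (y - x) ` U)" for y using assms(1) by (rule open_left_translation)
    have "y \<in> (+) (y - x) ` U" for y
      using assms(2) by (intro image_eqI[of _ _ x]) auto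
    then have "K \<subseteq> (\<Union>y\<in>K. (+) (y - x) ` U)" by blast
    from compactE_image[OF K op this] obtain P where
      P: "finite P" "K \<subseteq> (\<Union>y\<in>P. (+) (y - x) ` U)" by metis
    have "emeasure \<mu> K \<le> emeasure \<mu> (\<Union>y\<in>P. (+) (y - x) ` U)"
      using op P(2) by (intro emeasure_mono) (auto simp: sets_eq intro!: borel_open)
    also have "\<dots> \<le> (\<Sum>y\<in>P. emeasure \<mu> ((+) (y - x) ` U))"
      using op P(1) by (intro emeasure_subadditive_finite) (auto simp: sets_eq)
    also have "\<dots> = 0"
      using U0 assms(1) by (simp add: emeasure_left_translation)
    finally show ?thesis by simp
  qed
  then have "emeasure \<mu> UNIV = 0"
    using inner_regular[of UNIV] by (simp add: SUP_constant bot_ennreal)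
  then show False using haar by (simp add: left_haar_measure_def)
qed

lemma integrable_compactly_supported:
  fixes f :: "'a \<Rightarrow> 'b::{banach, second_countable_topology}"
  assumes "compactly_supported f"
  shows "integrable \<mu> f"
proof -
  obtain K where K: "compact K" "\<And>x. x \<notin> K \<Longrightarrow> f x = 0"
    using assms by (auto simp: compactly_supported_def)
  obtain B where B: "\<And>x. norm (f x) \<le> B"
    using compactly_supported_bounded[OF assms] by metis
  show ?thesis
  proof (rule integrableI_bounded_set[where A = K and B = B])
    show "K \<in> sets \<mu>" using K by (simp add: sets_eq borel_compact)
    show "f \<in> borel_measurable \<mu>"
      using assms by (simp add: borel_measurable_eq compactly_supported_measurable)
  qed (use K B emeasure_compact_finite in auto)
qed

lemma integral_compactly_supported_pos:
  fixes f :: "'a \<Rightarrow> real"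
  assumes f: "compactly_supported f" and nonneg: "\<And>x. 0 \<le> f x" and pos: "0 < f x"
  shows "0 < (LINT x|\<mu>. f x)"
proof (rule ccontr)
  assume "\<not> ?thesis"
  moreover have "0 \<le> (LINT x|\<mu>. f x)" using nonneg by simp
  ultimately have "(LINT x|\<mu>. f x) = 0" by simp
  then have "AE x in \<mu>. f x = 0"
    using integral_nonneg_eq_0_iff_AE[OF integrable_compactly_supported[OF f]] nonneg by simp
  moreover have op: "open {x. f x \<noteq> 0}"
    using f by (auto simp: compactly_supported_def intro!: open_Collect_neq continuous_intros)
  ultimately have "emeasure \<mu> {x. f x \<noteq> 0} = 0"
    by (subst (asm) AE_iff_measurable[OF _ refl]) (auto simp: sets_eq)
  then show False using emeasure_open_pos[OF op, of x] pos by simp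
qed

end

text \<open>
  Haar measure need not be sigma-finite, and \<open>f x * \<phi> (- x + y)\<close> is not obviously measurable for the
  product of the two Borel algebras. But this function lives on a product of compact sets, where
  both measures are finite, and it is the uniform limit of functions that arise by replacing \<open>x\<close>
  inside \<open>\<phi>\<close> by a finitely valued Borel function of \<open>x\<close>.
\<close>
lemma Fubini_convolution:
  fixes \<mu> \<nu> :: "'a::{topological_group_add,t2_space} measure" and f \<phi> :: "'a \<Rightarrow> real"
  assumes sets: "sets \<mu> = sets borel" "sets \<nu> = sets borel"
    and fin: "\<And>K. compact K \<Longrightarrow> emeasure \<mu> K < \<infinity>" "\<And>K. compact K \<Longrightarrow> emeasure \<nu> K < \<infinity>"
    and f: "compactly_supported f" and \<phi>: "compactly_supported \<phi>"
  shows "(LINT x|\<mu>. LINT y|\<nu>. f x * \<phi> (- x + y)) = (LINT y|\<nu>. LINT x|\<mu>. f x * \<phi> (- x + y))"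
    and "integrable \<nu> (\<lambda>y. LINT x|\<mu>. f x * \<phi> (- x + y))"
proof -
  note sets[measurable_cong]
  have [measurable]: "f \<in> borel_measurable borel" "\<phi> \<in> borel_measurable borel"
    using f \<phi> by (simp_all add: compactly_supported_measurable)
  obtain K where K: "compact K" "\<And>x. x \<notin> K \<Longrightarrow> f x = 0"
    using f by (auto simp: compactly_supported_def)
  obtain K' where K': "compact K'" "\<And>x. x \<notin> K' \<Longrightarrow> \<phi> x = 0"
    using \<phi> by (auto simp: compactly_supported_def)
  \<comment> \<open>The product \<open>f x * \<phi> (- x + y)\<close> vanishes unless \<open>x \<in> K\<close> and \<open>y \<in> L\<close>.\<close>
  define L where "L = (\<lambda>(x, y). x + y) ` (K \<times> K')"
  have L: "compact L" unfolding L_def using K(1) K'(1) by (rule compact_sumset)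
  have [measurable]: "K \<in> sets borel" "L \<in> sets borel"
    using K(1) L by (auto intro: borel_compact)
  obtain Bf where Bf: "\<And>x. norm (f x) \<le> Bf" "Bf > 0" using compactly_supported_bounded[OF f] by metis
  obtain B\<phi> where B\<phi>: "\<And>x. norm (\<phi> x) \<le> B\<phi>" "B\<phi> > 0"
    using compactly_supported_bounded[OF \<phi>] by metis
  have \<phi>_left: "(\<lambda>y. \<phi> (- p + y)) \<in> borel_measurable borel" for p
    by (rule measurable_compose[OF borel_measurable_continuous_onI]) (auto intro!: continuous_intros)
  have \<phi>_right: "(\<lambda>x. \<phi> (- x + p)) \<in> borel_measurable borel" for p
    by (rule measurable_compose[OF borel_measurable_continuous_onI]) (auto intro!: continuous_intros)
  define h where "h x y = f x * \<phi> (- x + y)" for x y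
  have h0: "h x y = 0" if "x \<notin> K \<or> y \<notin> L" for x y
  proof (rule ccontr)
    assume nz: "h x y \<noteq> 0"
    then have "x \<in> K" "- x + y \<in> K'" using K K' by (auto simp: h_def)
    then have "x + (- x + y) \<in> L" unfolding L_def by (force simp del: add_minus_cancel)
    then show False using that \<open>x \<in> K\<close> by simp
  qed
  have meas_h: "(\<lambda>z. h (fst z) (snd z)) \<in> borel_measurable (borel \<Otimes>\<^sub>M borel)"
  proof -
    have "\<exists>g. g \<in> borel_measurable (borel \<Otimes>\<^sub>M borel) \<and>
        (\<forall>x y. norm (g (x, y) - h x y) \<le> Bf * (1 / real (Suc n)))" for n
    proof -
      have "0 < 1 / real (Suc n)" by simp
      from compactly_supported_uniformly_continuous_left[OF \<phi> this]
      obtain V where V: "open V" "0 \<in> V" "\<And>v x. v \<in> V \<Longrightarrow> norm (\<phi> (v + x) - \<phi> x) \<le> 1 / real (Suc n)"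
        by metis
      have "open {x. - x + p \<in> V} \<and> p \<in> {x. - x + p \<in> V}" for p
      proof -
        have "continuous_on UNIV (\<lambda>x. - x + p)" by (intro continuous_intros)
        then show ?thesis
          using V(2) open_vimage[OF V(1), of "\<lambda>x. - x + p"] by (simp add: vimage_def)
      qed
      then obtain P s where P: "finite P" "P \<subseteq> K" "\<And>x. x \<in> K \<Longrightarrow> s x \<in> P \<and> x \<in> {z. - z + s x \<in> V}"
        and s: "s \<in> borel \<rightarrow>\<^sub>M count_space UNIV"
        using finite_Borel_selection[OF K(1), of "\<lambda>p. {x. - x + p \<in> V}"] by metis
      define g where "g z = (\<Sum>p\<in>P. indicat_real (s -` {p}) (fst z) * f (fst z) * \<phi> (- p + snd z))" for z
      have [measurable]: "s -` {p} \<in> sets borel" for p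
        using measurable_sets[OF s, of "{p}"] by simp
      have "(\<lambda>z. indicat_real (s -` {p}) (fst z)) \<in> borel_measurable (borel \<Otimes>\<^sub>M borel)"
        "(\<lambda>z. f (fst z)) \<in> borel_measurable (borel \<Otimes>\<^sub>M borel)" for p
        by (rule measurable_compose[OF measurable_fst], simp)+
      moreover have "(\<lambda>z. \<phi> (- p + snd z)) \<in> borel_measurable (borel \<Otimes>\<^sub>M borel)" for p
        using measurable_compose[OF measurable_snd \<phi>_left] .
      ultimately have "g \<in> borel_measurable (borel \<Otimes>\<^sub>M borel)"
        unfolding g_def[abs_def] by (intro borel_measurable_sum borel_measurable_times)
      moreover have "norm (g (x, y) - h x y) \<le> Bf * (1 / real (Suc n))" for x y
      proof (cases "x \<in> K")
        case True
        have "g (x, y) = (\<Sum>p\<in>P. if p = s x then f x * \<phi> (- p + y) else 0)"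
          unfolding g_def by (intro sum.cong) (auto simp: indicator_def)
        also have "\<dots> = f x * \<phi> (- s x + y)"
          using P True by simp
        finally have "norm (g (x, y) - h x y) = norm (f x) * norm (\<phi> (- x + y) - \<phi> (- s x + y))"
          by (simp add: h_def abs_mult[symmetric] right_diff_distrib[symmetric])
            (simp add: abs_mult abs_minus_commute)
        also have "- x + y = (- x + s x) + (- s x + y)"
          by (metis add.assoc add.right_neutral add.right_inverse add_minus_cancel)
        also have "norm (f x) * norm (\<phi> (- x + s x + (- s x + y)) - \<phi> (- s x + y)) \<le> Bf * (1 / real (Suc n))"
          using Bf V(3) P(3)[OF True] by (intro mult_mono) auto
        finally show ?thesis .
      next
        case False
        then have "f x = 0" using K by simp
        then show ?thesis using Bf by (simp add: g_def h_def)
      qed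
      ultimately show ?thesis by blast
    qed
    then obtain g where g: "\<And>n. g n \<in> borel_measurable (borel \<Otimes>\<^sub>M borel)"
      "\<And>n x y. norm (g n (x, y) - h x y) \<le> Bf * (1 / real (Suc n))"
      by metis
    show ?thesis
    proof (rule borel_measurable_LIMSEQ_metric[OF g(1)])
      fix z :: "'a \<times> 'a"
      have lim: "(\<lambda>n. Bf * (1 / real (Suc n))) \<longlonglongrightarrow> 0"
        using tendsto_mult_right_zero[OF LIMSEQ_inverse_real_of_nat, of Bf]
        by (simp only: inverse_eq_divide)
      have le: "norm (g n z - h (fst z) (snd z)) \<le> Bf * (1 / real (Suc n))" for n
        using g(2)[of n "fst z" "snd z"] by (simp only: prod.collapse)
      have "(\<lambda>n. g n z - h (fst z) (snd z)) \<longlonglongrightarrow> 0"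
        by (rule Lim_null_comparison[OF always_eventually[OF allI[OF le]] lim])
      then show "(\<lambda>n. g n z) \<longlonglongrightarrow> h (fst z) (snd z)" by (simp add: LIM_zero_iff)
    qed
  qed
  define M where "M = density \<mu> (\<lambda>x. ennreal (indicat_real K x))"
  define N where "N = density \<nu> (\<lambda>x. ennreal (indicat_real L x))"
  have setsMN [measurable_cong]: "sets M = sets borel" "sets N = sets borel"
    by (simp_all add: M_def N_def sets)
  interpret M: finite_measure M
    by (rule finite_measureI)
      (use fin(1)[OF K(1)] in \<open>simp add: M_def emeasure_density sets_eq_imp_space_eq[OF sets(1)] ennreal_indicator\<close>)
  interpret N: finite_measure N
    by (rule finite_measureI)
      (use fin(2)[OF L] in \<open>simp add: N_def emeasure_density sets_eq_imp_space_eq[OF sets(2)] ennreal_indicator\<close>)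
  interpret MN: finite_measure "M \<Otimes>\<^sub>M N"
    by (rule finite_measure_pair_measure) unfold_locales
  interpret P: pair_sigma_finite M N ..
  have h_meas: "(\<lambda>z. h (fst z) (snd z)) \<in> borel_measurable (M \<Otimes>\<^sub>M N)"
    using meas_h measurable_cong_sets[OF sets_pair_measure_cong[OF setsMN] refl] by blast
  have "norm (h x y) \<le> Bf * B\<phi>" for x y
    unfolding h_def norm_mult using Bf B\<phi> by (intro mult_mono) auto
  then have int: "integrable (M \<Otimes>\<^sub>M N) (\<lambda>z. h (fst z) (snd z))"
    using h_meas by (intro MN.integrable_const_bound[where B = "Bf * B\<phi>"]) auto
  have hx: "(\<lambda>x. h x y) \<in> borel_measurable borel" for y
    unfolding h_def using \<phi>_right by simp
  have hy: "h x \<in> borel_measurable borel" for x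
    unfolding h_def[abs_def] using \<phi>_left by simp
  have M_eq: "(LINT x|M. F x) = (LINT x|\<mu>. F x)"
    if "F \<in> borel_measurable borel" "\<And>x. x \<notin> K \<Longrightarrow> F x = 0" for F :: "'a \<Rightarrow> real"
  proof -
    have "(LINT x|M. F x) = (LINT x|\<mu>. indicat_real K x *\<^sub>R F x)"
      unfolding M_def using that(1) by (intro integral_density) auto
    also have "\<dots> = (LINT x|\<mu>. F x)"
      using that(2) by (intro Bochner_Integration.integral_cong) (auto simp: indicator_def)
    finally show ?thesis .
  qed
  have N_eq: "(LINT x|N. F x) = (LINT x|\<nu>. F x)" "integrable N F \<longleftrightarrow> integrable \<nu> F"
    if F: "F \<in> borel_measurable borel" "\<And>x. x \<notin> L \<Longrightarrow> F x = 0" for F :: "'a \<Rightarrow> real"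
  proof -
    have "(\<lambda>x. indicat_real L x *\<^sub>R F x) = F"
      using F(2) by (intro ext) (auto simp: indicator_def)
    then show "(LINT x|N. F x) = (LINT x|\<nu>. F x)" "integrable N F \<longleftrightarrow> integrable \<nu> F"
      unfolding N_def using F(1) integral_density[of F \<nu> "indicat_real L"] integrable_density[of F \<nu> "indicat_real L"]
      by auto
  qed
  have J: "(LINT y|N. h x y) = (LINT y|\<nu>. h x y)" "(LINT x|M. h x y) = (LINT x|\<mu>. h x y)" for x y
    using M_eq[OF hx] N_eq(1)[OF hy] h0 by auto
  have J_meas: "(\<lambda>x. LINT y|\<nu>. h x y) \<in> borel_measurable borel"
    "(\<lambda>y. LINT x|\<mu>. h x y) \<in> borel_measurable borel"
    using borel_measurable_integrable[OF P.integrable_fst'[OF int]]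
      borel_measurable_integrable[OF P.integrable_snd[of h]] int
    by (simp_all add: J split_beta' setsMN measurable_cong_sets[OF setsMN(1) refl] measurable_cong_sets[OF setsMN(2) refl])
  have J0: "(LINT y|\<nu>. h x y) = 0" if "x \<notin> K" for x using h0 that by simp
  have J0': "(LINT x|\<mu>. h x y) = 0" if "y \<notin> L" for y using h0 that by simp
  have outer1: "(LINT x|M. LINT y|\<nu>. h x y) = (LINT x|\<mu>. LINT y|\<nu>. h x y)"
    by (rule M_eq[OF J_meas(1)]) (rule J0)
  have outer2: "(LINT y|N. LINT x|\<mu>. h x y) = (LINT y|\<nu>. LINT x|\<mu>. h x y)"
    "integrable N (\<lambda>y. LINT x|\<mu>. h x y) \<longleftrightarrow> integrable \<nu> (\<lambda>y. LINT x|\<mu>. h x y)"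
    by (rule N_eq[OF J_meas(2)], rule J0', assumption)+
  have "(LINT y|N. LINT x|M. h x y) = (LINT x|M. LINT y|N. h x y)"
    using int by (intro P.Fubini_integral) (simp add: split_beta')
  then have "(LINT x|\<mu>. LINT y|\<nu>. h x y) = (LINT y|\<nu>. LINT x|\<mu>. h x y)"
    unfolding J outer1 outer2(1) by (rule sym)
  then show "(LINT x|\<mu>. LINT y|\<nu>. f x * \<phi> (- x + y)) = (LINT y|\<nu>. LINT x|\<mu>. f x * \<phi> (- x + y))"
    unfolding h_def .
  have "integrable N (\<lambda>y. LINT x|M. h x y)"
    using int by (intro P.integrable_snd) (simp add: split_beta')
  then have "integrable \<nu> (\<lambda>y. LINT x|\<mu>. h x y)"
    unfolding J outer2(2) .
  then show "integrable \<nu> (\<lambda>y. LINT x|\<mu>. f x * \<phi> (- x + y))"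
    unfolding h_def .
qed

context locally_compact_haar
begin

lemma integral_norm_le_integral:
  fixes f :: "'c \<Rightarrow> 'd::{banach, second_countable_topology}"
  assumes "integrable M f" "integrable M g" "\<And>x. norm (f x) \<le> g x"
  shows "norm (LINT x|M. f x) \<le> (LINT x|M. g x)"
proof -
  have "norm (LINT x|M. f x) \<le> (LINT x|M. norm (f x))" by (rule integral_norm_bound)
  also have "\<dots> \<le> (LINT x|M. g x)" using assms by (intro integral_mono) auto
  finally show ?thesis .
qed

text \<open>
  Testing against a symmetric bump \<open>\<phi>\<close>: interchange the integrals of \<open>f x * \<phi> (- x + y)\<close> and
  substitute \<open>y + x\<close> for \<open>x\<close> in the inner integral, which becomes the integral of
  \<open>f (y + x) * \<phi> (- x)\<close>. If \<open>\<phi>\<close> is supported near \<open>0\<close>, then \<open>f (y + x)\<close> is nearly \<open>f y\<close>.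
\<close>
lemma Haar_integrals_nearly_proportional:
  fixes f :: "'a \<Rightarrow> real"
  assumes \<nu>: "left_haar_measure \<nu>" and f: "compactly_supported f"
  obtains C where "C \<ge> 0" "\<And>\<epsilon>. \<epsilon> > 0 \<Longrightarrow>
    \<exists>U. open U \<and> 0 \<in> U \<and> (\<forall>\<phi> :: 'a \<Rightarrow> real. compactly_supported \<phi> \<and> (\<forall>x. 0 \<le> \<phi> x) \<and> (\<forall>x. \<phi> (- x) = \<phi> x) \<and>
      (\<forall>x. x \<notin> U \<longrightarrow> \<phi> x = 0) \<longrightarrow>
      \<bar>(LINT x|\<mu>. f x) * (LINT x|\<nu>. \<phi> x) - (LINT x|\<nu>. f x) * (LINT x|\<mu>. \<phi> x)\<bar>
        \<le> \<epsilon> * C * (LINT x|\<mu>. \<phi> x))"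
proof -
  interpret \<nu>: locally_compact_haar \<nu> using lc \<nu> by unfold_locales
  obtain K where K: "compact K" "\<And>x. x \<notin> K \<Longrightarrow> f x = 0"
    using f by (auto simp: compactly_supported_def)
  obtain V0 W :: "'a set" where W: "open V0" "compact W" "0 \<in> V0" "V0 \<subseteq> W"
    using compact_nhd[OF lc open_UNIV UNIV_I, of 0] by metis
  define S where "S = (\<lambda>(x, y). x - y) ` (K \<times> W)"
  have S: "compact S" unfolding S_def using K(1) W(2) by (rule compact_diffset)
  have S_meas: "S \<in> sets borel" using S by (rule borel_compact)
  have KS: "x \<in> S" if "x \<in> K" for x
    unfolding S_def using that W by (intro image_eqI[of _ _ "(x, 0)"]) auto
  show thesis
  proof (rule that[of "measure \<nu> S"])
    fix \<epsilon> :: real assume \<epsilon>: "\<epsilon> > 0"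
    obtain V where V: "open V" "0 \<in> V" "\<And>v x. v \<in> V \<Longrightarrow> norm (f (x + v) - f x) \<le> \<epsilon>"
      using compactly_supported_uniformly_continuous_right[OF f \<epsilon>] by metis
    have main: "\<bar>(LINT x|\<mu>. f x) * (LINT x|\<nu>. \<phi> x) - (LINT x|\<nu>. f x) * (LINT x|\<mu>. \<phi> x)\<bar>
        \<le> \<epsilon> * measure \<nu> S * (LINT x|\<mu>. \<phi> x)"
      if \<phi>: "compactly_supported \<phi>" and \<phi>0: "\<And>x. 0 \<le> \<phi> x" and sym: "\<And>x. \<phi> (- x) = \<phi> x"
        and supp: "\<And>x. x \<notin> V \<inter> V0 \<Longrightarrow> \<phi> x = 0" for \<phi> :: "'a \<Rightarrow> real"
    proof -
      have f_meas: "f \<in> borel_measurable borel" and \<phi>_meas: "\<phi> \<in> borel_measurable borel"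
        using f \<phi> by (simp_all add: compactly_supported_measurable)
      have f_right: "(\<lambda>x. f (x + y)) \<in> borel_measurable borel" for y
        by (rule measurable_compose[OF borel_measurable_continuous_onI f_meas]) (intro continuous_intros)
      have f_left: "(\<lambda>x. f (y + x)) \<in> borel_measurable borel" for y
        by (rule measurable_compose[OF borel_measurable_continuous_onI f_meas]) (intro continuous_intros)
      have \<phi>_refl: "(\<lambda>x. \<phi> (- x + y)) \<in> borel_measurable borel" for y
        by (rule measurable_compose[OF borel_measurable_continuous_onI \<phi>_meas]) (intro continuous_intros)
      have \<phi>_int: "integrable \<mu> \<phi>" using \<phi> by (rule integrable_compactly_supported)
      note Fub = Fubini_convolution[OF sets_eq \<nu>.sets_eq emeasure_compact_finite \<nu>.emeasure_compact_finite f \<phi>]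
      have inner: "(LINT x|\<mu>. f x * \<phi> (- x + y)) = (LINT x|\<mu>. f (y + x) * \<phi> x)" for y
      proof -
        have "(LINT x|\<mu>. f x * \<phi> (- x + y)) = (LINT x|\<mu>. f (y + x) * \<phi> (- (y + x) + y))"
          using integral_left_translation[of "\<lambda>x. f x * \<phi> (- x + y)" y] f_meas \<phi>_refl by simp
        also have "\<dots> = (LINT x|\<mu>. f (y + x) * \<phi> x)"
          by (intro Bochner_Integration.integral_cong) (simp_all add: minus_add add.assoc sym)
        finally show ?thesis .
      qed
      have "(LINT x|\<mu>. f x) * (LINT x|\<nu>. \<phi> x) = (LINT x|\<mu>. f x * (LINT y|\<nu>. \<phi> (- x + y)))"
        using \<nu>.integral_left_translation[OF \<phi>_meas] by simp
      also have "\<dots> = (LINT x|\<mu>. LINT y|\<nu>. f x * \<phi> (- x + y))" by simp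
      also have "\<dots> = (LINT y|\<nu>. LINT x|\<mu>. f x * \<phi> (- x + y))" by (rule Fub(1))
      also have "\<dots> = (LINT y|\<nu>. LINT x|\<mu>. f (y + x) * \<phi> x)" by (simp only: inner)
      finally have eq1: "(LINT x|\<mu>. f x) * (LINT x|\<nu>. \<phi> x) = (LINT y|\<nu>. LINT x|\<mu>. f (y + x) * \<phi> x)" .
      have int1: "integrable \<nu> (\<lambda>y. LINT x|\<mu>. f (y + x) * \<phi> x)"
        using Fub(2) unfolding inner .
      have int2: "integrable \<nu> (\<lambda>y. f y * (LINT x|\<mu>. \<phi> x))"
        using \<nu>.integrable_compactly_supported[OF f] by simp
      have eq2: "(LINT x|\<nu>. f x) * (LINT x|\<mu>. \<phi> x) = (LINT y|\<nu>. f y * (LINT x|\<mu>. \<phi> x))"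
        by simp
      have int_prod: "integrable \<mu> (\<lambda>x. f (y + x) * \<phi> x)" for y
      proof -
        obtain B where B: "\<And>x. norm (f x) \<le> B" "B > 0"
          using compactly_supported_bounded[OF f] by metis
        show ?thesis
        proof (rule Bochner_Integration.integrable_bound)
          show "integrable \<mu> (\<lambda>x. B * \<phi> x)" using \<phi>_int by simp
          show "(\<lambda>x. f (y + x) * \<phi> x) \<in> borel_measurable \<mu>"
            unfolding borel_measurable_eq using f_left \<phi>_meas by simp
          show "AE x in \<mu>. norm (f (y + x) * \<phi> x) \<le> norm (B * \<phi> x)"
            using B \<phi>0 by (intro AE_I2) (auto simp: abs_mult intro!: mult_right_mono)
        qed
      qed
      have pointwise: "\<bar>(LINT x|\<mu>. f (y + x) * \<phi> x) - f y * (LINT x|\<mu>. \<phi> x)\<bar>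
          \<le> \<epsilon> * (LINT x|\<mu>. \<phi> x) * indicat_real S y" for y
      proof (cases "y \<in> S")
        case True
        have "(LINT x|\<mu>. f (y + x) * \<phi> x) - f y * (LINT x|\<mu>. \<phi> x) = (LINT x|\<mu>. f (y + x) * \<phi> x - f y * \<phi> x)"
          using int_prod \<phi>_int by (subst Bochner_Integration.integral_diff) simp_all
        also have "\<bar>\<dots>\<bar> \<le> (LINT x|\<mu>. \<epsilon> * \<phi> x)"
          unfolding real_norm_def[symmetric]
        proof (rule integral_norm_le_integral)
          show "integrable \<mu> (\<lambda>x. f (y + x) * \<phi> x - f y * \<phi> x)"
            using int_prod \<phi>_int by simp
          show "integrable \<mu> (\<lambda>x. \<epsilon> * \<phi> x)" using \<phi>_int by simp
          fix x
          show "norm (f (y + x) * \<phi> x - f y * \<phi> x) \<le> \<epsilon> * \<phi> x"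
          proof (cases "x \<in> V")
            case True
            then have "\<bar>f (y + x) - f y\<bar> * \<phi> x \<le> \<epsilon> * \<phi> x"
              using V(3)[OF True, of y] \<phi>0 by (intro mult_right_mono) auto
            then show ?thesis
              using \<phi>0[of x] by (simp add: left_diff_distrib[symmetric] abs_mult)
          qed (use supp in simp)
        qed
        finally show ?thesis using True by simp
      next
        case False
        have zero: "f (y + x) * \<phi> x = 0" for x
        proof (rule ccontr)
          assume "f (y + x) * \<phi> x \<noteq> 0"
          then have "y + x \<in> K" "x \<in> W" using K(2) supp W(4) by auto
          then have "y \<in> S" unfolding S_def by (intro image_eqI[of _ _ "(y + x, x)"]) auto
          then show False using False by simp
        qed
        have "f y = 0" using False KS K(2) by blast
        then show ?thesis using False unfolding zero by simp
      qed
      have "\<bar>(LINT x|\<mu>. f x) * (LINT x|\<nu>. \<phi> x) - (LINT x|\<nu>. f x) * (LINT x|\<mu>. \<phi> x)\<bar>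
          = \<bar>LINT y|\<nu>. (LINT x|\<mu>. f (y + x) * \<phi> x) - f y * (LINT x|\<mu>. \<phi> x)\<bar>"
        unfolding eq1 eq2 using int1 int2 by (subst Bochner_Integration.integral_diff) simp_all
      also have "\<dots> \<le> (LINT y|\<nu>. \<epsilon> * (LINT x|\<mu>. \<phi> x) * indicat_real S y)"
        unfolding real_norm_def[symmetric]
      proof (rule integral_norm_le_integral)
        show "integrable \<nu> (\<lambda>y. (LINT x|\<mu>. f (y + x) * \<phi> x) - f y * (LINT x|\<mu>. \<phi> x))"
          using int1 int2 by simp
        show "integrable \<nu> (\<lambda>y. \<epsilon> * (LINT x|\<mu>. \<phi> x) * indicat_real S y)"
          using \<nu>.emeasure_compact_finite[OF S] S_meas
          by (intro integrable_mult_right integrable_real_indicator) (auto simp: \<nu>.sets_eq)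
      qed (use pointwise in simp)
      also have "\<dots> = \<epsilon> * measure \<nu> S * (LINT x|\<mu>. \<phi> x)"
        by simp
      finally show ?thesis .
    qed
    show "\<exists>U. open U \<and> 0 \<in> U \<and> (\<forall>\<phi> :: 'a \<Rightarrow> real. compactly_supported \<phi> \<and> (\<forall>x. 0 \<le> \<phi> x) \<and> (\<forall>x. \<phi> (- x) = \<phi> x) \<and>
      (\<forall>x. x \<notin> U \<longrightarrow> \<phi> x = 0) \<longrightarrow>
      \<bar>(LINT x|\<mu>. f x) * (LINT x|\<nu>. \<phi> x) - (LINT x|\<nu>. f x) * (LINT x|\<mu>. \<phi> x)\<bar>
        \<le> \<epsilon> * measure \<nu> S * (LINT x|\<mu>. \<phi> x))"
    proof (intro exI[of _ "V \<inter> V0"] conjI allI impI)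
      show "open (V \<inter> V0)" "0 \<in> V \<inter> V0" using V W by auto
      fix \<phi> :: "'a \<Rightarrow> real" assume "compactly_supported \<phi> \<and> (\<forall>x. 0 \<le> \<phi> x) \<and> (\<forall>x. \<phi> (- x) = \<phi> x) \<and>
        (\<forall>x. x \<notin> V \<inter> V0 \<longrightarrow> \<phi> x = 0)"
      then show "\<bar>(LINT x|\<mu>. f x) * (LINT x|\<nu>. \<phi> x) - (LINT x|\<nu>. f x) * (LINT x|\<mu>. \<phi> x)\<bar>
        \<le> \<epsilon> * measure \<nu> S * (LINT x|\<mu>. \<phi> x)"
        by (intro main) simp_all
    qed
  qed simp
qed

lemma symmetric_bump:
  fixes U :: "'a set"
  assumes "open U" "0 \<in> U"
  obtains \<phi> :: "'a \<Rightarrow> real" where "compactly_supported \<phi>" "\<And>x. 0 \<le> \<phi> x" "\<And>x. \<phi> (- x) = \<phi> x"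
    "\<And>x. x \<notin> U \<Longrightarrow> \<phi> x = 0" "\<phi> 0 > 0"
proof -
  obtain V where V: "open V" "0 \<in> V" "V \<subseteq> U" "\<And>v. v \<in> V \<Longrightarrow> - v \<in> V"
    using symmetric_nhd[OF assms] by metis
  have "compact {0::'a}" "{0} \<subseteq> V" using V by auto
  then obtain \<psi> :: "'a \<Rightarrow> real" where \<psi>: "compactly_supported \<psi>" "\<And>x. 0 \<le> \<psi> x"
    "\<And>x. x \<in> {0} \<Longrightarrow> \<psi> x = 1" "\<And>x. x \<notin> V \<Longrightarrow> \<psi> x = 0"
    using compactly_supported_Urysohn[OF lc _ V(1), of "{0}"] by metis
  obtain K where K: "compact K" "\<And>x. x \<notin> K \<Longrightarrow> \<psi> x = 0"
    using \<psi>(1) by (auto simp: compactly_supported_def)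
  have "compactly_supported (\<lambda>x. \<psi> (- x))"
  proof (rule compactly_supported_compose[OF \<psi>(1)])
    show "continuous_on UNIV (uminus :: 'a \<Rightarrow> 'a)" by (intro continuous_intros)
    show "compact (uminus ` K)" using K(1) by (intro compact_continuous_image continuous_intros)
    show "x \<in> uminus ` K" if "\<psi> (- x) \<noteq> 0" for x
      using that K(2)[of "- x"] by (intro image_eqI[of _ _ "- x"]) auto
  qed
  then have "compactly_supported (\<lambda>x. \<psi> x + \<psi> (- x))"
    using \<psi>(1) by (intro compactly_supported_add)
  moreover have "\<psi> x + \<psi> (- x) = 0" if "x \<notin> U" for x
  proof -
    have "x \<notin> V" "- x \<notin> V" using that V(3) V(4)[of "- x"] by auto
    then show ?thesis using \<psi>(4) by simp
  qed
  ultimately show thesis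
    using \<psi>(2,3) by (intro that[of "\<lambda>x. \<psi> x + \<psi> (- x)"]) (auto simp: add.commute)
qed

text \<open>
  For one bump with integrals \<open>a\<close> and \<open>b\<close> with respect to the two measures, the ratio \<open>b / a\<close> nearly
  converts the first integral into the second, for \<open>f\<close> and for \<open>g\<close> alike.
\<close>
lemma Haar_integrals_proportional:
  fixes f g :: "'a \<Rightarrow> real"
  assumes \<nu>: "left_haar_measure \<nu>" and f: "compactly_supported f" and g: "compactly_supported g"
  shows "(LINT x|\<mu>. f x) * (LINT x|\<nu>. g x) = (LINT x|\<nu>. f x) * (LINT x|\<mu>. g x)"
proof -
  let ?If = "LINT x|\<mu>. f x" and ?Jf = "LINT x|\<nu>. f x"
  let ?Ig = "LINT x|\<mu>. g x" and ?Jg = "LINT x|\<nu>. g x"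
  from Haar_integrals_nearly_proportional[OF \<nu> f] obtain C where C: "C \<ge> 0"
    "\<And>\<epsilon>. \<epsilon> > 0 \<Longrightarrow>
    \<exists>U. open U \<and> 0 \<in> U \<and> (\<forall>\<phi> :: 'a \<Rightarrow> real. compactly_supported \<phi> \<and> (\<forall>x. 0 \<le> \<phi> x) \<and> (\<forall>x. \<phi> (- x) = \<phi> x) \<and>
      (\<forall>x. x \<notin> U \<longrightarrow> \<phi> x = 0) \<longrightarrow>
      \<bar>?If * (LINT x|\<nu>. \<phi> x) - ?Jf * (LINT x|\<mu>. \<phi> x)\<bar> \<le> \<epsilon> * C * (LINT x|\<mu>. \<phi> x))"
    by metis
  from Haar_integrals_nearly_proportional[OF \<nu> g] obtain D where D: "D \<ge> 0"
    "\<And>\<epsilon>. \<epsilon> > 0 \<Longrightarrow>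
    \<exists>U. open U \<and> 0 \<in> U \<and> (\<forall>\<phi> :: 'a \<Rightarrow> real. compactly_supported \<phi> \<and> (\<forall>x. 0 \<le> \<phi> x) \<and> (\<forall>x. \<phi> (- x) = \<phi> x) \<and>
      (\<forall>x. x \<notin> U \<longrightarrow> \<phi> x = 0) \<longrightarrow>
      \<bar>?Ig * (LINT x|\<nu>. \<phi> x) - ?Jg * (LINT x|\<mu>. \<phi> x)\<bar> \<le> \<epsilon> * D * (LINT x|\<mu>. \<phi> x))"
    by metis
  have bound: "\<bar>?If * ?Jg - ?Jf * ?Ig\<bar> \<le> \<epsilon> * (D * \<bar>?If\<bar> + C * \<bar>?Ig\<bar>)" if \<epsilon>: "\<epsilon> > 0" for \<epsilon>
  proof -
    obtain U where U: "open U" "0 \<in> U" "\<And>\<phi>. compactly_supported \<phi> \<Longrightarrow> (\<And>x. 0 \<le> \<phi> x) \<Longrightarrow>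
      (\<And>x. \<phi> (- x) = \<phi> x) \<Longrightarrow> (\<And>x. x \<notin> U \<Longrightarrow> \<phi> x = 0) \<Longrightarrow>
      \<bar>?If * (LINT x|\<nu>. \<phi> x) - ?Jf * (LINT x|\<mu>. \<phi> x)\<bar> \<le> \<epsilon> * C * (LINT x|\<mu>. \<phi> x)"
      using C(2)[OF \<epsilon>] by auto
    obtain V where V: "open V" "0 \<in> V" "\<And>\<phi>. compactly_supported \<phi> \<Longrightarrow> (\<And>x. 0 \<le> \<phi> x) \<Longrightarrow>
      (\<And>x. \<phi> (- x) = \<phi> x) \<Longrightarrow> (\<And>x. x \<notin> V \<Longrightarrow> \<phi> x = 0) \<Longrightarrow>
      \<bar>?Ig * (LINT x|\<nu>. \<phi> x) - ?Jg * (LINT x|\<mu>. \<phi> x)\<bar> \<le> \<epsilon> * D * (LINT x|\<mu>. \<phi> x)"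
      using D(2)[OF \<epsilon>] by auto
    have UV: "open (U \<inter> V)" "0 \<in> U \<inter> V" using U V by auto
    obtain \<phi> :: "'a \<Rightarrow> real" where \<phi>: "compactly_supported \<phi>" "\<And>x. 0 \<le> \<phi> x" "\<And>x. \<phi> (- x) = \<phi> x"
      "\<And>x. x \<notin> U \<inter> V \<Longrightarrow> \<phi> x = 0" "\<phi> 0 > 0"
      using symmetric_bump[OF UV] by metis
    define a where "a = (LINT x|\<mu>. \<phi> x)"
    define b where "b = (LINT x|\<nu>. \<phi> x)"
    have a: "a > 0"
      unfolding a_def using \<phi>(1,2,5) by (rule integral_compactly_supported_pos)
    have f_le: "\<bar>?If * b - ?Jf * a\<bar> \<le> \<epsilon> * C * a"
      unfolding a_def b_def using \<phi> by (intro U(3)) auto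
    have g_le: "\<bar>?Ig * b - ?Jg * a\<bar> \<le> \<epsilon> * D * a"
      unfolding a_def b_def using \<phi> by (intro V(3)) auto
    have "a * \<bar>?If * ?Jg - ?Jf * ?Ig\<bar> = \<bar>?Ig * (?If * b - ?Jf * a) - ?If * (?Ig * b - ?Jg * a)\<bar>"
    proof -
      have "a * (?If * ?Jg - ?Jf * ?Ig) = ?Ig * (?If * b - ?Jf * a) - ?If * (?Ig * b - ?Jg * a)"
        by (simp add: algebra_simps)
      then show ?thesis using a by (metis abs_mult abs_of_pos)
    qed
    also have "\<dots> \<le> \<bar>?Ig\<bar> * \<bar>?If * b - ?Jf * a\<bar> + \<bar>?If\<bar> * \<bar>?Ig * b - ?Jg * a\<bar>"
      unfolding abs_mult[symmetric] by (rule abs_triangle_ineq4)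
    also have "\<dots> \<le> \<bar>?Ig\<bar> * (\<epsilon> * C * a) + \<bar>?If\<bar> * (\<epsilon> * D * a)"
      using f_le g_le by (intro add_mono mult_left_mono) auto
    also have "\<dots> = a * (\<epsilon> * (D * \<bar>?If\<bar> + C * \<bar>?Ig\<bar>))"
      by (simp add: algebra_simps)
    finally show ?thesis using a by simp
  qed
  have "\<bar>?If * ?Jg - ?Jf * ?Ig\<bar> \<le> 0 + e" if e: "e > 0" for e
  proof -
    define R where "R = D * \<bar>?If\<bar> + C * \<bar>?Ig\<bar>"
    have R: "R \<ge> 0" using C(1) D(1) by (simp add: R_def)
    have "\<bar>?If * ?Jg - ?Jf * ?Ig\<bar> \<le> e / (R + 1) * R"
      using bound[of "e / (R + 1)"] e R by (simp add: R_def)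
    also have "\<dots> \<le> e"
      using e R by (simp add: field_simps)
    finally show ?thesis by simp
  qed
  then show ?thesis using field_le_epsilon[of "\<bar>?If * ?Jg - ?Jf * ?Ig\<bar>" 0] by simp
qed

text \<open>
  Urysohn functions between a compact set and an open superset transfer the comparison to open
  sets by inner regularity of the smaller measure, then to Borel sets by outer regularity of the
  larger one.
\<close>
lemma emeasure_le_if_integrals_le:
  assumes \<nu>: "left_haar_measure \<nu>" and a: "a \<ge> 0"
    and le: "\<And>f :: 'a \<Rightarrow> real. compactly_supported f \<Longrightarrow> (\<And>x. 0 \<le> f x) \<Longrightarrow>
      a * (LINT x|\<nu>. f x) \<le> (LINT x|\<mu>. f x)"
    and A: "A \<in> sets borel"
  shows "ennreal a * emeasure \<nu> A \<le> emeasure \<mu> A"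
proof -
  interpret \<nu>: locally_compact_haar \<nu> using lc \<nu> by unfold_locales
  have K_le: "ennreal a * emeasure \<nu> K \<le> emeasure \<mu> U" if K: "compact K" "K \<subseteq> U" "open U" for K U
  proof -
    obtain f :: "'a \<Rightarrow> real" where f: "compactly_supported f" "\<And>x. 0 \<le> f x" "\<And>x. f x \<le> 1"
      "\<And>x. x \<in> K \<Longrightarrow> f x = 1" "\<And>x. x \<notin> U \<Longrightarrow> f x = 0"
      using compactly_supported_Urysohn[OF lc K(1,3,2)] by metis
    have meas: "K \<in> sets \<nu>" "U \<in> sets \<mu>"
      using K by (auto simp: \<nu>.sets_eq sets_eq borel_compact)
    have "emeasure \<nu> K = (\<integral>\<^sup>+ x. indicator K x \<partial>\<nu>)" using meas by simp
    also have "\<dots> \<le> (\<integral>\<^sup>+ x. ennreal (f x) \<partial>\<nu>)"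
      using f(4) by (intro nn_integral_mono) (auto simp: indicator_def)
    also have "\<dots> = ennreal (LINT x|\<nu>. f x)"
      using \<nu>.integrable_compactly_supported[OF f(1)] f(2) by (intro nn_integral_eq_integral) auto
    finally have "ennreal a * emeasure \<nu> K \<le> ennreal a * ennreal (LINT x|\<nu>. f x)"
      by (rule mult_left_mono) simp
    also have "\<dots> = ennreal (a * (LINT x|\<nu>. f x))"
      using a f(2) by (simp add: ennreal_mult)
    also have "\<dots> \<le> ennreal (LINT x|\<mu>. f x)"
      using le[OF f(1,2)] by (rule ennreal_leI)
    also have "\<dots> = (\<integral>\<^sup>+ x. ennreal (f x) \<partial>\<mu>)"
      using integrable_compactly_supported[OF f(1)] f(2) by (intro nn_integral_eq_integral[symmetric]) auto
    also have "\<dots> \<le> (\<integral>\<^sup>+ x. indicator U x \<partial>\<mu>)"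
      using f(3,5) by (intro nn_integral_mono) (auto simp: indicator_def)
    also have "\<dots> = emeasure \<mu> U" using meas by simp
    finally show ?thesis .
  qed
  have U_le: "ennreal a * emeasure \<nu> U \<le> emeasure \<mu> U" if "open U" for U
  proof -
    have "{K. compact K \<and> K \<subseteq> U} \<noteq> {}" by (auto intro: exI[of _ "{}"])
    then have "ennreal a * emeasure \<nu> U = (SUP K\<in>{K. compact K \<and> K \<subseteq> U}. ennreal a * emeasure \<nu> K)"
      unfolding \<nu>.inner_regular[OF that] by (simp add: SUP_mult_left_ennreal)
    also have "\<dots> \<le> emeasure \<mu> U"
      using K_le that by (intro SUP_least) auto
    finally show ?thesis .
  qed
  show ?thesis
    unfolding outer_regular[OF A]
  proof (rule INF_greatest)
    fix U assume U: "U \<in> {U. open U \<and> A \<subseteq> U}"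
    then have "ennreal a * emeasure \<nu> A \<le> ennreal a * emeasure \<nu> U"
      by (intro mult_left_mono emeasure_mono) (auto simp: \<nu>.sets_eq)
    also have "\<dots> \<le> emeasure \<mu> U" using U by (intro U_le) simp
    finally show "ennreal a * emeasure \<nu> A \<le> emeasure \<mu> U" .
  qed
qed

theorem left_haar_measure_unique:
  assumes \<nu>: "left_haar_measure \<nu>"
  obtains c where "c > 0" "\<nu> = scale_measure (ennreal c) \<mu>"
proof -
  interpret \<nu>: locally_compact_haar \<nu> using lc \<nu> by unfold_locales
  obtain g :: "'a \<Rightarrow> real" where g: "compactly_supported g" "\<And>x. 0 \<le> g x" "g 0 > 0"
    using symmetric_bump[OF open_UNIV UNIV_I] by metis
  have pos: "0 < (LINT x|\<mu>. g x)" "0 < (LINT x|\<nu>. g x)"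
    using integral_compactly_supported_pos[OF g] \<nu>.integral_compactly_supported_pos[OF g] by auto
  define c where "c = (LINT x|\<nu>. g x) / (LINT x|\<mu>. g x)"
  have c: "c > 0" using pos by (simp add: c_def)
  have eq: "(LINT x|\<nu>. f x) = c * (LINT x|\<mu>. f x)" if "compactly_supported f" for f :: "'a \<Rightarrow> real"
    using Haar_integrals_proportional[OF \<nu> that g(1)] pos by (simp add: c_def field_simps)
  have "emeasure \<nu> A = emeasure (scale_measure (ennreal c) \<mu>) A" if A: "A \<in> sets borel" for A
  proof (rule antisym)
    have "ennreal (1 / c) * emeasure \<nu> A \<le> emeasure \<mu> A"
      using eq c by (intro emeasure_le_if_integrals_le[OF \<nu> _ _ A]) auto
    then have "ennreal c * (ennreal (1 / c) * emeasure \<nu> A) \<le> ennreal c * emeasure \<mu> A"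
      by (rule mult_left_mono) simp
    moreover have "ennreal c * ennreal (1 / c) = 1"
      using c by (simp add: ennreal_mult[symmetric])
    ultimately show "emeasure \<nu> A \<le> emeasure (scale_measure (ennreal c) \<mu>) A"
      by (simp add: mult.assoc[symmetric])
    have "ennreal c * emeasure \<mu> A \<le> emeasure \<nu> A"
      using eq c by (intro \<nu>.emeasure_le_if_integrals_le[OF haar _ _ A]) auto
    then show "emeasure (scale_measure (ennreal c) \<mu>) A \<le> emeasure \<nu> A" by simp
  qed
  then have "\<nu> = scale_measure (ennreal c) \<mu>"
    by (intro measure_eqI) (simp_all add: sets_eq \<nu>.sets_eq)
  then show thesis using c that by blast
qed

lemma right_translated_left_haar_measure:
  "left_haar_measure (distr \<mu> borel (\<lambda>y. y + w))"
proof -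
  let ?\<nu> = "distr \<mu> borel (\<lambda>y. y + w)" and ?t = "\<lambda>y. y - w"
  have vimage: "(\<lambda>y. y + w) -` A = ?t ` A" for A
    by (auto simp: image_iff) (metis add_diff_cancel)
  have em: "emeasure ?\<nu> A = emeasure \<mu> (?t ` A)" if "A \<in> sets borel" for A
    using that by (simp add: emeasure_distr vimage)
  have t_meas: "?t ` A \<in> sets borel" if "A \<in> sets borel" for A
    using measurable_sets[OF measurable_translation(2)[of w], of A] that by (simp add: vimage sets_eq)
  have t_open: "open (?t ` U)" if "open U" for U
    using open_right_translation[OF that, of "- w"] by simp
  have t_compact: "compact (?t ` K)" if "compact K" for K
    using compact_right_translation[OF that, of "- w"] by simp
  have t_open': "open ((\<lambda>y. y + w) ` U)" if "open U" for U
    using open_right_translation[OF that] .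
  have t_compact': "compact ((\<lambda>y. y + w) ` K)" if "compact K" for K
    using compact_right_translation[OF that] .
  have tt: "?t ` (\<lambda>y. y + w) ` A = A" for A by (simp add: image_image)
  have left: "?t ` (+) x ` A = (+) x ` ?t ` A" for x A
    by (simp add: image_image add_diff_eq)
  have inner: "emeasure ?\<nu> U = (SUP K\<in>{K. compact K \<and> K \<subseteq> U}. emeasure ?\<nu> K)" if U: "open U" for U
  proof -
    have "{K. compact K \<and> K \<subseteq> ?t ` U} = (`) ?t ` {K. compact K \<and> K \<subseteq> U}"
    proof (intro set_eqI iffI)
      fix K assume K: "K \<in> {K. compact K \<and> K \<subseteq> ?t ` U}"
      then have "(\<lambda>y. y + w) ` K \<subseteq> U" by auto
      then show "K \<in> (`) ?t ` {K. compact K \<and> K \<subseteq> U}"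
        using K t_compact' by (intro image_eqI[where x = "(\<lambda>y. y + w) ` K"]) (simp_all add: tt)
    qed (use t_compact in auto)
    then have "emeasure ?\<nu> U = (SUP K\<in>{K. compact K \<and> K \<subseteq> U}. emeasure \<mu> (?t ` K))"
      using U by (simp add: em inner_regular[OF t_open] image_image)
    also have "\<dots> = (SUP K\<in>{K. compact K \<and> K \<subseteq> U}. emeasure ?\<nu> K)"
      by (intro SUP_cong refl) (simp add: em borel_compact)
    finally show ?thesis .
  qed
  have outer: "emeasure ?\<nu> A = (INF U\<in>{U. open U \<and> A \<subseteq> U}. emeasure ?\<nu> U)" if A: "A \<in> sets borel" for A
  proof -
    have "{U. open U \<and> ?t ` A \<subseteq> U} = (`) ?t ` {U. open U \<and> A \<subseteq> U}"
    proof (intro set_eqI iffI)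
      fix U assume U: "U \<in> {U. open U \<and> ?t ` A \<subseteq> U}"
      then have "A \<subseteq> (\<lambda>y. y + w) ` U" by (force simp: image_iff)
      then show "U \<in> (`) ?t ` {U. open U \<and> A \<subseteq> U}"
        using U t_open' by (intro image_eqI[where x = "(\<lambda>y. y + w) ` U"]) (simp_all add: tt)
    qed (use t_open in auto)
    then have "emeasure ?\<nu> A = (INF U\<in>{U. open U \<and> A \<subseteq> U}. emeasure \<mu> (?t ` U))"
      using A by (simp add: em outer_regular[OF t_meas] image_image)
    also have "\<dots> = (INF U\<in>{U. open U \<and> A \<subseteq> U}. emeasure ?\<nu> U)"
      by (intro INF_cong refl) (simp add: em)
    finally show ?thesis .
  qed
  have univ: "emeasure ?\<nu> UNIV \<noteq> 0"
    using emeasure_open_pos[of UNIV 0] by (simp add: emeasure_distr)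
  have left_inv: "emeasure ?\<nu> ((+) x ` A) = emeasure ?\<nu> A" if A: "A \<in> sets borel" for x A
  proof -
    have "y \<in> (+) x ` A \<longleftrightarrow> - x + y \<in> A" for y
      using add_minus_cancel[of x y] minus_add_cancel[of x] by (metis imageE imageI)
    then have "(+) x ` A = (+) (- x) -` A" by auto
    then have "(+) x ` A \<in> sets borel"
      using measurable_sets[OF measurable_translation(1)[of "- x"] A] by (simp add: sets_eq)
    then show ?thesis
      using A by (simp add: em left emeasure_left_translation t_meas)
  qed
  have fin: "emeasure ?\<nu> K < \<infinity>" if "compact K" for K
    using that emeasure_compact_finite[OF t_compact[OF that]] by (simp add: em borel_compact)
  show ?thesis
    unfolding left_haar_measure_def
    by (intro conjI allI ballI impI sets_distr univ left_inv fin inner outer)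
qed

text \<open>
  By uniqueness, right translation scales Haar measure by a constant, the value of the modular
  function. Evaluating it on one compact neighbourhood bounds it over compact sets of translations.
\<close>
lemma right_translation_scales:
  assumes "compact W"
  obtains C where "C > 0"
    "\<And>w. w \<in> W \<Longrightarrow> \<exists>c. 0 < c \<and> c \<le> C \<and> distr \<mu> borel (\<lambda>y. y + w) = scale_measure (ennreal c) \<mu>"
proof -
  obtain V L :: "'a set" where L: "open V" "compact L" "0 \<in> V" "V \<subseteq> L"
    using compact_nhd[OF lc open_UNIV UNIV_I, of 0] by metis
  define S where "S = (\<lambda>(x, y). x - y) ` (L \<times> W)"
  have S: "compact S" unfolding S_def using L(2) assms by (rule compact_diffset)
  have meas: "L \<in> sets borel" "S \<in> sets borel" using L(2) S by (auto intro: borel_compact)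
  have Lfin: "emeasure \<mu> L < \<infinity>" "emeasure \<mu> S < \<infinity>" using L(2) S emeasure_compact_finite by auto
  have "0 < emeasure \<mu> V" using L by (intro emeasure_open_pos)
  also have "emeasure \<mu> V \<le> emeasure \<mu> L" using L meas by (intro emeasure_mono) (auto simp: sets_eq)
  finally have Lpos: "0 < measure \<mu> L"
    using Lfin by (simp add: measure_def enn2real_positive_iff)
  show thesis
  proof (rule that[of "measure \<mu> S / measure \<mu> L + 1"])
    show "0 < measure \<mu> S / measure \<mu> L + 1"
      using Lpos by (simp add: add_nonneg_pos)
    fix w assume w: "w \<in> W"
    obtain c where c: "c > 0" "distr \<mu> borel (\<lambda>y. y + w) = scale_measure (ennreal c) \<mu>"
      using left_haar_measure_unique[OF right_translated_left_haar_measure] by metis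
    have "ennreal c * emeasure \<mu> L = emeasure (distr \<mu> borel (\<lambda>y. y + w)) L"
      unfolding c(2) by simp
    also have "\<dots> = emeasure \<mu> ((\<lambda>y. y + w) -` L)"
      using meas by (simp add: emeasure_distr)
    also have "\<dots> \<le> emeasure \<mu> S"
    proof (rule emeasure_mono)
      show "(\<lambda>y. y + w) -` L \<subseteq> S"
      proof
        fix y assume "y \<in> (\<lambda>y. y + w) -` L"
        then show "y \<in> S"
          unfolding S_def using w by (intro image_eqI[of _ _ "(y + w, w)"]) simp_all
      qed
    qed (use meas in \<open>simp add: sets_eq\<close>)
    finally have "ennreal (c * measure \<mu> L) \<le> ennreal (measure \<mu> S)"
      using Lfin c(1) by (simp add: emeasure_eq_ennreal_measure ennreal_mult)
    then have "c * measure \<mu> L \<le> measure \<mu> S" by simp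
    then have "c \<le> measure \<mu> S / measure \<mu> L" using Lpos by (simp add: field_simps)
    then show "\<exists>c. 0 < c \<and> c \<le> measure \<mu> S / measure \<mu> L + 1 \<and>
        distr \<mu> borel (\<lambda>y. y + w) = scale_measure (ennreal c) \<mu>"
      using c by (intro exI[of _ c]) auto
  qed
qed

end

section \<open>The space \<open>L\<^sup>p\<close>\<close>

lemma Lp_fun_measurable: "f \<in> Lp_fun M p \<Longrightarrow> f \<in> borel_measurable M"
  by (simp add: Lp_fun_def)

lemma Lp_fun_mono:
  assumes "p \<ge> 1" "f \<in> borel_measurable M" "g \<in> Lp_fun M p" "\<And>x. cmod (f x) \<le> cmod (g x)"
  shows "f \<in> Lp_fun M p" "Lp_norm M p f \<le> Lp_norm M p g"
proof -
  have [measurable]: "f \<in> borel_measurable M" "g \<in> borel_measurable M"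
    using assms by (auto simp: Lp_fun_def)
  have le: "cmod (f x) powr p \<le> cmod (g x) powr p" for x
    using assms by (intro powr_mono2) auto
  have g: "integrable M (\<lambda>x. cmod (g x) powr p)" using assms by (simp add: Lp_fun_def)
  then have f: "integrable M (\<lambda>x. cmod (f x) powr p)"
    by (rule Bochner_Integration.integrable_bound) (use le in auto)
  then show "f \<in> Lp_fun M p" by (simp add: Lp_fun_def)
  show "Lp_norm M p f \<le> Lp_norm M p g"
    unfolding Lp_norm_def using integral_mono[OF f g le] assms(1) by (intro powr_mono2) auto
qed

lemma Lp_indicator_mult:
  assumes p: "p \<ge> 1" and "A \<in> sets M" and f: "f \<in> Lp_fun M p"
  shows "(\<lambda>x. of_real (indicat_real A x) * f x) \<in> Lp_fun M p"
    and "Lp_norm M p (\<lambda>x. of_real (indicat_real A x) * f x) \<le> Lp_norm M p f"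
proof -
  have [measurable]: "A \<in> sets M" "f \<in> borel_measurable M" using assms by (auto simp: Lp_fun_def)
  have meas: "(\<lambda>x. of_real (indicat_real A x) * f x) \<in> borel_measurable M" by measurable
  have le: "cmod (of_real (indicat_real A x) * f x) \<le> cmod (f x)" for x
    by (simp add: norm_mult indicator_def)
  show "(\<lambda>x. of_real (indicat_real A x) * f x) \<in> Lp_fun M p"
    "Lp_norm M p (\<lambda>x. of_real (indicat_real A x) * f x) \<le> Lp_norm M p f"
    using Lp_fun_mono[OF p meas f le] by auto
qed

lemma Lp_fun_cmult:
  assumes "f \<in> Lp_fun M p"
  shows "(\<lambda>x. c * f x) \<in> Lp_fun M p"
  using assms by (auto simp: Lp_fun_def norm_mult powr_mult)

lemma Lp_norm_cmult:
  assumes "p \<ge> 1"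
  shows "Lp_norm M p (\<lambda>x. c * f x) = cmod c * Lp_norm M p f"
  using assms by (simp add: Lp_norm_def norm_mult powr_mult powr_powr)

lemma Lp_norm_minus_commute: "Lp_norm M p (\<lambda>x. f x - g x) = Lp_norm M p (\<lambda>x. g x - f x)"
  by (simp add: Lp_norm_def norm_minus_commute)

lemma Lp_norm_triangle_diff:
  assumes "p \<ge> 1" "f \<in> Lp_fun M p" "g \<in> Lp_fun M p" "h \<in> Lp_fun M p"
  shows "Lp_norm M p (\<lambda>x. f x - h x) \<le> Lp_norm M p (\<lambda>x. f x - g x) + Lp_norm M p (\<lambda>x. g x - h x)"
  using Lp_norm_triangle[OF assms(1) Lp_fun_diff[OF assms(1-3)] Lp_fun_diff[OF assms(1,3,4)]] by simp

lemma Lp_norm_triangle_sub: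
  assumes "p \<ge> 1" "f \<in> Lp_fun M p" "g \<in> Lp_fun M p"
  shows "Lp_norm M p f \<le> Lp_norm M p (\<lambda>x. f x - g x) + Lp_norm M p g"
  using Lp_norm_triangle[OF assms(1) Lp_fun_diff[OF assms] assms(3)] by simp

lemma Lp_fun_zero: "(\<lambda>x. 0) \<in> Lp_fun M p"
  by (simp add: Lp_fun_def)

lemma Lp_norm_zero: "Lp_norm M p (\<lambda>x. 0) = 0"
  by (simp add: Lp_norm_def)

lemma Lp_sum:
  assumes "p \<ge> 1" "finite I" "\<And>i. i \<in> I \<Longrightarrow> f i \<in> Lp_fun M p"
  shows "(\<lambda>x. \<Sum>i\<in>I. f i x) \<in> Lp_fun M p"
    and "Lp_norm M p (\<lambda>x. \<Sum>i\<in>I. f i x) \<le> (\<Sum>i\<in>I. Lp_norm M p (f i))"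
proof -
  have "(\<lambda>x. \<Sum>i\<in>I. f i x) \<in> Lp_fun M p \<and>
      Lp_norm M p (\<lambda>x. \<Sum>i\<in>I. f i x) \<le> (\<Sum>i\<in>I. Lp_norm M p (f i))"
    using assms(2,3)
  proof (induction rule: finite_induct)
    case empty
    then show ?case by (simp add: Lp_fun_zero Lp_norm_zero)
  next
    case (insert a I)
    then have a: "f a \<in> Lp_fun M p" and s: "(\<lambda>x. \<Sum>i\<in>I. f i x) \<in> Lp_fun M p" by auto
    then show ?case
      using insert Lp_fun_add[OF assms(1) a s] Lp_norm_triangle[OF assms(1) a s] by simp
  qed
  then show "(\<lambda>x. \<Sum>i\<in>I. f i x) \<in> Lp_fun M p"
    "Lp_norm M p (\<lambda>x. \<Sum>i\<in>I. f i x) \<le> (\<Sum>i\<in>I. Lp_norm M p (f i))" by auto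
qed

lemma Lp_norm_leI:
  assumes "p \<ge> 1" "a \<ge> 0" "(LINT x|M. cmod (f x) powr p) \<le> a powr p"
  shows "Lp_norm M p f \<le> a"
proof -
  have "Lp_norm M p f \<le> (a powr p) powr (1 / p)"
    unfolding Lp_norm_def using assms by (intro powr_mono2) auto
  then show ?thesis using assms by (simp add: powr_powr)
qed

lemma Lp_norm_powr_le:
  assumes "p \<ge> 1" "Lp_norm M p f \<le> a"
  shows "(LINT x|M. cmod (f x) powr p) \<le> a powr p"
proof -
  have "Lp_norm M p f powr p \<le> a powr p" using assms by (intro powr_mono2) auto
  then show ?thesis by (simp add: Lp_norm_powr[OF assms(1)])
qed

lemma nn_integral_Lp_norm:
  assumes "p \<ge> 1" "f \<in> Lp_fun M p"
  shows "(\<integral>\<^sup>+ x. ennreal (cmod (f x) powr p) \<partial>M) = ennreal (Lp_norm M p f powr p)"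
  unfolding Lp_norm_powr[OF assms(1)]
  using assms(2) by (intro nn_integral_eq_integral) (auto simp: Lp_fun_def)

lemma Lp_funI_nn_integral:
  assumes "p \<ge> 1" "f \<in> borel_measurable M" "a \<ge> 0"
    "(\<integral>\<^sup>+ x. ennreal (cmod (f x) powr p) \<partial>M) \<le> ennreal (a powr p)"
  shows "f \<in> Lp_fun M p" "Lp_norm M p f \<le> a"
proof -
  have [measurable]: "f \<in> borel_measurable M" by fact
  have "(\<integral>\<^sup>+ x. ennreal (cmod (f x) powr p) \<partial>M) < \<infinity>"
    using assms(4) by (rule le_less_trans) simp
  then have int: "integrable M (\<lambda>x. cmod (f x) powr p)"
    by (intro integrableI_nonneg) auto
  then show f: "f \<in> Lp_fun M p" by (simp add: Lp_fun_def)
  have "ennreal (Lp_norm M p f powr p) \<le> ennreal (a powr p)"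
    using assms(4) nn_integral_Lp_norm[OF assms(1) f] by simp
  then have "Lp_norm M p f powr p \<le> a powr p" by simp
  then show "Lp_norm M p f \<le> a"
    unfolding Lp_norm_powr[OF assms(1)] by (rule Lp_norm_leI[OF assms(1,3)])
qed

text \<open>
  Limits almost everywhere of functions in a ball of \<open>L\<^sup>p\<close> stay in the ball; applied to differences,
  this yields both that a limit is in \<open>L\<^sup>p\<close> and the rate of convergence to it.
\<close>
lemma Lp_Fatou:
  assumes p: "p \<ge> 1" and g: "\<And>n. g n \<in> Lp_fun M p" and f [measurable]: "f \<in> borel_measurable M"
    and lim: "AE x in M. (\<lambda>n. g n x) \<longlonglongrightarrow> f x"
    and le: "\<And>n. n \<ge> N \<Longrightarrow> Lp_norm M p (g n) \<le> a"
  shows "f \<in> Lp_fun M p" "Lp_norm M p f \<le> a"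
proof -
  have [measurable]: "g n \<in> borel_measurable M" for n using g by (simp add: Lp_fun_def)
  have a: "a \<ge> 0" using le[of N] Lp_norm_nonneg[of M p "g N"] by linarith
  have "AE x in M. ennreal (cmod (f x) powr p) = liminf (\<lambda>n. ennreal (cmod (g n x) powr p))"
    using lim
  proof eventually_elim
    case (elim x)
    have "(\<lambda>n. ennreal (cmod (g n x) powr p)) \<longlonglongrightarrow> ennreal (cmod (f x) powr p)"
      using elim p by (intro tendsto_ennrealI tendsto_powr' tendsto_norm tendsto_const) auto
    then show ?case by (intro lim_imp_Liminf[symmetric]) auto
  qed
  then have "(\<integral>\<^sup>+ x. ennreal (cmod (f x) powr p) \<partial>M) =
      (\<integral>\<^sup>+ x. liminf (\<lambda>n. ennreal (cmod (g n x) powr p)) \<partial>M)"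
    by (rule nn_integral_cong_AE)
  also have "\<dots> \<le> liminf (\<lambda>n. \<integral>\<^sup>+ x. ennreal (cmod (g n x) powr p) \<partial>M)"
    by (rule nn_integral_liminf) measurable
  also have "\<dots> = liminf (\<lambda>n. ennreal (Lp_norm M p (g n) powr p))"
    using nn_integral_Lp_norm[OF p g] by simp
  also have "\<dots> \<le> limsup (\<lambda>n. ennreal (Lp_norm M p (g n) powr p))"
    by (rule Liminf_le_Limsup) simp
  also have "\<dots> \<le> ennreal (a powr p)"
  proof (rule Limsup_bounded)
    show "\<forall>\<^sub>F n in sequentially. ennreal (Lp_norm M p (g n) powr p) \<le> ennreal (a powr p)"
      using eventually_ge_at_top[of N]
    proof eventually_elim
      case (elim n)
      then show ?case using le[of n] p by (intro ennreal_leI powr_mono2) auto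
    qed
  qed
  finally have "(\<integral>\<^sup>+ x. ennreal (cmod (f x) powr p) \<partial>M) \<le> ennreal (a powr p)" .
  from Lp_funI_nn_integral[OF p f a this]
  show "f \<in> Lp_fun M p" "Lp_norm M p f \<le> a" by auto
qed

lemma convergent_if_summable_increments:
  fixes u :: "nat \<Rightarrow> 'a::banach"
  assumes "summable (\<lambda>n. norm (u (Suc n) - u n))"
  shows "convergent u"
proof -
  have "summable (\<lambda>n. u (Suc n) - u n)" using assms by (rule summable_norm_cancel)
  then have "(\<lambda>n. \<Sum>i<n. u (Suc i) - u i) \<longlonglongrightarrow> (\<Sum>i. u (Suc i) - u i)"
    by (rule summable_LIMSEQ)
  then have "(\<lambda>n. u n - u 0) \<longlonglongrightarrow> (\<Sum>i. u (Suc i) - u i)"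
    by (simp add: sum_lessThan_telescope)
  then have "(\<lambda>n. u n - u 0 + u 0) \<longlonglongrightarrow> (\<Sum>i. u (Suc i) - u i) + u 0"
    by (intro tendsto_add tendsto_const)
  then show ?thesis by (auto simp: convergent_def)
qed

text \<open>
  Multiplied by \<open>2 ^ n\<close>, the increments still have norms at most \<open>(1 / 2) ^ n\<close>, so the sum of the \<open>p\<close>-th
  powers of these multiples is integrable. Almost everywhere it is finite and bounds each term, so
  that the increments decay geometrically there.
\<close>
lemma Lp_rapid_convergence_AE:
  assumes p: "p \<ge> 1" and f: "\<And>n. f n \<in> Lp_fun M p"
    and le: "\<And>n. Lp_norm M p (\<lambda>x. f (Suc n) x - f n x) \<le> (1 / 4) ^ n"
  shows "AE x in M. convergent (\<lambda>n. f n x)"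
proof -
  have [measurable]: "f n \<in> borel_measurable M" for n using f by (simp add: Lp_fun_def)
  define d where "d n x = 2 ^ n * (f (Suc n) x - f n x)" for n x
  have d_Lp: "d n \<in> Lp_fun M p" for n
    unfolding d_def using p f by (intro Lp_fun_cmult Lp_fun_diff)
  have [measurable]: "d n \<in> borel_measurable M" for n using d_Lp by (simp add: Lp_fun_def)
  have d_norm: "Lp_norm M p (d n) powr p \<le> (1 / 2) ^ n" for n
  proof -
    have "Lp_norm M p (d n) = 2 ^ n * Lp_norm M p (\<lambda>x. f (Suc n) x - f n x)"
      unfolding d_def using p by (simp add: Lp_norm_cmult norm_power)
    also have "\<dots> \<le> 2 ^ n * (1 / 4) ^ n" using le by (intro mult_left_mono) auto
    also have "\<dots> = (1 / 2) ^ n" by (simp add: power_mult_distrib[symmetric])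
    finally have *: "Lp_norm M p (d n) \<le> (1 / 2) ^ n" .
    have "Lp_norm M p (d n) powr p \<le> ((1 / 2) ^ n) powr p"
      using * p by (intro powr_mono2) auto
    also have "\<dots> \<le> ((1 / 2) ^ n) powr 1"
      using p by (intro powr_mono') (auto simp: power_le_one)
    finally show ?thesis by simp
  qed
  have "(\<integral>\<^sup>+ x. (\<Sum>n. ennreal (cmod (d n x) powr p)) \<partial>M) = (\<Sum>n. \<integral>\<^sup>+ x. ennreal (cmod (d n x) powr p) \<partial>M)"
    by (intro nn_integral_suminf) measurable
  also have "\<dots> = (\<Sum>n. ennreal (Lp_norm M p (d n) powr p))"
    using nn_integral_Lp_norm[OF p d_Lp] by simp
  also have "\<dots> \<le> (\<Sum>n. ennreal ((1 / 2) ^ n))"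
    using d_norm by (intro suminf_le ennreal_leI) auto
  also have "\<dots> = ennreal (\<Sum>n. (1 / 2) ^ n)"
    by (intro suminf_ennreal2) (auto intro: summable_geometric)
  also have "\<dots> < \<infinity>" by simp
  finally have "AE x in M. (\<Sum>n. ennreal (cmod (d n x) powr p)) \<noteq> \<infinity>"
    by (intro nn_integral_noteq_infinite) auto
  then show ?thesis
  proof eventually_elim
    case (elim x)
    define C where "C = enn2real (\<Sum>n. ennreal (cmod (d n x) powr p))"
    have "ennreal (cmod (d n x) powr p) \<le> ennreal C" for n
    proof -
      have "ennreal (cmod (d n x) powr p) = (\<Sum>i\<in>{n}. ennreal (cmod (d i x) powr p))" by simp
      also have "\<dots> \<le> (\<Sum>i. ennreal (cmod (d i x) powr p))"
        by (intro sum_le_suminf) auto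
      also have "\<dots> = ennreal C" using elim by (simp add: C_def less_top)
      finally show ?thesis .
    qed
    then have C: "cmod (d n x) powr p \<le> C" for n
      by (simp add: C_def)
    have inc: "cmod (f (Suc n) x - f n x) \<le> C powr (1 / p) * (1 / 2) ^ n" for n
    proof -
      have "cmod (d n x) = (cmod (d n x) powr p) powr (1 / p)" using p by (simp add: powr_powr)
      also have "\<dots> \<le> C powr (1 / p)" using C p by (intro powr_mono2) auto
      finally have "2 ^ n * cmod (f (Suc n) x - f n x) \<le> C powr (1 / p)"
        by (simp add: d_def norm_mult norm_power)
      then show ?thesis by (simp add: field_simps power_divide)
    qed
    have geo: "summable (\<lambda>n. C powr (1 / p) * (1 / 2) ^ n)"
      by (intro summable_mult summable_geometric) simp
    have "summable (\<lambda>n. norm (f (Suc n) x - f n x))"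
      by (rule summable_comparison_test'[OF geo, of 0]) (simp only: real_norm_def abs_norm_cancel inc)
    then show ?case by (rule convergent_if_summable_increments)
  qed
qed

definition Lp_class :: "'a measure \<Rightarrow> real \<Rightarrow> ('a \<Rightarrow> complex) \<Rightarrow> ('a \<Rightarrow> complex) set" where
  "Lp_class M p f = Lp_rel M p `` {f}"

lemma Lp_class_in_space: "f \<in> Lp_fun M p \<Longrightarrow> Lp_class M p f \<in> Lp_space M p"
  by (simp add: Lp_class_def Lp_space_def quotientI)

lemma in_Lp_class: "f \<in> Lp_fun M p \<Longrightarrow> f \<in> Lp_class M p f"
  by (simp add: Lp_class_def Lp_rel_def)

lemma Lp_space_nonempty: "c \<in> Lp_space M p \<Longrightarrow> \<exists>f. f \<in> c"
  using in_quotient_imp_non_empty[OF equiv_Lp_rel] unfolding Lp_space_def by blast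

lemma Lp_space_in_fun: "c \<in> Lp_space M p \<Longrightarrow> f \<in> c \<Longrightarrow> f \<in> Lp_fun M p"
  using in_quotient_imp_subset[OF equiv_Lp_rel] unfolding Lp_space_def by blast

lemma Lp_space_AE_eq: "c \<in> Lp_space M p \<Longrightarrow> f \<in> c \<Longrightarrow> g \<in> c \<Longrightarrow> AE x in M. f x = g x"
  using quotient_eq_iff[OF equiv_Lp_rel, of c M p c f g] unfolding Lp_space_def Lp_rel_def by auto

lemma Lp_dist_eq:
  assumes "c \<in> Lp_space M p" "d \<in> Lp_space M p" "f \<in> c" "g \<in> d"
  shows "Lp_dist M p c d = Lp_norm M p (\<lambda>x. f x - g x)"
proof -
  define f' where "f' = (SOME f. f \<in> c)"
  define g' where "g' = (SOME g. g \<in> d)"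
  have f': "f' \<in> c" unfolding f'_def using assms(3) by (rule someI[of "\<lambda>f. f \<in> c"])
  have g': "g' \<in> d" unfolding g'_def using assms(4) by (rule someI[of "\<lambda>g. g \<in> d"])
  have [measurable]: "f \<in> borel_measurable M" "f' \<in> borel_measurable M"
    "g \<in> borel_measurable M" "g' \<in> borel_measurable M"
    using assms f' g' Lp_space_in_fun Lp_fun_measurable by metis+
  have "AE x in M. f' x = f x" "AE x in M. g' x = g x"
    using Lp_space_AE_eq assms f' g' by metis+
  then have "AE x in M. f' x - g' x = f x - g x" by eventually_elim simp
  then show ?thesis
    unfolding Lp_dist_def f'_def[symmetric] g'_def[symmetric]
    by (intro Lp_norm_cong_AE) auto
qed

text \<open>
  A Cauchy sequence has a subsequence whose increments decay like \<open>(1 / 4) ^ n\<close>. It converges almost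
  everywhere, and by Fatou's lemma also in norm.
\<close>
theorem Lp_complete:
  assumes p: "p \<ge> 1"
  shows "Metric_space.mcomplete (Lp_space M p) (Lp_dist M p)"
proof -
  interpret Metric_space "Lp_space M p" "Lp_dist M p" by (rule Metric_space_Lp[OF p])
  show ?thesis
    unfolding mcomplete_def
  proof (intro allI impI)
    fix \<sigma> assume \<sigma>: "MCauchy \<sigma>"
    then have \<sigma>_in: "\<sigma> n \<in> Lp_space M p" for n
      unfolding MCauchy_def by auto
    have "\<exists>N. \<forall>m\<ge>N. \<forall>n\<ge>N. Lp_dist M p (\<sigma> m) (\<sigma> n) < (1 / 4) ^ k" for k :: nat
      using \<sigma> unfolding MCauchy_def by (metis zero_less_power zero_less_divide_1_iff zero_less_numeral)
    then obtain N where N: "\<And>k m n. m \<ge> N k \<Longrightarrow> n \<ge> N k \<Longrightarrow> Lp_dist M p (\<sigma> m) (\<sigma> n) < (1 / 4) ^ k"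
      by metis
    \<comment> \<open>The sum dominates all \<open>N i\<close> with \<open>i \<le> k\<close>; adding \<open>k\<close> makes \<open>r\<close> strictly increasing.\<close>
    define r where "r k = (\<Sum>i\<le>k. N i) + k" for k
    have r_mono: "strict_mono r"
      unfolding strict_mono_Suc_iff by (simp add: r_def)
    have r_ge: "r m \<ge> N k" if "m \<ge> k" for m k
    proof -
      have "N k \<le> (\<Sum>i\<le>m. N i)" using that by (intro member_le_sum) auto
      then show ?thesis by (simp add: r_def)
    qed
    define f where "f k = (SOME g. g \<in> \<sigma> (r k))" for k
    have f_in: "f k \<in> \<sigma> (r k)" for k
      unfolding f_def using Lp_space_nonempty[OF \<sigma>_in] by (rule someI_ex)
    have f: "f k \<in> Lp_fun M p" for k using Lp_space_in_fun[OF \<sigma>_in f_in] .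
    have [measurable]: "f k \<in> borel_measurable M" for k using f by (rule Lp_fun_measurable)
    have f_le: "Lp_norm M p (\<lambda>x. f m x - f n x) \<le> (1 / 4) ^ k" if "m \<ge> k" "n \<ge> k" for m n k
      using N[OF r_ge[OF that(1)] r_ge[OF that(2)]] Lp_dist_eq[OF \<sigma>_in \<sigma>_in f_in f_in] by (simp add: less_imp_le)
    have conv: "AE x in M. convergent (\<lambda>n. f n x)"
      using f_le by (intro Lp_rapid_convergence_AE[OF p f]) simp
    define F where "F x = lim (\<lambda>n. f n x)" for x
    have [measurable]: "F \<in> borel_measurable M"
      unfolding F_def by measurable
    have lim: "AE x in M. (\<lambda>n. f n x) \<longlonglongrightarrow> F x"
      using conv by eventually_elim (simp add: F_def convergent_LIMSEQ_iff)
    have diff: "(\<lambda>x. F x - f k x) \<in> Lp_fun M p \<and> Lp_norm M p (\<lambda>x. F x - f k x) \<le> (1 / 4) ^ k" for k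
    proof -
      have "AE x in M. (\<lambda>n. f n x - f k x) \<longlonglongrightarrow> F x - f k x"
        using lim by eventually_elim (intro tendsto_intros)
      moreover have "(\<lambda>x. f n x - f k x) \<in> Lp_fun M p" for n using p f by (intro Lp_fun_diff)
      moreover have "Lp_norm M p (\<lambda>x. f n x - f k x) \<le> (1 / 4) ^ k" if "n \<ge> k" for n
        using that by (intro f_le) auto
      moreover have "(\<lambda>x. F x - f k x) \<in> borel_measurable M" by measurable
      ultimately show ?thesis
        using Lp_Fatou[OF p, of "\<lambda>n x. f n x - f k x" M "\<lambda>x. F x - f k x" k] by blast
    qed
    have F: "F \<in> Lp_fun M p"
      using Lp_fun_add[OF p conjunct1[OF diff[of 0]] f[of 0]] by simp
    have "limitin mtopology (\<sigma> \<circ> r) (Lp_class M p F) sequentially"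
      unfolding limitin_metric
    proof (intro conjI allI impI)
      show "Lp_class M p F \<in> Lp_space M p" using F by (rule Lp_class_in_space)
      fix \<epsilon> :: real assume "\<epsilon> > 0"
      have "(\<lambda>k. (1 / 4 :: real) ^ k) \<longlonglongrightarrow> 0" by (intro LIMSEQ_power_zero) simp
      then have "\<forall>\<^sub>F k in sequentially. (1 / 4) ^ k < \<epsilon>"
        using \<open>\<epsilon> > 0\<close> by (rule order_tendstoD)
      then show "\<forall>\<^sub>F k in sequentially. (\<sigma> \<circ> r) k \<in> Lp_space M p \<and> Lp_dist M p ((\<sigma> \<circ> r) k) (Lp_class M p F) < \<epsilon>"
      proof eventually_elim
        case (elim k)
        have "Lp_dist M p (\<sigma> (r k)) (Lp_class M p F) = Lp_norm M p (\<lambda>x. F x - f k x)"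
          using Lp_dist_eq[OF \<sigma>_in Lp_class_in_space[OF F] f_in in_Lp_class[OF F]]
          by (simp add: Lp_norm_minus_commute)
        then show ?case using diff[of k] elim \<sigma>_in by simp
      qed
    qed
    then show "\<exists>x. limitin mtopology \<sigma> x sequentially"
      using MCauchy_convergent_subsequence[OF \<sigma> r_mono] by blast
  qed
qed

lemma relatively_compact_iff_totally_bounded:
  assumes p: "p \<ge> 1" and F: "F \<subseteq> Lp_space M p"
  shows "relatively_compact_in (Lp_topology M p) F \<longleftrightarrow>
    Metric_space.mtotally_bounded (Lp_space M p) (Lp_dist M p) F"
proof -
  interpret Metric_space "Lp_space M p" "Lp_dist M p" by (rule Metric_space_Lp[OF p])
  show ?thesis
    unfolding relatively_compact_in_def Lp_topology_def
    using mtotally_bounded_eq_compact_closure_of[OF Lp_complete[OF p]] by simp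
qed

lemma relatively_compact_finite_net:
  assumes p: "p \<ge> 1" and F: "F \<subseteq> Lp_space M p"
    and "relatively_compact_in (Lp_topology M p) F" and \<epsilon>: "\<epsilon> > 0"
  obtains G where "finite G" "G \<subseteq> Lp_fun M p"
    "\<And>c f. c \<in> F \<Longrightarrow> f \<in> c \<Longrightarrow> \<exists>g\<in>G. Lp_norm M p (\<lambda>x. f x - g x) < \<epsilon>"
proof -
  interpret Metric_space "Lp_space M p" "Lp_dist M p" by (rule Metric_space_Lp[OF p])
  have "mtotally_bounded F" using assms relatively_compact_iff_totally_bounded by blast
  then have "\<exists>K. finite K \<and> K \<subseteq> F \<and> F \<subseteq> (\<Union>c\<in>K. mball c \<epsilon>)"
    using \<epsilon> unfolding mtotally_bounded_def by simp
  then obtain K where K: "finite K" "K \<subseteq> F" "F \<subseteq> (\<Union>c\<in>K. mball c \<epsilon>)"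
    by metis
  define rep where "rep c = (SOME f. f \<in> c)" for c :: "('a \<Rightarrow> complex) set"
  have rep: "rep c \<in> c" if "c \<in> Lp_space M p" for c
    unfolding rep_def using Lp_space_nonempty[OF that] by (rule someI_ex)
  show thesis
  proof (rule that[of "rep ` K"])
    show "finite (rep ` K)" using K by simp
    show "rep ` K \<subseteq> Lp_fun M p"
    proof
      fix g assume "g \<in> rep ` K"
      then obtain c where "c \<in> Lp_space M p" "g = rep c" using K(2) F by blast
      then show "g \<in> Lp_fun M p" using Lp_space_in_fun[OF _ rep] by simp
    qed
    fix c f assume c: "c \<in> F" "f \<in> c"
    then obtain d where d: "d \<in> K" "c \<in> mball d \<epsilon>" using K(3) by blast
    then have mem: "c \<in> Lp_space M p" "d \<in> Lp_space M p" "Lp_dist M p c d < \<epsilon>"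
      by (auto simp: commute)
    then have "Lp_norm M p (\<lambda>x. f x - rep d x) < \<epsilon>"
      using Lp_dist_eq[OF mem(1,2) c(2) rep[OF mem(2)]] by simp
    then show "\<exists>g\<in>rep ` K. Lp_norm M p (\<lambda>x. f x - g x) < \<epsilon>" using d(1) by blast
  qed
qed

text \<open>
  The centres need not belong to the family: one moves each centre that has a member of the family
  within \<open>\<epsilon> / 2\<close> to such a member.
\<close>
lemma relatively_compactI_finite_net:
  assumes p: "p \<ge> 1" and F: "F \<subseteq> Lp_space M p"
    and net: "\<And>\<epsilon>. \<epsilon> > 0 \<Longrightarrow> \<exists>G. finite G \<and> G \<subseteq> Lp_fun M p \<and>
      (\<forall>c\<in>F. \<exists>f\<in>c. \<exists>g\<in>G. Lp_norm M p (\<lambda>x. f x - g x) < \<epsilon>)"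
  shows "relatively_compact_in (Lp_topology M p) F"
proof -
  interpret Metric_space "Lp_space M p" "Lp_dist M p" by (rule Metric_space_Lp[OF p])
  have "mtotally_bounded F"
    unfolding mtotally_bounded_def
  proof (intro allI impI)
    fix \<epsilon> :: real assume \<epsilon>: "\<epsilon> > 0"
    then obtain G where G: "finite G" "G \<subseteq> Lp_fun M p"
      "\<forall>c\<in>F. \<exists>f\<in>c. \<exists>g\<in>G. Lp_norm M p (\<lambda>x. f x - g x) < \<epsilon> / 2"
      using net[of "\<epsilon> / 2"] by auto
    define near where "near g c \<longleftrightarrow> c \<in> F \<and> (\<exists>f\<in>c. Lp_norm M p (\<lambda>x. f x - g x) < \<epsilon> / 2)" for g c
    define pick where "pick g = (SOME c. near g c)" for g
    have pick: "near g (pick g)" if "near g c" for g c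
      unfolding pick_def using that by (rule someI)
    have close: "Lp_dist M p c d < \<epsilon>" if g: "g \<in> G" and c: "near g c" and d: "near g d" for c d g
    proof -
      obtain f h where fh: "f \<in> c" "Lp_norm M p (\<lambda>x. f x - g x) < \<epsilon> / 2"
        "h \<in> d" "Lp_norm M p (\<lambda>x. h x - g x) < \<epsilon> / 2"
        using c d unfolding near_def by blast
      have mem: "c \<in> Lp_space M p" "d \<in> Lp_space M p" using c d F by (auto simp: near_def)
      have "Lp_dist M p c d = Lp_norm M p (\<lambda>x. f x - h x)"
        using mem fh by (intro Lp_dist_eq) auto
      also have "\<dots> \<le> Lp_norm M p (\<lambda>x. f x - g x) + Lp_norm M p (\<lambda>x. g x - h x)"
        using p mem fh g G(2) by (intro Lp_norm_triangle_diff) (auto intro: Lp_space_in_fun)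
      also have "\<dots> < \<epsilon>"
        using fh(2,4) unfolding Lp_norm_minus_commute[of M p g h] by simp
      finally show ?thesis .
    qed
    define K where "K = pick ` {g\<in>G. \<exists>c. near g c}"
    have "finite K" unfolding K_def using G(1) by simp
    moreover have "K \<subseteq> F"
    proof
      fix d assume "d \<in> K"
      then obtain g c where "near g c" "d = pick g" unfolding K_def by blast
      then show "d \<in> F" using pick[of g c] by (simp add: near_def)
    qed
    moreover have "F \<subseteq> (\<Union>d\<in>K. mball d \<epsilon>)"
    proof
      fix c assume c: "c \<in> F"
      then obtain f g where fg: "f \<in> c" "g \<in> G" "Lp_norm M p (\<lambda>x. f x - g x) < \<epsilon> / 2"
        using G(3) by blast
      then have n: "near g c" using c unfolding near_def by blast
      have "pick g \<in> K" unfolding K_def using fg(2) n by blast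
      moreover have "c \<in> mball (pick g) \<epsilon>"
        using close[OF fg(2) pick[OF n] n] pick[OF n] c F by (auto simp: near_def)
      ultimately show "c \<in> (\<Union>d\<in>K. mball d \<epsilon>)" by blast
    qed
    ultimately show "\<exists>K. finite K \<and> K \<subseteq> F \<and> F \<subseteq> (\<Union>x\<in>K. mball x \<epsilon>)" by blast
  qed
  then show ?thesis using relatively_compact_iff_totally_bounded[OF p F] by simp
qed

section \<open>Translations and compactly supported functions in \<open>L\<^sup>p\<close>\<close>

lemma mult_divide_add_one_le: "\<epsilon> / (a + 1) * a \<le> \<epsilon>" if "\<epsilon> > 0" "a \<ge> 0" for a \<epsilon> :: real
  using that by (simp add: field_simps)

context locally_compact_haar
begin

lemma Lp_left_translation:
  assumes "f \<in> Lp_fun \<mu> p"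
  shows "(\<lambda>y. f (x + y)) \<in> Lp_fun \<mu> p" "Lp_norm \<mu> p (\<lambda>y. f (x + y)) = Lp_norm \<mu> p f"
proof -
  have f: "f \<in> borel_measurable borel" using assms by (simp add: Lp_fun_def borel_measurable_eq)
  then have g: "(\<lambda>y. cmod (f y) powr p) \<in> borel_measurable borel" by simp
  have "(\<lambda>y. f (x + y)) \<in> borel_measurable \<mu>"
    by (rule measurable_compose[OF measurable_translation(1) f])
  then show "(\<lambda>y. f (x + y)) \<in> Lp_fun \<mu> p"
    using assms integrable_left_translation[OF g] by (simp add: Lp_fun_def)
  show "Lp_norm \<mu> p (\<lambda>y. f (x + y)) = Lp_norm \<mu> p f"
    using integral_left_translation[OF g] by (simp add: Lp_norm_def)
qed

lemma Lp_right_translation_bounded: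
  assumes "p \<ge> 1" "compact W"
  obtains C where "C > 0" "\<And>w f. w \<in> W \<Longrightarrow> f \<in> Lp_fun \<mu> p \<Longrightarrow>
    (\<lambda>y. f (y + w)) \<in> Lp_fun \<mu> p \<and> Lp_norm \<mu> p (\<lambda>y. f (y + w)) \<le> C * Lp_norm \<mu> p f"
proof -
  obtain C where C: "C > 0"
    "\<And>w. w \<in> W \<Longrightarrow> \<exists>c. 0 < c \<and> c \<le> C \<and> distr \<mu> borel (\<lambda>y. y + w) = scale_measure (ennreal c) \<mu>"
    using right_translation_scales[OF assms(2)] by metis
  show thesis
  proof (rule that[of "C powr (1 / p)"])
    show "C powr (1 / p) > 0" using C by simp
    fix w f assume w: "w \<in> W" and fL: "f \<in> Lp_fun \<mu> p"
    have f: "f \<in> borel_measurable borel" using fL by (simp add: Lp_fun_def borel_measurable_eq)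
    then have g: "(\<lambda>y. ennreal (cmod (f y) powr p)) \<in> borel_measurable borel" by simp
    obtain c where c: "0 < c" "c \<le> C" "distr \<mu> borel (\<lambda>y. y + w) = scale_measure (ennreal c) \<mu>"
      using C(2)[OF w] by metis
    have "(\<integral>\<^sup>+ y. ennreal (cmod (f (y + w)) powr p) \<partial>\<mu>)
        = (\<integral>\<^sup>+ y. ennreal (cmod (f y) powr p) \<partial>(distr \<mu> borel (\<lambda>y. y + w)))"
      using g by (subst nn_integral_distr) simp_all
    also have "\<dots> = ennreal c * (\<integral>\<^sup>+ y. ennreal (cmod (f y) powr p) \<partial>\<mu>)"
      unfolding c(3) using g by (intro nn_integral_scale_measure) (simp add: borel_measurable_eq)
    also have "\<dots> = ennreal (c * Lp_norm \<mu> p f powr p)"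
      using c(1) by (simp add: nn_integral_Lp_norm[OF assms(1) fL] ennreal_mult)
    also have "\<dots> \<le> ennreal ((C powr (1 / p) * Lp_norm \<mu> p f) powr p)"
      using c C(1) assms(1) by (intro ennreal_leI) (simp add: powr_mult powr_powr mult_right_mono)
    finally have le: "(\<integral>\<^sup>+ y. ennreal (cmod (f (y + w)) powr p) \<partial>\<mu>)
        \<le> ennreal ((C powr (1 / p) * Lp_norm \<mu> p f) powr p)" .
    have meas: "(\<lambda>y. f (y + w)) \<in> borel_measurable \<mu>"
      by (rule measurable_compose[OF measurable_translation(2) f])
    show "(\<lambda>y. f (y + w)) \<in> Lp_fun \<mu> p \<and>
        Lp_norm \<mu> p (\<lambda>y. f (y + w)) \<le> C powr (1 / p) * Lp_norm \<mu> p f"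
      using Lp_funI_nn_integral[OF assms(1) meas _ le] by simp
  qed
qed

lemma Lp_right_translation:
  assumes "p \<ge> 1" "f \<in> Lp_fun \<mu> p"
  shows "(\<lambda>y. f (y + w)) \<in> Lp_fun \<mu> p"
proof -
  have "compact {w}" by simp
  from Lp_right_translation_bounded[OF assms(1) this]
  obtain C where "\<And>v f. v \<in> {w} \<Longrightarrow> f \<in> Lp_fun \<mu> p \<Longrightarrow> (\<lambda>y. f (y + v)) \<in> Lp_fun \<mu> p \<and>
      Lp_norm \<mu> p (\<lambda>y. f (y + v)) \<le> C * Lp_norm \<mu> p f"
    by metis
  then show ?thesis using assms(2) by simp
qed

lemma Lp_bounded_with_support:
  assumes p: "p \<ge> 1" and f: "f \<in> borel_measurable \<mu>" and S: "S \<in> sets borel" "emeasure \<mu> S < \<infinity>"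
    and supp: "\<And>x. x \<notin> S \<Longrightarrow> f x = 0" and B: "B \<ge> 0" "\<And>x. cmod (f x) \<le> B"
  shows "f \<in> Lp_fun \<mu> p" "Lp_norm \<mu> p f \<le> B * measure \<mu> S powr (1 / p)"
proof -
  have "(\<integral>\<^sup>+ x. ennreal (cmod (f x) powr p) \<partial>\<mu>) \<le> (\<integral>\<^sup>+ x. ennreal (B powr p) * indicator S x \<partial>\<mu>)"
  proof (rule nn_integral_mono)
    fix x
    have "cmod (f x) powr p \<le> B powr p" using B p by (intro powr_mono2) auto
    then show "ennreal (cmod (f x) powr p) \<le> ennreal (B powr p) * indicator S x"
      using supp[of x] by (cases "x \<in> S") (auto intro: ennreal_leI)
  qed
  also have "\<dots> = ennreal (B powr p) * emeasure \<mu> S"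
    using S(1) by (intro nn_integral_cmult_indicator) (simp add: sets_eq)
  also have "\<dots> = ennreal (B powr p * measure \<mu> S)"
    using S(2) by (simp add: emeasure_eq_ennreal_measure ennreal_mult)
  also have "B powr p * measure \<mu> S = (B * measure \<mu> S powr (1 / p)) powr p"
    using B(1) p by (simp add: powr_mult powr_powr)
  finally have le: "(\<integral>\<^sup>+ x. ennreal (cmod (f x) powr p) \<partial>\<mu>) \<le> ennreal ((B * measure \<mu> S powr (1 / p)) powr p)" .
  have "B * measure \<mu> S powr (1 / p) \<ge> 0" using B(1) by simp
  from Lp_funI_nn_integral[OF p f this le]
  show "f \<in> Lp_fun \<mu> p" "Lp_norm \<mu> p f \<le> B * measure \<mu> S powr (1 / p)" by auto
qed

lemma compactly_supported_in_Lp: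
  assumes p: "p \<ge> 1" and f: "compactly_supported f"
  shows "f \<in> Lp_fun \<mu> p"
proof -
  obtain K where K: "compact K" "\<And>x. x \<notin> K \<Longrightarrow> f x = 0"
    using f by (auto simp: compactly_supported_def)
  obtain B where B: "\<And>x. cmod (f x) \<le> B" "B > 0"
    using compactly_supported_bounded[OF f] by metis
  have meas: "f \<in> borel_measurable \<mu>"
    using compactly_supported_measurable[OF f] by (simp add: borel_measurable_eq)
  show ?thesis
    using Lp_bounded_with_support(1)[OF p meas borel_compact[OF K(1)] emeasure_compact_finite[OF K(1)] K(2) _ B(1)]
      B(2) by simp
qed

text \<open>
  An indicator function is approximated through an open superset of nearly the same measure and a
  Urysohn function for a compact subset of that open set, again of nearly the same measure.
\<close>
lemma indicator_Lp_approximable: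
  assumes p: "p \<ge> 1" and A: "A \<in> sets borel" "emeasure \<mu> A < \<infinity>" and \<epsilon>: "\<epsilon> > 0"
  obtains g :: "'a \<Rightarrow> complex" where "compactly_supported g"
    "Lp_norm \<mu> p (\<lambda>x. of_real (indicat_real A x) - g x) \<le> \<epsilon>"
proof -
  define \<delta> where "\<delta> = (\<epsilon> / 2) powr p"
  have \<delta>: "\<delta> > 0" using \<epsilon> by (simp add: \<delta>_def)
  have \<delta>_root: "\<delta> powr (1 / p) = \<epsilon> / 2" using \<epsilon> p by (simp add: \<delta>_def powr_powr)
  have "emeasure \<mu> A < emeasure \<mu> A + ennreal \<delta>"
    using A(2) \<delta> by (simp add: ennreal_add_left_cancel_less less_top[symmetric])
  then obtain U where U: "open U" "A \<subseteq> U" "emeasure \<mu> U < emeasure \<mu> A + ennreal \<delta>"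
    unfolding outer_regular[OF A(1)] by (auto simp: INF_less_iff)
  have U_fin: "emeasure \<mu> U < \<infinity>"
    using U(3) A(2) by (auto simp: less_top[symmetric] top_unique)
  have U_sets: "U \<in> sets \<mu>" "A \<in> sets \<mu>" using U(1) A(1) by (auto simp: sets_eq)
  have UA: "measure \<mu> (U - A) \<le> \<delta>" "emeasure \<mu> (U - A) < \<infinity>"
  proof -
    have "emeasure \<mu> (U - A) = emeasure \<mu> U - emeasure \<mu> A"
      using U A U_sets by (intro emeasure_Diff) (auto simp: less_top)
    also have "\<dots> \<le> ennreal \<delta>"
      using U(3) A(2) by (intro ennreal_minus_le_iff[THEN iffD2]) (auto simp: less_imp_le)
    finally have "emeasure \<mu> (U - A) \<le> ennreal \<delta>" .
    then show "measure \<mu> (U - A) \<le> \<delta>" "emeasure \<mu> (U - A) < \<infinity>"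
      using \<delta> by (auto simp: measure_def enn2real_leI le_less_trans)
  qed
  obtain K where K: "compact K" "K \<subseteq> U" "emeasure \<mu> U \<le> emeasure \<mu> K + ennreal \<delta>"
  proof (cases "emeasure \<mu> U = 0")
    case True
    then show thesis using that[of "{}"] by simp
  next
    case False
    then have "emeasure \<mu> U - ennreal \<delta> < emeasure \<mu> U"
      using U_fin \<delta> by (intro ennreal_between) (auto simp: less_top[symmetric] zero_less_iff_neq_zero)
    then have "emeasure \<mu> U - ennreal \<delta> < (SUP K\<in>{K. compact K \<and> K \<subseteq> U}. emeasure \<mu> K)"
      using inner_regular[OF U(1)] by simp
    then obtain K where K: "compact K" "K \<subseteq> U" "emeasure \<mu> U - ennreal \<delta> < emeasure \<mu> K"
      by (auto simp: less_SUP_iff)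
    then have "emeasure \<mu> U \<le> emeasure \<mu> K + ennreal \<delta>"
      by (metis add.commute ennreal_minus_le_iff less_imp_le ennreal_less_top less_irrefl)
    then show thesis using that K by blast
  qed
  have K_sets: "K \<in> sets \<mu>" using borel_compact[OF K(1)] by (simp add: sets_eq)
  have UK: "measure \<mu> (U - K) \<le> \<delta>" "emeasure \<mu> (U - K) < \<infinity>"
  proof -
    have "emeasure \<mu> (U - K) = emeasure \<mu> U - emeasure \<mu> K"
      using U K U_sets K_sets emeasure_compact_finite[OF K(1)] by (intro emeasure_Diff) (auto simp: less_top)
    also have "\<dots> \<le> ennreal \<delta>"
      using K emeasure_compact_finite[OF K(1)] by (intro ennreal_minus_le_iff[THEN iffD2]) auto
    finally have "emeasure \<mu> (U - K) \<le> ennreal \<delta>" .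
    then show "measure \<mu> (U - K) \<le> \<delta>" "emeasure \<mu> (U - K) < \<infinity>"
      using \<delta> by (auto simp: measure_def enn2real_leI le_less_trans)
  qed
  obtain h :: "'a \<Rightarrow> real" where h: "compactly_supported h" "\<And>x. 0 \<le> h x" "\<And>x. h x \<le> 1"
    "\<And>x. x \<in> K \<Longrightarrow> h x = 1" "\<And>x. x \<notin> U \<Longrightarrow> h x = 0"
    using compactly_supported_Urysohn[OF lc K(1) U(1) K(2)] by metis
  define g where "g x = complex_of_real (h x)" for x
  have g: "compactly_supported g"
    using h(1) unfolding compactly_supported_def g_def by (auto intro!: continuous_intros)
  have g_meas: "g \<in> borel_measurable \<mu>"
    using compactly_supported_measurable[OF g] by (simp add: borel_measurable_eq)
  define u where "u x = complex_of_real (indicat_real A x) - of_real (indicat_real U x)" for x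
  define v where "v x = complex_of_real (indicat_real U x) - g x" for x
  have meas: "u \<in> borel_measurable \<mu>" "v \<in> borel_measurable \<mu>"
    unfolding u_def v_def using U_sets g_meas by (auto intro!: borel_measurable_diff borel_measurable_of_real borel_measurable_indicator)
  have root: "measure \<mu> S powr (1 / p) \<le> \<epsilon> / 2" if "measure \<mu> S \<le> \<delta>" for S
    unfolding \<delta>_root[symmetric] using that p by (intro powr_mono2) auto
  have u0: "u x = 0" if "x \<notin> U - A" for x
    using that U(2) by (auto simp: u_def indicator_def)
  have u1: "cmod (u x) \<le> 1" for x by (simp add: u_def indicator_def)
  have v0: "v x = 0" if "x \<notin> U - K" for x
    using that h(4,5)[of x] by (auto simp: v_def g_def indicator_def)
  have v1: "cmod (v x) \<le> 1" for x
  proof -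
    have "v x = of_real (indicat_real U x - h x)" by (simp add: v_def g_def)
    then have "cmod (v x) = \<bar>indicat_real U x - h x\<bar>" by (metis norm_of_real)
    also have "\<dots> \<le> 1" using h(2,3,5)[of x] by (auto simp: indicator_def)
    finally show ?thesis .
  qed
  have sets: "U - A \<in> sets borel" "U - K \<in> sets borel"
    using U_sets K_sets by (auto simp: sets_eq)
  note u = Lp_bounded_with_support[OF p meas(1) sets(1) UA(2) u0 zero_le_one u1]
  note v = Lp_bounded_with_support[OF p meas(2) sets(2) UK(2) v0 zero_le_one v1]
  have "Lp_norm \<mu> p (\<lambda>x. of_real (indicat_real A x) - g x) = Lp_norm \<mu> p (\<lambda>x. u x + v x)"
    by (simp add: u_def v_def)
  also have "\<dots> \<le> Lp_norm \<mu> p u + Lp_norm \<mu> p v" by (rule Lp_norm_triangle[OF p u(1) v(1)])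
  also have "\<dots> \<le> \<epsilon>" using u(2) v(2) root[OF UA(1)] root[OF UK(1)] by simp
  finally show thesis using that g by blast
qed

text \<open>
  The functions that can be approximated form a vector space closed under limits in norm and, by the
  previous lemma, contain the indicators of sets of finite measure. Every \<open>f\<close> in \<open>L\<^sup>p\<close> is the limit of
  simple functions dominated by \<open>2 * cmod (f x)\<close>, whose nonzero level sets have finite measure.
\<close>
theorem compactly_supported_dense:
  assumes p: "p \<ge> 1" and f: "f \<in> Lp_fun \<mu> p" and \<epsilon>: "\<epsilon> > 0"
  obtains g where "compactly_supported g" "Lp_norm \<mu> p (\<lambda>x. f x - g x) \<le> \<epsilon>"
proof -
  define approx where "approx f \<longleftrightarrow> f \<in> Lp_fun \<mu> p \<and>
    (\<forall>\<epsilon>>0. \<exists>g. compactly_supported g \<and> Lp_norm \<mu> p (\<lambda>x. f x - g x) \<le> \<epsilon>)" for f :: "'a \<Rightarrow> complex"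
  have zero: "approx (\<lambda>x. 0)"
  proof -
    have "compactly_supported (\<lambda>x::'a. 0::complex)"
      unfolding compactly_supported_def by (auto intro: exI[of _ "{}"])
    then show ?thesis
      unfolding approx_def using Lp_fun_zero Lp_norm_zero[of \<mu> p] by (auto intro!: exI[of _ "\<lambda>x. 0"])
  qed
  have add: "approx (\<lambda>x. u x + v x)" if u: "approx u" and v: "approx v" for u v
    unfolding approx_def
  proof (intro conjI allI impI)
    show "(\<lambda>x. u x + v x) \<in> Lp_fun \<mu> p" using u v p unfolding approx_def by (blast intro: Lp_fun_add)
    fix \<epsilon> :: real assume "\<epsilon> > 0"
    then have e2: "\<epsilon> / 2 > 0" by simp
    obtain g where g: "compactly_supported g" "Lp_norm \<mu> p (\<lambda>x. u x - g x) \<le> \<epsilon> / 2"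
      using u e2 unfolding approx_def by metis
    obtain h where h: "compactly_supported h" "Lp_norm \<mu> p (\<lambda>x. v x - h x) \<le> \<epsilon> / 2"
      using v e2 unfolding approx_def by metis
    have "Lp_norm \<mu> p (\<lambda>x. (u x - g x) + (v x - h x)) \<le> Lp_norm \<mu> p (\<lambda>x. u x - g x) + Lp_norm \<mu> p (\<lambda>x. v x - h x)"
    proof (rule Lp_norm_triangle[OF p])
      show "(\<lambda>x. u x - g x) \<in> Lp_fun \<mu> p" "(\<lambda>x. v x - h x) \<in> Lp_fun \<mu> p"
        using u v g(1) h(1) p unfolding approx_def
        by (simp_all add: Lp_fun_diff compactly_supported_in_Lp)
    qed
    also have "\<dots> \<le> \<epsilon>" using g h by simp
    finally have "Lp_norm \<mu> p (\<lambda>x. u x + v x - (g x + h x)) \<le> \<epsilon>" by (simp add: algebra_simps)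
    then show "\<exists>g. compactly_supported g \<and> Lp_norm \<mu> p (\<lambda>x. u x + v x - g x) \<le> \<epsilon>"
      using compactly_supported_add[OF g(1) h(1)] by (intro exI[of _ "\<lambda>x. g x + h x"]) simp
  qed
  have ind: "approx (\<lambda>x. c * of_real (indicat_real A x))"
    if A: "A \<in> sets borel" "emeasure \<mu> A < \<infinity>" for A c
  proof -
    have [measurable]: "A \<in> sets \<mu>" using A(1) by (simp add: sets_eq)
    have meas: "(\<lambda>x. complex_of_real (indicat_real A x)) \<in> borel_measurable \<mu>"
      by measurable
    have "(\<lambda>x. complex_of_real (indicat_real A x)) \<in> Lp_fun \<mu> p"
      by (rule Lp_bounded_with_support(1)[OF p meas A, of 1]) (auto simp: indicator_def)
    then have Lp: "(\<lambda>x. c * of_real (indicat_real A x)) \<in> Lp_fun \<mu> p" by (rule Lp_fun_cmult)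
    show ?thesis
      unfolding approx_def
    proof (intro conjI Lp allI impI)
      fix \<epsilon> :: real assume \<epsilon>: "\<epsilon> > 0"
      define \<delta> where "\<delta> = \<epsilon> / (cmod c + 1)"
      have \<delta>: "\<delta> > 0" using \<epsilon> by (simp add: \<delta>_def add_nonneg_pos)
      obtain g :: "'a \<Rightarrow> complex" where g: "compactly_supported g"
        "Lp_norm \<mu> p (\<lambda>x. of_real (indicat_real A x) - g x) \<le> \<delta>"
        using indicator_Lp_approximable[OF p A \<delta>] by metis
      have "Lp_norm \<mu> p (\<lambda>x. c * of_real (indicat_real A x) - c * g x)
          = cmod c * Lp_norm \<mu> p (\<lambda>x. of_real (indicat_real A x) - g x)"
        unfolding right_diff_distrib[symmetric] by (rule Lp_norm_cmult[OF p])
      also have "\<dots> \<le> cmod c * \<delta>" using g(2) by (intro mult_left_mono) auto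
      also have "\<dots> \<le> \<epsilon>"
        using mult_divide_add_one_le[OF \<epsilon>, of "cmod c"] by (simp add: \<delta>_def mult.commute)
      finally have *: "Lp_norm \<mu> p (\<lambda>x. c * of_real (indicat_real A x) - c * g x) \<le> \<epsilon>" .
      have "compactly_supported (\<lambda>x. c * g x)"
        using g(1) unfolding compactly_supported_def by (auto intro!: continuous_intros)
      then show "\<exists>g. compactly_supported g \<and> Lp_norm \<mu> p (\<lambda>x. c * of_real (indicat_real A x) - g x) \<le> \<epsilon>"
        using * by (intro exI[of _ "\<lambda>x. c * g x"]) simp
    qed
  qed
  have simple: "approx s" if s: "simple_function \<mu> s" and sL: "s \<in> Lp_fun \<mu> p" for s
  proof -
    have fin: "finite (range s)" using s by (simp add: simple_function_def)
    have level: "s -` {y} \<in> sets borel" for y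
      using simple_functionD(2)[OF s, of "{y}"] by (simp add: sets_eq)
    have summand: "approx (\<lambda>x. y * of_real (indicat_real (s -` {y}) x))" for y
    proof (cases "y = 0")
      case True
      then show ?thesis using zero by simp
    next
      case False
      have "ennreal (cmod y powr p) * emeasure \<mu> (s -` {y}) = (\<integral>\<^sup>+ x. ennreal (cmod y powr p) * indicator (s -` {y}) x \<partial>\<mu>)"
        using level by (intro nn_integral_cmult_indicator[symmetric]) (simp add: sets_eq)
      also have "\<dots> \<le> (\<integral>\<^sup>+ x. ennreal (cmod (s x) powr p) \<partial>\<mu>)"
        by (intro nn_integral_mono) (auto simp: indicator_def)
      also have "\<dots> < \<infinity>" using nn_integral_Lp_norm[OF p sL] by simp
      finally have "emeasure \<mu> (s -` {y}) < \<infinity>"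
        using False by (auto simp: ennreal_mult_less_top less_top[symmetric] ennreal_mult_eq_top_iff)
      then show ?thesis using level by (intro ind)
    qed
    have "approx (\<lambda>x. \<Sum>y\<in>Y. y * of_real (indicat_real (s -` {y}) x))" if "finite Y" for Y
      using that
    proof (induction rule: finite_induct)
      case empty
      then show ?case using zero by simp
    next
      case (insert y Y)
      then show ?case using add[OF summand[of y] insert.IH] by simp
    qed
    from this[OF fin] have "approx (\<lambda>x. \<Sum>y\<in>range s. y * of_real (indicat_real (s -` {y}) x))" .
    moreover have "(\<Sum>y\<in>range s. y * of_real (indicat_real (s -` {y}) x)) = s x" for x
    proof -
      have "(\<Sum>y\<in>range s. y * of_real (indicat_real (s -` {y}) x)) = (\<Sum>y\<in>range s. if y = s x then s x else 0)"
        by (intro sum.cong) (auto simp: indicator_def)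
      then show ?thesis using fin by simp
    qed
    ultimately show ?thesis by simp
  qed
  have f_meas [measurable]: "f \<in> borel_measurable \<mu>" using f by (rule Lp_fun_measurable)
  obtain s where s: "\<And>i. simple_function \<mu> (s i)" "\<And>x. (\<lambda>i. s i x) \<longlonglongrightarrow> f x"
    "\<And>i x. cmod (s i x) \<le> 2 * cmod (f x)"
    using borel_measurable_implies_sequence_metric[OF f_meas, of 0] by (auto simp: dist_norm)
  have [measurable]: "s i \<in> borel_measurable \<mu>" for i using s(1) by (rule borel_measurable_simple_function)
  have dom: "cmod (f x - s i x) \<le> cmod (3 * f x)" for i x
    using norm_triangle_ineq4[of "f x" "s i x"] s(3)[of i x] by (simp add: norm_mult)
  have s_Lp: "s i \<in> Lp_fun \<mu> p" for i
    using Lp_fun_mono(1)[OF p _ Lp_fun_cmult[OF f, of 2], of "s i"] s(3) by (simp add: norm_mult)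
  have "(\<lambda>i. LINT x|\<mu>. cmod (f x - s i x) powr p) \<longlonglongrightarrow> (LINT x|\<mu>. 0)"
  proof (rule integral_dominated_convergence)
    show "integrable \<mu> (\<lambda>x. cmod (3 * f x) powr p)"
      using Lp_fun_cmult[OF f, of 3] by (simp add: Lp_fun_def)
    show "AE x in \<mu>. (\<lambda>i. cmod (f x - s i x) powr p) \<longlonglongrightarrow> 0"
    proof (rule AE_I2)
      fix x
      have "(\<lambda>i. cmod (f x - s i x)) \<longlonglongrightarrow> cmod (f x - f x)"
        using s(2) by (intro tendsto_intros)
      then have "(\<lambda>i. cmod (f x - s i x) powr p) \<longlonglongrightarrow> 0 powr p"
        using p by (intro tendsto_powr' tendsto_const) auto
      then show "(\<lambda>i. cmod (f x - s i x) powr p) \<longlonglongrightarrow> 0" using p by simp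
    qed
    show "AE x in \<mu>. norm (cmod (f x - s i x) powr p) \<le> cmod (3 * f x) powr p" for i
      using dom p by (intro AE_I2) (simp add: powr_mono2)
  qed simp_all
  then have "(\<lambda>i. LINT x|\<mu>. cmod (f x - s i x) powr p) \<longlonglongrightarrow> 0" by simp
  moreover have "(\<epsilon> / 2) powr p > 0" using \<epsilon> by simp
  ultimately have "\<forall>\<^sub>F i in sequentially. (LINT x|\<mu>. cmod (f x - s i x) powr p) < (\<epsilon> / 2) powr p"
    by (rule order_tendstoD)
  from eventually_happens'[OF sequentially_bot this]
  obtain i where "(LINT x|\<mu>. cmod (f x - s i x) powr p) < (\<epsilon> / 2) powr p" ..
  then have i: "Lp_norm \<mu> p (\<lambda>x. f x - s i x) \<le> \<epsilon> / 2"
    using \<epsilon> by (intro Lp_norm_leI[OF p]) auto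
  have e2: "\<epsilon> / 2 > 0" using \<epsilon> by simp
  obtain g where g: "compactly_supported g" "Lp_norm \<mu> p (\<lambda>x. s i x - g x) \<le> \<epsilon> / 2"
    using simple[OF s(1) s_Lp, of i] e2 unfolding approx_def by metis
  have "Lp_norm \<mu> p (\<lambda>x. f x - g x) \<le> Lp_norm \<mu> p (\<lambda>x. f x - s i x) + Lp_norm \<mu> p (\<lambda>x. s i x - g x)"
    by (rule Lp_norm_triangle_diff[OF p f s_Lp compactly_supported_in_Lp[OF p g(1)]])
  also have "\<dots> \<le> \<epsilon>" using i g(2) by simp
  finally show thesis using that g(1) by blast
qed

lemma compactly_supported_left_translation_continuous:
  assumes p: "p \<ge> 1" and g: "compactly_supported g" and \<epsilon>: "\<epsilon> > 0"
  obtains U where "open U" "0 \<in> U" "\<And>x. x \<in> U \<Longrightarrow> Lp_norm \<mu> p (\<lambda>y. g (x + y) - g y) \<le> \<epsilon>"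
proof -
  obtain K where K: "compact K" "\<And>x. x \<notin> K \<Longrightarrow> g x = 0"
    using g by (auto simp: compactly_supported_def)
  obtain V W :: "'a set" where W: "open V" "compact W" "0 \<in> V" "V \<subseteq> W"
    using compact_nhd[OF lc open_UNIV UNIV_I, of 0] by metis
  define S where "S = (\<lambda>(x, y). x + y) ` (uminus ` W \<times> K)"
  have S: "compact S" unfolding S_def
    using K(1) W(2) by (intro compact_sumset compact_continuous_image continuous_intros)
  have in_S: "y \<in> S" if "x \<in> W" "x + y \<in> K" for x y
    unfolding S_def using that by (intro image_eqI[of _ _ "(- x, x + y)"]) (auto simp: add.assoc[symmetric])
  define \<eta> where "\<eta> = \<epsilon> / (measure \<mu> S powr (1 / p) + 1)"
  have \<eta>: "\<eta> > 0" using \<epsilon> by (simp add: \<eta>_def add_nonneg_pos)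
  obtain N where N: "open N" "0 \<in> N" "\<And>v x. v \<in> N \<Longrightarrow> norm (g (v + x) - g x) \<le> \<eta>"
    using compactly_supported_uniformly_continuous_left[OF g \<eta>] by metis
  have meas: "(\<lambda>y. g (x + y) - g y) \<in> borel_measurable \<mu>" for x
    using compactly_supported_in_Lp[OF p g] p
    by (intro Lp_fun_measurable[of _ _ p] Lp_fun_diff Lp_left_translation)
  show thesis
  proof (rule that[of "N \<inter> V"])
    fix x assume x: "x \<in> N \<inter> V"
    have zero: "g (x + y) - g y = 0" if "y \<notin> S" for y
    proof -
      have "x \<in> W" "0 \<in> W" using x W by auto
      then have "x + y \<notin> K" "y \<notin> K" using that in_S[of x y] in_S[of 0 y] by auto
      then show ?thesis using K(2) by simp
    qed
    have "Lp_norm \<mu> p (\<lambda>y. g (x + y) - g y) \<le> \<eta> * measure \<mu> S powr (1 / p)"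
      using x N(3) \<eta> by (intro Lp_bounded_with_support(2)[OF p meas borel_compact[OF S] emeasure_compact_finite[OF S] zero]) auto
    also have "\<dots> \<le> \<epsilon>"
      unfolding \<eta>_def by (rule mult_divide_add_one_le[OF \<epsilon>]) simp
    finally show "Lp_norm \<mu> p (\<lambda>y. g (x + y) - g y) \<le> \<epsilon>" .
  qed (use N W in auto)
qed

lemma compactly_supported_right_translation_continuous:
  assumes p: "p \<ge> 1" and g: "compactly_supported g" and \<epsilon>: "\<epsilon> > 0"
  obtains U where "open U" "0 \<in> U" "\<And>x. x \<in> U \<Longrightarrow> Lp_norm \<mu> p (\<lambda>y. g (y + x) - g y) \<le> \<epsilon>"
proof -
  obtain K where K: "compact K" "\<And>x. x \<notin> K \<Longrightarrow> g x = 0"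
    using g by (auto simp: compactly_supported_def)
  obtain V W :: "'a set" where W: "open V" "compact W" "0 \<in> V" "V \<subseteq> W"
    using compact_nhd[OF lc open_UNIV UNIV_I, of 0] by metis
  define S where "S = (\<lambda>(x, y). x - y) ` (K \<times> W)"
  have S: "compact S" unfolding S_def using K(1) W(2) by (rule compact_diffset)
  have in_S: "y \<in> S" if "x \<in> W" "y + x \<in> K" for x y
    unfolding S_def using that by (intro image_eqI[of _ _ "(y + x, x)"]) auto
  define \<eta> where "\<eta> = \<epsilon> / (measure \<mu> S powr (1 / p) + 1)"
  have \<eta>: "\<eta> > 0" using \<epsilon> by (simp add: \<eta>_def add_nonneg_pos)
  obtain N where N: "open N" "0 \<in> N" "\<And>v x. v \<in> N \<Longrightarrow> norm (g (x + v) - g x) \<le> \<eta>"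
    using compactly_supported_uniformly_continuous_right[OF g \<eta>] by metis
  have meas: "(\<lambda>y. g (y + x) - g y) \<in> borel_measurable \<mu>" for x
    using compactly_supported_in_Lp[OF p g] p
    by (intro Lp_fun_measurable[of _ _ p] Lp_fun_diff Lp_right_translation)
  show thesis
  proof (rule that[of "N \<inter> V"])
    fix x assume x: "x \<in> N \<inter> V"
    have zero: "g (y + x) - g y = 0" if "y \<notin> S" for y
    proof -
      have "x \<in> W" "0 \<in> W" using x W by auto
      then have "y + x \<notin> K" "y \<notin> K" using that in_S[of x y] in_S[of 0 y] by auto
      then show ?thesis using K(2) by simp
    qed
    have "Lp_norm \<mu> p (\<lambda>y. g (y + x) - g y) \<le> \<eta> * measure \<mu> S powr (1 / p)"
      using x N(3) \<eta> by (intro Lp_bounded_with_support(2)[OF p meas borel_compact[OF S] emeasure_compact_finite[OF S] zero]) auto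
    also have "\<dots> \<le> \<epsilon>"
      unfolding \<eta>_def by (rule mult_divide_add_one_le[OF \<epsilon>]) simp
    finally show "Lp_norm \<mu> p (\<lambda>y. g (y + x) - g y) \<le> \<epsilon>" .
  qed (use N W in auto)
qed

lemma Lp_translation_three_terms:
  assumes p: "p \<ge> 1" and f: "f \<in> Lp_fun \<mu> p" and g: "g \<in> Lp_fun \<mu> p"
    and T: "\<And>f. f \<in> Lp_fun \<mu> p \<Longrightarrow>
      (\<lambda>y. f (t y)) \<in> Lp_fun \<mu> p \<and> Lp_norm \<mu> p (\<lambda>y. f (t y)) \<le> C * Lp_norm \<mu> p f"
  shows "Lp_norm \<mu> p (\<lambda>y. f (t y) - f y) \<le> (C + 1) * Lp_norm \<mu> p (\<lambda>y. f y - g y) + Lp_norm \<mu> p (\<lambda>y. g (t y) - g y)"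
proof -
  have fT: "(\<lambda>y. f (t y)) \<in> Lp_fun \<mu> p" and gT: "(\<lambda>y. g (t y)) \<in> Lp_fun \<mu> p"
    using T f g by auto
  have "Lp_norm \<mu> p (\<lambda>y. f (t y) - f y)
      \<le> Lp_norm \<mu> p (\<lambda>y. f (t y) - g (t y)) + Lp_norm \<mu> p (\<lambda>y. g (t y) - f y)"
    by (rule Lp_norm_triangle_diff[OF p fT gT f])
  also have "Lp_norm \<mu> p (\<lambda>y. g (t y) - f y) \<le> Lp_norm \<mu> p (\<lambda>y. g (t y) - g y) + Lp_norm \<mu> p (\<lambda>y. g y - f y)"
    by (rule Lp_norm_triangle_diff[OF p gT g f])
  also have "Lp_norm \<mu> p (\<lambda>y. f (t y) - g (t y)) \<le> C * Lp_norm \<mu> p (\<lambda>y. f y - g y)"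
    using T[OF Lp_fun_diff[OF p f g]] by simp
  finally show ?thesis
    unfolding Lp_norm_minus_commute[of \<mu> p g f] by (simp add: algebra_simps)
qed

text \<open>
  Both continuity statements for translations extend from the dense subspace by the same
  three-term estimate, as the translations near \<open>0\<close> have bounded operator norms.
\<close>
lemma Lp_continuous_by_density:
  fixes T :: "'a \<Rightarrow> 'a \<Rightarrow> 'a"
  assumes p: "p \<ge> 1" and f: "f \<in> Lp_fun \<mu> p" and \<epsilon>: "\<epsilon> > 0" and C: "C > 0" and V: "open V" "0 \<in> V"
    and T: "\<And>x f. x \<in> V \<Longrightarrow> f \<in> Lp_fun \<mu> p \<Longrightarrow>
      (\<lambda>y. f (T x y)) \<in> Lp_fun \<mu> p \<and> Lp_norm \<mu> p (\<lambda>y. f (T x y)) \<le> C * Lp_norm \<mu> p f"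
    and cont: "\<And>g \<epsilon>. compactly_supported g \<Longrightarrow> \<epsilon> > 0 \<Longrightarrow>
      \<exists>U. open U \<and> 0 \<in> U \<and> (\<forall>x\<in>U. Lp_norm \<mu> p (\<lambda>y. g (T x y) - g y) \<le> \<epsilon>)"
  obtains U where "open U" "0 \<in> U" "\<And>x. x \<in> U \<Longrightarrow> Lp_norm \<mu> p (\<lambda>y. f (T x y) - f y) \<le> \<epsilon>"
proof -
  define \<delta> where "\<delta> = \<epsilon> / (2 * (C + 1))"
  have \<delta>: "\<delta> > 0" using \<epsilon> C by (simp add: \<delta>_def)
  have \<delta>_eq: "(C + 1) * \<delta> = \<epsilon> / 2" using C by (simp add: \<delta>_def field_simps)
  obtain g where g: "compactly_supported g" "Lp_norm \<mu> p (\<lambda>x. f x - g x) \<le> \<delta>"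
    using compactly_supported_dense[OF p f \<delta>] by metis
  have gL: "g \<in> Lp_fun \<mu> p" using g(1) by (rule compactly_supported_in_Lp[OF p])
  have "\<epsilon> / 2 > 0" using \<epsilon> by simp
  from cont[OF g(1) this] obtain U where U: "open U" "0 \<in> U"
    "\<And>x. x \<in> U \<Longrightarrow> Lp_norm \<mu> p (\<lambda>y. g (T x y) - g y) \<le> \<epsilon> / 2"
    by metis
  show thesis
  proof (rule that[of "U \<inter> V"])
    fix x assume x: "x \<in> U \<inter> V"
    have "Lp_norm \<mu> p (\<lambda>y. f (T x y) - f y)
        \<le> (C + 1) * Lp_norm \<mu> p (\<lambda>y. f y - g y) + Lp_norm \<mu> p (\<lambda>y. g (T x y) - g y)"
      using x by (intro Lp_translation_three_terms[OF p f gL] T) simp_all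
    also have "\<dots> \<le> (C + 1) * \<delta> + \<epsilon> / 2"
      using C g(2) U(3) x by (intro add_mono mult_left_mono) auto
    also have "\<dots> = \<epsilon>" using \<delta>_eq by simp
    finally show "Lp_norm \<mu> p (\<lambda>y. f (T x y) - f y) \<le> \<epsilon>" .
  qed (use U V in auto)
qed

lemma Lp_left_translation_continuous:
  assumes p: "p \<ge> 1" and f: "f \<in> Lp_fun \<mu> p" and \<epsilon>: "\<epsilon> > 0"
  obtains U where "open U" "0 \<in> U" "\<And>x. x \<in> U \<Longrightarrow> Lp_norm \<mu> p (\<lambda>y. f (x + y) - f y) \<le> \<epsilon>"
proof (rule Lp_continuous_by_density[OF p f \<epsilon> zero_less_one open_UNIV UNIV_I, of "(+)"])
  show "\<exists>U. open U \<and> 0 \<in> U \<and> (\<forall>x\<in>U. Lp_norm \<mu> p (\<lambda>y. g (x + y) - g y) \<le> \<epsilon>)"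
    if "compactly_supported g" "\<epsilon> > 0" for g \<epsilon>
    using compactly_supported_left_translation_continuous[OF p that] by metis
qed (use Lp_left_translation that in auto)

lemma Lp_right_translation_continuous:
  assumes p: "p \<ge> 1" and f: "f \<in> Lp_fun \<mu> p" and \<epsilon>: "\<epsilon> > 0"
  obtains U where "open U" "0 \<in> U" "\<And>x. x \<in> U \<Longrightarrow> Lp_norm \<mu> p (\<lambda>y. f (y + x) - f y) \<le> \<epsilon>"
proof -
  obtain V W :: "'a set" where W: "open V" "compact W" "0 \<in> V" "V \<subseteq> W"
    using compact_nhd[OF lc open_UNIV UNIV_I, of 0] by metis
  obtain C where C: "C > 0" "\<And>w f. w \<in> W \<Longrightarrow> f \<in> Lp_fun \<mu> p \<Longrightarrow>
    (\<lambda>y. f (y + w)) \<in> Lp_fun \<mu> p \<and> Lp_norm \<mu> p (\<lambda>y. f (y + w)) \<le> C * Lp_norm \<mu> p f"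
    using Lp_right_translation_bounded[OF p W(2)] by metis
  show thesis
  proof (rule Lp_continuous_by_density[OF p f \<epsilon> C(1) W(1,3), of "\<lambda>x y. y + x"])
    show "\<exists>U. open U \<and> 0 \<in> U \<and> (\<forall>x\<in>U. Lp_norm \<mu> p (\<lambda>y. g (y + x) - g y) \<le> \<epsilon>)"
      if "compactly_supported g" "\<epsilon> > 0" for g \<epsilon>
      using compactly_supported_right_translation_continuous[OF p that] by metis
  qed (use C(2) W(4) that in auto)
qed

end

section \<open>Local averaging\<close>

lemma le_one_plus_powr: "r \<le> 1 + r powr p" if "p \<ge> 1" "r \<ge> 0" for r p :: real
proof (cases "r \<le> 1")
  case False
  then have "r powr 1 \<le> r powr p" using that by (intro powr_mono) auto
  then show ?thesis using False by simp
qed (use that in \<open>simp add: add_increasing2\<close>)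

text \<open>
  A function on \<open>K\<close> is averaged around \<open>s x\<close> instead of \<open>x\<close>, which leaves only finitely many averages.
  The last assumption says that the translate \<open>s x + U\<close>, over which the mean is taken, is contained in
  \<open>x + V\<close>. The pieces of \<open>K\<close> on which \<open>s\<close> is constant are tiny in comparison with \<open>U\<close>, so that \<open>V\<close>
  can be a slight enlargement of \<open>U\<close>, of at most twice its measure.
\<close>
locale averaging = locally_compact_haar \<mu>
  for \<mu> :: "'a::{topological_group_add,t2_space} measure" +
  fixes p :: real and K U V W :: "'a set" and s :: "'a \<Rightarrow> 'a"
  assumes p: "p \<ge> 1"
    and K: "compact K" and U: "compact U" and V: "open V" and W: "compact W" and VW: "V \<subseteq> W"
    and U_pos: "0 < measure \<mu> U" and V_le: "measure \<mu> V \<le> 2 * measure \<mu> U"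
    and s_meas: "s \<in> borel \<rightarrow>\<^sub>M count_space UNIV" and s_finite: "finite (s ` K)"
    and s_close: "\<And>x u. x \<in> K \<Longrightarrow> u \<in> U \<Longrightarrow> - x + (s x + u) \<in> V"
begin

definition mean :: "('a \<Rightarrow> complex) \<Rightarrow> 'a \<Rightarrow> complex" where
  "mean f z = (LINT u|\<mu>. of_real (indicat_real U u) * f (z + u)) / of_real (measure \<mu> U)"

definition smooth :: "('a \<Rightarrow> complex) \<Rightarrow> 'a \<Rightarrow> complex" where
  "smooth f x = of_real (indicat_real K x) * mean f (s x)"

lemma sets_UVWK [measurable]: "U \<in> sets \<mu>" "V \<in> sets \<mu>" "W \<in> sets \<mu>" "K \<in> sets \<mu>"
  using K U V W by (auto simp: sets_eq borel_compact)

lemma U_finite: "emeasure \<mu> U < \<infinity>" and K_finite: "emeasure \<mu> K < \<infinity>" and V_finite: "emeasure \<mu> V < \<infinity>"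
proof -
  show "emeasure \<mu> U < \<infinity>" "emeasure \<mu> K < \<infinity>"
    using U K emeasure_compact_finite by auto
  have "emeasure \<mu> V \<le> emeasure \<mu> W" using VW by (intro emeasure_mono) auto
  then show "emeasure \<mu> V < \<infinity>" using emeasure_compact_finite[OF W] by (rule le_less_trans)
qed

text \<open>
  The inequality \<open>r \<le> 1 + r powr p\<close> for \<open>r = cmod (f (z + u)) / a\<close> plays the part of Hoelder's
  inequality, at the price of a worse constant.
\<close>
lemma mean_bounded:
  assumes f: "f \<in> Lp_fun \<mu> p" and a: "a > 0" "Lp_norm \<mu> p f \<le> a"
  shows "integrable \<mu> (\<lambda>u. of_real (indicat_real U u) * f (z + u))"
    and "cmod (mean f z) \<le> a * ((measure \<mu> U + 1) / measure \<mu> U)"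
proof -
  have fz: "(\<lambda>u. f (z + u)) \<in> Lp_fun \<mu> p" "Lp_norm \<mu> p (\<lambda>u. f (z + u)) \<le> a"
    using Lp_left_translation[OF f] a(2) by auto
  then have int_p: "integrable \<mu> (\<lambda>u. cmod (f (z + u)) powr p)" by (simp add: Lp_fun_def)
  have [measurable]: "(\<lambda>u. f (z + u)) \<in> borel_measurable \<mu>" using fz(1) by (rule Lp_fun_measurable)
  let ?b = "\<lambda>u. a * (indicat_real U u + cmod (f (z + u)) powr p / a powr p)"
  have int_b: "integrable \<mu> ?b"
    using int_p U_finite by (intro integrable_mult_right integrable_add integrable_real_indicator integrable_divide_zero) auto
  have le: "cmod (of_real (indicat_real U u) * f (z + u)) \<le> ?b u" for u
  proof (cases "u \<in> U")
    case True
    have "cmod (f (z + u)) / a \<le> 1 + (cmod (f (z + u)) / a) powr p"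
      using a(1) by (intro le_one_plus_powr p) simp
    then have "cmod (f (z + u)) \<le> a * (1 + cmod (f (z + u)) powr p / a powr p)"
      using a(1) by (simp add: powr_divide field_simps)
    then show ?thesis using True by simp
  qed (use a(1) in simp)
  show int: "integrable \<mu> (\<lambda>u. of_real (indicat_real U u) * f (z + u))"
  proof (rule Bochner_Integration.integrable_bound[OF int_b])
    show "AE u in \<mu>. norm (of_real (indicat_real U u) * f (z + u)) \<le> norm (?b u)"
      using le by (intro AE_I2) (auto intro: order_trans abs_ge_self)
  qed measurable
  have "cmod (LINT u|\<mu>. of_real (indicat_real U u) * f (z + u)) \<le> (LINT u|\<mu>. ?b u)"
    by (rule integral_norm_le_integral[OF int int_b le])
  also have "\<dots> = a * (measure \<mu> U + (LINT u|\<mu>. cmod (f (z + u)) powr p) / a powr p)"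
    using int_p U_finite by (subst integral_mult_right_zero, subst Bochner_Integration.integral_add) auto
  also have "\<dots> \<le> a * (measure \<mu> U + 1)"
    using Lp_norm_powr_le[OF p fz(2)] a(1) by (intro mult_left_mono add_left_mono) auto
  finally show "cmod (mean f z) \<le> a * ((measure \<mu> U + 1) / measure \<mu> U)"
    unfolding mean_def using U_pos by (simp add: norm_divide divide_right_mono)
qed

lemma mean_integrable:
  assumes "f \<in> Lp_fun \<mu> p"
  shows "integrable \<mu> (\<lambda>u. of_real (indicat_real U u) * f (z + u))"
  by (rule mean_bounded(1)[OF assms, of "Lp_norm \<mu> p f + 1"]) (simp_all add: add_nonneg_pos)

lemma mean_diff:
  assumes "f \<in> Lp_fun \<mu> p" "g \<in> Lp_fun \<mu> p"
  shows "mean (\<lambda>x. f x - g x) z = mean f z - mean g z"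
  unfolding mean_def using mean_integrable assms by (simp add: right_diff_distrib diff_divide_distrib)

text \<open>Functions of this form make up a space of finite dimension, as \<open>s\<close> has finitely many values on \<open>K\<close>.\<close>
lemma step_function_Lp:
  assumes "B \<ge> 0" "\<And>x. x \<in> K \<Longrightarrow> cmod (\<psi> (s x)) \<le> B"
  shows "(\<lambda>x. of_real (indicat_real K x) * \<psi> (s x)) \<in> Lp_fun \<mu> p"
    and "Lp_norm \<mu> p (\<lambda>x. of_real (indicat_real K x) * \<psi> (s x)) \<le> B * measure \<mu> K powr (1 / p)"
proof -
  have "(\<lambda>x. \<psi> (s x)) \<in> borel_measurable borel"
    by (rule measurable_compose[OF s_meas]) simp
  then have [measurable]: "(\<lambda>x. \<psi> (s x)) \<in> borel_measurable \<mu>" by (simp add: borel_measurable_eq)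
  have meas: "(\<lambda>x. of_real (indicat_real K x) * \<psi> (s x)) \<in> borel_measurable \<mu>" by measurable
  have zero: "of_real (indicat_real K x) * \<psi> (s x) = 0" if "x \<notin> K" for x using that by simp
  have le: "cmod (of_real (indicat_real K x) * \<psi> (s x)) \<le> B" for x
    using assms by (cases "x \<in> K") auto
  show "(\<lambda>x. of_real (indicat_real K x) * \<psi> (s x)) \<in> Lp_fun \<mu> p"
    "Lp_norm \<mu> p (\<lambda>x. of_real (indicat_real K x) * \<psi> (s x)) \<le> B * measure \<mu> K powr (1 / p)"
    using Lp_bounded_with_support[OF p meas borel_compact[OF K] K_finite zero assms(1) le] by auto
qed

lemma smooth_bounded:
  assumes "f \<in> Lp_fun \<mu> p" "a > 0" "Lp_norm \<mu> p f \<le> a"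
  shows "smooth f \<in> Lp_fun \<mu> p"
    and "Lp_norm \<mu> p (smooth f) \<le> a * ((measure \<mu> U + 1) / measure \<mu> U) * measure \<mu> K powr (1 / p)"
  using step_function_Lp[of "a * ((measure \<mu> U + 1) / measure \<mu> U)" "mean f"]
    mean_bounded(2)[OF assms] assms(2) U_pos
  unfolding smooth_def[abs_def] by simp_all

text \<open>
  On \<open>K\<close>, the difference \<open>g x - mean g (s x)\<close> is an average of \<open>g x - g (x + w)\<close> over \<open>w\<close> in a
  subset of \<open>V\<close> whose measure is that of \<open>U\<close>, at least half the measure of \<open>V\<close>. By uniform continuity
  of \<open>g\<close>, the average over \<open>w\<close> is a Riemann sum over finitely many \<open>w \<in> W\<close> up to a uniformly small
  error, and the triangle inequality in \<open>L\<^sup>p\<close> applies to the sum.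
\<close>
lemma smooth_close_compactly_supported:
  assumes g: "compactly_supported g" and t0: "t \<ge> 0"
    and t: "\<And>w. w \<in> W \<Longrightarrow> Lp_norm \<mu> p (\<lambda>x. g (x + w) - g x) \<le> t"
  shows "Lp_norm \<mu> p (\<lambda>x. of_real (indicat_real K x) * g x - smooth g x) \<le> 2 * t"
proof -
  have gL: "g \<in> Lp_fun \<mu> p" using g by (rule compactly_supported_in_Lp[OF p])
  have [measurable]: "g \<in> borel_measurable \<mu>" using gL by (rule Lp_fun_measurable)
  have g_borel: "g \<in> borel_measurable borel" using g by (rule compactly_supported_measurable)
  obtain B where B: "\<And>x. cmod (g x) \<le> B" "B > 0" using compactly_supported_bounded[OF g] by metis
  define \<kappa> where "\<kappa> = measure \<mu> K powr (1 / p)"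
  have \<kappa>: "\<kappa> \<ge> 0" by (simp add: \<kappa>_def)
  have main: "Lp_norm \<mu> p (\<lambda>x. of_real (indicat_real K x) * g x - smooth g x) \<le> 2 * (t + \<eta> * \<kappa>)"
    if \<eta>: "\<eta> > 0" for \<eta>
  proof -
    obtain N where N: "open N" "0 \<in> N" "\<And>v x. v \<in> N \<Longrightarrow> norm (g (x + v) - g x) \<le> \<eta>"
      using compactly_supported_uniformly_continuous_right[OF g \<eta>] by metis
    have "open {w. - q + w \<in> N} \<and> q \<in> {w. - q + w \<in> N}" for q
    proof -
      have "continuous_on UNIV (\<lambda>w. - q + w)" by (intro continuous_intros)
      then show ?thesis using N(2) open_vimage[OF N(1), of "\<lambda>w. - q + w"] by (simp add: vimage_def)
    qed
    then obtain Q q where Q: "finite Q" "Q \<subseteq> W" "\<And>w. w \<in> W \<Longrightarrow> q w \<in> Q \<and> w \<in> {z. - q w + z \<in> N}"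
      and q: "q \<in> borel \<rightarrow>\<^sub>M count_space UNIV"
      using finite_Borel_selection[OF W, of "\<lambda>q. {w. - q + w \<in> N}"] by metis
    have g_q: "cmod (g (x + w) - g (x + q w)) \<le> \<eta>" if "w \<in> W" for x w
    proof -
      have "- q w + w \<in> N" using Q(3)[OF that] by simp
      then have "cmod (g (x + q w + (- q w + w)) - g (x + q w)) \<le> \<eta>" by (rule N(3))
      moreover have "x + q w + (- q w + w) = x + w" by (simp add: add.assoc)
      ultimately show ?thesis by simp
    qed
    define E where "E z = V \<inter> q -` {z}" for z
    have E_sets: "E z \<in> sets \<mu>" for z
      unfolding E_def using measurable_sets[OF q, of "{z}"] by (auto simp: sets_eq V)
    have E_fin: "emeasure \<mu> (E z) < \<infinity>" for z
    proof -
      have "emeasure \<mu> (E z) \<le> emeasure \<mu> V" unfolding E_def by (intro emeasure_mono) auto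
      then show ?thesis using V_finite by (rule le_less_trans)
    qed
    have E_sum: "(\<Sum>z\<in>Q. measure \<mu> (E z)) = measure \<mu> V"
    proof -
      have "measure \<mu> (\<Union>z\<in>Q. E z) = (\<Sum>z\<in>Q. measure \<mu> (E z))"
        using Q(1) E_sets E_fin by (intro measure_finite_Union) (auto simp: disjoint_family_on_def E_def less_top)
      moreover have "(\<Union>z\<in>Q. E z) = V" using Q(3) VW by (auto simp: E_def)
      ultimately show ?thesis by simp
    qed
    define c where "c z = measure \<mu> (E z) / measure \<mu> U" for z
    have c0: "c z \<ge> 0" for z by (simp add: c_def)
    have c_sum: "(\<Sum>z\<in>Q. c z) \<le> 2"
      unfolding c_def sum_divide_distrib[symmetric] E_sum using V_le U_pos by (simp add: field_simps)
    define \<Phi> where "\<Phi> x = (\<Sum>z\<in>Q. of_real (c z) * (of_real (cmod (g (x + z) - g x)) + of_real (\<eta> * indicat_real K x) :: complex))" for x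
    have \<Phi>_eq: "\<Phi> x = of_real (\<Sum>z\<in>Q. c z * (cmod (g (x + z) - g x) + \<eta> * indicat_real K x))" for x
      by (simp add: \<Phi>_def)
    have \<Phi>_cmod: "cmod (\<Phi> x) = (\<Sum>z\<in>Q. c z * (cmod (g (x + z) - g x) + \<eta> * indicat_real K x))" for x
      unfolding \<Phi>_eq norm_of_real using c0 \<eta> by (intro abs_of_nonneg sum_nonneg mult_nonneg_nonneg add_nonneg_nonneg) auto
    have pointwise: "cmod (of_real (indicat_real K x) * g x - smooth g x) \<le> cmod (\<Phi> x)" for x
    proof (cases "x \<in> K")
      case False
      then show ?thesis by (simp add: smooth_def)
    next
      case True
      let ?r = "- s x + x"
      have int1: "integrable \<mu> (\<lambda>u. of_real (indicat_real U u) * g (s x + u))"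
        using gL by (rule mean_integrable)
      have int2: "integrable \<mu> (\<lambda>u. complex_of_real (indicat_real U u) * g x)"
        using U_finite by (intro integrable_mult_left integrable_of_real integrable_real_indicator) auto
      let ?h = "\<lambda>u. of_real (indicat_real U u) * (g x - g (s x + u))"
      have "g x - mean g (s x) = (LINT u|\<mu>. ?h u) / of_real (measure \<mu> U)"
      proof -
        have "(LINT u|\<mu>. ?h u) = (LINT u|\<mu>. of_real (indicat_real U u) * g x) - (LINT u|\<mu>. of_real (indicat_real U u) * g (s x + u))"
          using int1 int2 by (simp add: right_diff_distrib)
        also have "(LINT u|\<mu>. complex_of_real (indicat_real U u) * g x) = of_real (measure \<mu> U) * g x"
          by simp
        finally show ?thesis unfolding mean_def using U_pos by (simp add: field_simps)
      qed
      also have "(LINT u|\<mu>. ?h u) = (LINT w|\<mu>. ?h (?r + w))"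
      proof (rule integral_left_translation[symmetric])
        have "(\<lambda>u. g (s x + u)) \<in> borel_measurable borel"
          by (rule measurable_compose[OF borel_measurable_continuous_onI g_borel]) (intro continuous_intros)
        moreover have "(\<lambda>u. complex_of_real (indicat_real U u)) \<in> borel_measurable borel"
          using borel_compact[OF U] by measurable
        ultimately show "?h \<in> borel_measurable borel" by measurable
      qed
      finally have eq: "g x - mean g (s x) = (LINT w|\<mu>. ?h (?r + w)) / of_real (measure \<mu> U)" .
      have "cmod (LINT w|\<mu>. ?h (?r + w)) \<le> (LINT w|\<mu>. (\<Sum>z\<in>Q. indicat_real (E z) w * (cmod (g (x + z) - g x) + \<eta>)))"
      proof (rule integral_norm_le_integral)
        have "?h \<in> borel_measurable \<mu>"
          using borel_measurable_integrable[OF int1] by (simp add: right_diff_distrib)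
        have "integrable \<mu> ?h" using int1 int2 by (simp add: right_diff_distrib)
        then show "integrable \<mu> (\<lambda>w. ?h (?r + w))"
          using integrable_left_translation[of ?h ?r] by (simp add: borel_measurable_eq[symmetric] borel_measurable_integrable)
        show "integrable \<mu> (\<lambda>w. \<Sum>z\<in>Q. indicat_real (E z) w * (cmod (g (x + z) - g x) + \<eta>))"
          using E_sets E_fin by (intro Bochner_Integration.integrable_sum integrable_mult_left integrable_real_indicator) auto
        fix w
        have nonneg: "0 \<le> (\<Sum>z\<in>Q. indicat_real (E z) w * (cmod (g (x + z) - g x) + \<eta>))"
          using \<eta> by (intro sum_nonneg) simp
        show "cmod (?h (?r + w)) \<le> (\<Sum>z\<in>Q. indicat_real (E z) w * (cmod (g (x + z) - g x) + \<eta>))"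
        proof (cases "?r + w \<in> U")
          case False
          then show ?thesis using nonneg by simp
        next
          case inU: True
          have cancel: "s x + (?r + w) = x + w" by (simp add: add.assoc)
          then have "- x + (s x + (?r + w)) = w" by simp
          then have w: "w \<in> V" using s_close[OF True inU] by simp
          then have wQ: "q w \<in> Q" and wW: "w \<in> W" using Q(3) VW by auto
          have "(\<Sum>z\<in>Q. indicat_real (E z) w * (cmod (g (x + z) - g x) + \<eta>))
              = (\<Sum>z\<in>Q. if z = q w then cmod (g (x + q w) - g x) + \<eta> else 0)"
            using w by (intro sum.cong) (auto simp: E_def indicator_def)
          also have "\<dots> = cmod (g (x + q w) - g x) + \<eta>"
            using wQ Q(1) by simp
          finally have sum: "(\<Sum>z\<in>Q. indicat_real (E z) w * (cmod (g (x + z) - g x) + \<eta>))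
              = cmod (g (x + q w) - g x) + \<eta>" .
          have "cmod (?h (?r + w)) = cmod (g x - g (x + w))"
            unfolding cancel using inU by simp
          also have "\<dots> = cmod ((g (x + q w) - g x) + (g (x + w) - g (x + q w)))"
            by (simp add: norm_minus_commute)
          also have "\<dots> \<le> cmod (g (x + q w) - g x) + \<eta>"
            using norm_triangle_ineq[of "g (x + q w) - g x" "g (x + w) - g (x + q w)"] g_q[OF wW, of x] by linarith
          finally show ?thesis unfolding sum .
        qed
      qed
      also have "\<dots> = (\<Sum>z\<in>Q. measure \<mu> (E z) * (cmod (g (x + z) - g x) + \<eta>))"
        using E_sets E_fin
        by (subst Bochner_Integration.integral_sum) (auto intro!: integrable_mult_left integrable_real_indicator)
      finally have "cmod (g x - mean g (s x)) \<le> (\<Sum>z\<in>Q. measure \<mu> (E z) * (cmod (g (x + z) - g x) + \<eta>)) / measure \<mu> U"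
        unfolding eq using U_pos by (simp add: norm_divide divide_right_mono)
      also have "\<dots> = cmod (\<Phi> x)"
        unfolding \<Phi>_cmod using True by (simp add: c_def sum_divide_distrib)
      finally show ?thesis using True by (simp add: smooth_def)
    qed
    have ind: "(\<lambda>x. complex_of_real (\<eta> * indicat_real K x)) \<in> Lp_fun \<mu> p"
      "Lp_norm \<mu> p (\<lambda>x. complex_of_real (\<eta> * indicat_real K x)) \<le> \<eta> * \<kappa>"
      using step_function_Lp[of \<eta> "\<lambda>_. of_real \<eta>"] \<eta> by (simp_all add: \<kappa>_def mult.commute)
    have diff: "(\<lambda>x. complex_of_real (cmod (g (x + z) - g x))) \<in> Lp_fun \<mu> p \<and>
        Lp_norm \<mu> p (\<lambda>x. complex_of_real (cmod (g (x + z) - g x))) \<le> t" if "z \<in> Q" for z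
    proof -
      have L: "(\<lambda>x. g (x + z) - g x) \<in> Lp_fun \<mu> p"
        by (intro Lp_fun_diff Lp_right_translation p gL)
      then have [measurable]: "(\<lambda>x. g (x + z) - g x) \<in> borel_measurable \<mu>" by (rule Lp_fun_measurable)
      have "(\<lambda>x. complex_of_real (cmod (g (x + z) - g x))) \<in> borel_measurable \<mu>" by measurable
      from Lp_fun_mono[OF p this L] show ?thesis
        using t[of z] that Q(2) by force
    qed
    let ?\<phi> = "\<lambda>z x. of_real (c z) * (of_real (cmod (g (x + z) - g x)) + of_real (\<eta> * indicat_real K x) :: complex)"
    have term_Lp: "?\<phi> z \<in> Lp_fun \<mu> p" and term_norm: "Lp_norm \<mu> p (?\<phi> z) \<le> c z * (t + \<eta> * \<kappa>)"
      if z: "z \<in> Q" for z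
    proof -
      note d = diff[OF z]
      show "?\<phi> z \<in> Lp_fun \<mu> p"
        using Lp_fun_add[OF p conjunct1[OF d] ind(1)] by (rule Lp_fun_cmult)
      have "Lp_norm \<mu> p (?\<phi> z) = c z * Lp_norm \<mu> p (\<lambda>x. of_real (cmod (g (x + z) - g x)) + of_real (\<eta> * indicat_real K x))"
        using c0 by (subst Lp_norm_cmult[OF p]) simp
      also have "\<dots> \<le> c z * (t + \<eta> * \<kappa>)"
        using Lp_norm_triangle[OF p conjunct1[OF d] ind(1)] d ind(2) c0 by (intro mult_left_mono) auto
      finally show "Lp_norm \<mu> p (?\<phi> z) \<le> c z * (t + \<eta> * \<kappa>)" .
    qed
    have \<Phi>_fun: "\<Phi> = (\<lambda>x. \<Sum>z\<in>Q. ?\<phi> z x)" by (simp add: \<Phi>_def fun_eq_iff)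
    have \<Phi>: "\<Phi> \<in> Lp_fun \<mu> p" "Lp_norm \<mu> p \<Phi> \<le> (\<Sum>z\<in>Q. Lp_norm \<mu> p (?\<phi> z))"
      unfolding \<Phi>_fun using Lp_sum[OF p Q(1), of ?\<phi>] term_Lp by auto
    have meas: "(\<lambda>x. of_real (indicat_real K x) * g x - smooth g x) \<in> borel_measurable \<mu>"
      using Lp_fun_diff[OF p Lp_indicator_mult(1)[OF p sets_UVWK(4) gL] smooth_bounded(1)[OF gL, of "Lp_norm \<mu> p g + 1"]]
      by (auto simp: add_nonneg_pos intro: Lp_fun_measurable)
    have "Lp_norm \<mu> p (\<lambda>x. of_real (indicat_real K x) * g x - smooth g x) \<le> Lp_norm \<mu> p \<Phi>"
      by (rule Lp_fun_mono(2)[OF p meas \<Phi>(1) pointwise])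
    also have "\<dots> \<le> (\<Sum>z\<in>Q. c z * (t + \<eta> * \<kappa>))"
      using \<Phi>(2) sum_mono[of Q "\<lambda>z. Lp_norm \<mu> p (?\<phi> z)", OF term_norm] by (rule order_trans)
    also have "\<dots> \<le> 2 * (t + \<eta> * \<kappa>)"
      unfolding sum_distrib_right[symmetric] using c_sum t0 \<eta> \<kappa> by (intro mult_right_mono) auto
    finally show ?thesis .
  qed
  show ?thesis
  proof (rule field_le_epsilon)
    fix e :: real assume e: "e > 0"
    have "e / 2 / (\<kappa> + 1) > 0" using e \<kappa> by simp
    from main[OF this] have "Lp_norm \<mu> p (\<lambda>x. of_real (indicat_real K x) * g x - smooth g x)
        \<le> 2 * t + 2 * (e / 2 / (\<kappa> + 1) * \<kappa>)"
      by (simp only: distrib_left)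
    moreover have "e / 2 / (\<kappa> + 1) * \<kappa> \<le> e / 2"
      using e \<kappa> by (intro mult_divide_add_one_le) auto
    ultimately show "Lp_norm \<mu> p (\<lambda>x. of_real (indicat_real K x) * g x - smooth g x) \<le> 2 * t + e"
      by linarith
  qed
qed

text \<open>
  The terms of the estimate depend continuously on \<open>f\<close> in norm. The constant \<open>D\<close> in the proof collects
  the operator norms of the restriction to \<open>K\<close>, of the right differences and of the averaging.
\<close>
lemma smooth_close:
  assumes f: "f \<in> Lp_fun \<mu> p" and t0: "t \<ge> 0"
    and t: "\<And>w. w \<in> W \<Longrightarrow> Lp_norm \<mu> p (\<lambda>x. f (x + w) - f x) \<le> t"
  shows "Lp_norm \<mu> p (\<lambda>x. of_real (indicat_real K x) * f x - smooth f x) \<le> 2 * t"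
proof (rule field_le_epsilon)
  fix e :: real assume e: "e > 0"
  obtain C where C: "C > 0" "\<And>w f. w \<in> W \<Longrightarrow> f \<in> Lp_fun \<mu> p \<Longrightarrow>
    (\<lambda>y. f (y + w)) \<in> Lp_fun \<mu> p \<and> Lp_norm \<mu> p (\<lambda>y. f (y + w)) \<le> C * Lp_norm \<mu> p f"
    using Lp_right_translation_bounded[OF p W] by metis
  define A where "A = (measure \<mu> U + 1) / measure \<mu> U * measure \<mu> K powr (1 / p)"
  have A: "A \<ge> 0" by (simp add: A_def)
  define D where "D = 1 + 2 * (C + 1) + A"
  have D: "D > 0" using A C(1) by (simp add: D_def)
  define \<delta> where "\<delta> = e / D"
  have \<delta>: "\<delta> > 0" using e D by (simp add: \<delta>_def)
  have \<delta>D: "\<delta> * D = e" using D by (simp add: \<delta>_def)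
  obtain g where g: "compactly_supported g" "Lp_norm \<mu> p (\<lambda>x. f x - g x) \<le> \<delta>"
    using compactly_supported_dense[OF p f \<delta>] by metis
  have gL: "g \<in> Lp_fun \<mu> p" using g(1) by (rule compactly_supported_in_Lp[OF p])
  have fg: "(\<lambda>x. f x - g x) \<in> Lp_fun \<mu> p" using p f gL by (rule Lp_fun_diff)
  have "Lp_norm \<mu> p (\<lambda>x. g (x + w) - g x) \<le> (C + 1) * \<delta> + t" if w: "w \<in> W" for w
  proof -
    have "Lp_norm \<mu> p (\<lambda>x. g (x + w) - g x)
        \<le> (C + 1) * Lp_norm \<mu> p (\<lambda>x. g x - f x) + Lp_norm \<mu> p (\<lambda>x. f (x + w) - f x)"
      using C(2)[OF w] by (intro Lp_translation_three_terms[OF p gL f])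
    also have "\<dots> \<le> (C + 1) * \<delta> + t"
      using g(2) t[OF w] C(1) unfolding Lp_norm_minus_commute[of \<mu> p g f] by (intro add_mono mult_left_mono) auto
    finally show ?thesis .
  qed
  moreover have "(C + 1) * \<delta> + t \<ge> 0" using C(1) \<delta> t0 by simp
  ultimately
  have mid: "Lp_norm \<mu> p (\<lambda>x. of_real (indicat_real K x) * g x - smooth g x) \<le> 2 * ((C + 1) * \<delta> + t)"
    by (intro smooth_close_compactly_supported[OF g(1)])
  have smooth_diff: "smooth g x - smooth f x = - smooth (\<lambda>x. f x - g x) x" for x
    by (simp add: smooth_def mean_diff[OF f gL] algebra_simps)
  have last: "Lp_norm \<mu> p (\<lambda>x. smooth g x - smooth f x) \<le> \<delta> * A"
    using smooth_bounded(2)[OF fg \<delta> g(2)] unfolding smooth_diff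
    by (simp add: Lp_norm_def A_def mult.assoc)
  have first: "Lp_norm \<mu> p (\<lambda>x. of_real (indicat_real K x) * f x - of_real (indicat_real K x) * g x) \<le> \<delta>"
    using Lp_indicator_mult(2)[OF p sets_UVWK(4) fg] g(2) by (simp add: right_diff_distrib)
  have sL: "smooth f \<in> Lp_fun \<mu> p" "smooth g \<in> Lp_fun \<mu> p"
    using smooth_bounded(1)[OF f, of "Lp_norm \<mu> p f + 1"] smooth_bounded(1)[OF gL, of "Lp_norm \<mu> p g + 1"]
    by (simp_all add: add_nonneg_pos)
  note iL = Lp_indicator_mult(1)[OF p sets_UVWK(4) f] Lp_indicator_mult(1)[OF p sets_UVWK(4) gL]
  have "Lp_norm \<mu> p (\<lambda>x. of_real (indicat_real K x) * f x - smooth f x)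
      \<le> \<delta> + (2 * ((C + 1) * \<delta> + t) + \<delta> * A)"
    using Lp_norm_triangle_diff[OF p iL(1) iL(2) sL(1)] Lp_norm_triangle_diff[OF p iL(2) sL(2) sL(1)] first mid last
    by linarith
  also have "\<dots> = 2 * t + \<delta> * D" by (simp add: D_def algebra_simps)
  finally show "Lp_norm \<mu> p (\<lambda>x. of_real (indicat_real K x) * f x - smooth f x) \<le> 2 * t + e"
    unfolding \<delta>D .
qed

text \<open>
  The values of \<open>mean f\<close> at the finitely many points of \<open>s ` K\<close> are bounded uniformly in the
  family, so finitely many step functions come close to all the functions \<open>smooth f\<close>.
\<close>
lemma smooth_finite_net:
  assumes \<epsilon>: "\<epsilon> > 0" and B: "B > 0"
  obtains G where "finite G" "G \<subseteq> Lp_fun \<mu> p"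
    "\<And>f. f \<in> Lp_fun \<mu> p \<Longrightarrow> Lp_norm \<mu> p f \<le> B \<Longrightarrow> \<exists>g\<in>G. Lp_norm \<mu> p (\<lambda>x. smooth f x - g x) \<le> \<epsilon>"
proof -
  define R where "R = B * ((measure \<mu> U + 1) / measure \<mu> U)"
  have R: "R \<ge> 0" using B by (simp add: R_def)
  define \<theta> where "\<theta> = \<epsilon> / (measure \<mu> K powr (1 / p) + 1)"
  have \<theta>: "\<theta> > 0" using \<epsilon> by (simp add: \<theta>_def add_nonneg_pos)
  obtain D where D: "finite D" "D \<subseteq> cball (0::complex) R" "cball 0 R \<subseteq> (\<Union>d\<in>D. ball d \<theta>)"
    using compactE_image[OF compact_cball[of "0::complex" R], of "cball 0 R" "\<lambda>d. ball d \<theta>"] \<theta> by force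
  define step where "step \<psi> = (\<lambda>x. complex_of_real (indicat_real K x) * \<psi> (s x))" for \<psi>
  show thesis
  proof (rule that[of "step ` (s ` K \<rightarrow>\<^sub>E D)"])
    show "finite (step ` (s ` K \<rightarrow>\<^sub>E D))" by (rule finite_imageI[OF finite_PiE[OF s_finite D(1)]])
    show "step ` (s ` K \<rightarrow>\<^sub>E D) \<subseteq> Lp_fun \<mu> p"
    proof
      fix g assume "g \<in> step ` (s ` K \<rightarrow>\<^sub>E D)"
      then obtain \<psi> where \<psi>: "\<psi> \<in> s ` K \<rightarrow>\<^sub>E D" "g = step \<psi>" by blast
      have "cmod (\<psi> (s x)) \<le> R" if "x \<in> K" for x
      proof -
        have "\<psi> (s x) \<in> D" using \<psi>(1) that by (auto simp: PiE_iff)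
        then show ?thesis using D(2) by (auto simp: subset_iff)
      qed
      from step_function_Lp(1)[where \<psi> = \<psi>, OF R this] show "g \<in> Lp_fun \<mu> p" unfolding \<psi>(2) step_def .
    qed
    fix f assume f: "f \<in> Lp_fun \<mu> p" "Lp_norm \<mu> p f \<le> B"
    have "\<exists>d. d \<in> D \<and> dist d (mean f z) < \<theta>" for z
    proof -
      have "mean f z \<in> cball 0 R" using mean_bounded(2)[OF f(1) B f(2)] by (simp add: R_def)
      then have "mean f z \<in> (\<Union>d\<in>D. ball d \<theta>)" using D(3) by blast
      then show ?thesis by auto
    qed
    then obtain d where d: "\<And>z. d z \<in> D" "\<And>z. dist (d z) (mean f z) < \<theta>" by metis
    define \<psi> where "\<psi> = restrict d (s ` K)"
    have "cmod (mean f (s x) - \<psi> (s x)) \<le> \<theta>" if "x \<in> K" for x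
      using d(2)[of "s x"] that by (simp add: \<psi>_def dist_norm norm_minus_commute less_imp_le)
    from step_function_Lp(2)[where \<psi> = "\<lambda>z. mean f z - \<psi> z", OF less_imp_le[OF \<theta>] this]
    have "Lp_norm \<mu> p (\<lambda>x. smooth f x - step \<psi> x) \<le> \<theta> * measure \<mu> K powr (1 / p)"
      by (simp add: smooth_def step_def right_diff_distrib)
    also have "\<dots> \<le> \<epsilon>" unfolding \<theta>_def by (rule mult_divide_add_one_le[OF \<epsilon>]) simp
    finally show "\<exists>g\<in>step ` (s ` K \<rightarrow>\<^sub>E D). Lp_norm \<mu> p (\<lambda>x. smooth f x - g x) \<le> \<epsilon>"
      using d(1) by (intro bexI[of _ "step \<psi>"] imageI) (auto simp: \<psi>_def)
  qed
qed

end

context locally_compact_haar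
begin

text \<open>
  First comes \<open>U\<close>, then its neighbourhood \<open>V\<close> by outer regularity, and last the fineness \<open>N\<close> of the
  partition of \<open>K\<close>, such that \<open>N + U\<close> is contained in \<open>V\<close>.
\<close>
lemma averaging_exists:
  assumes "p \<ge> 1" "compact K" "open U0" "0 \<in> U0"
  obtains U V W s where "averaging \<mu> p K U V W s" "W \<subseteq> U0"
proof -
  obtain V1 W :: "'a set" where W: "open V1" "compact W" "0 \<in> V1" "V1 \<subseteq> W" "W \<subseteq> U0"
    using compact_nhd[OF lc assms(3,4)] by metis
  obtain V2 U :: "'a set" where U: "open V2" "compact U" "0 \<in> V2" "V2 \<subseteq> U" "U \<subseteq> V1"
    using compact_nhd[OF lc W(1,3)] by metis
  have sets: "U \<in> sets borel" "W \<in> sets \<mu>" "V2 \<in> sets \<mu>"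
    using U W by (auto intro: borel_compact simp: sets_eq)
  have U_fin: "emeasure \<mu> U < \<infinity>" using U(2) by (rule emeasure_compact_finite)
  have "0 < emeasure \<mu> V2" using U by (intro emeasure_open_pos)
  also have "\<dots> \<le> emeasure \<mu> U" using U sets by (intro emeasure_mono) (auto simp: sets_eq)
  finally have U_pos: "0 < emeasure \<mu> U" .
  have "emeasure \<mu> U < emeasure \<mu> U + emeasure \<mu> U"
    using U_pos U_fin by (metis add.right_neutral ennreal_add_left_cancel_less less_top infinity_ennreal_def)
  then obtain V3 where V3: "open V3" "U \<subseteq> V3" "emeasure \<mu> V3 < emeasure \<mu> U + emeasure \<mu> U"
    unfolding outer_regular[OF sets(1)] by (auto simp: INF_less_iff)
  define V where "V = V3 \<inter> V1"
  have V: "open V" "U \<subseteq> V" "V \<subseteq> W" using V3 W U by (auto simp: V_def)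
  have V_sets: "V \<in> sets \<mu>" "V3 \<in> sets \<mu>" using V V3 by (auto simp: sets_eq)
  have "emeasure \<mu> V \<le> emeasure \<mu> V3" using V_sets by (intro emeasure_mono) (auto simp: V_def)
  also have "\<dots> \<le> emeasure \<mu> U + emeasure \<mu> U" using V3(3) by simp
  finally have V_le: "emeasure \<mu> V \<le> emeasure \<mu> U + emeasure \<mu> U" .
  have V_le': "measure \<mu> V \<le> 2 * measure \<mu> U"
  proof -
    have "emeasure \<mu> U = ennreal (measure \<mu> U)" using U_fin by (simp add: emeasure_eq_ennreal_measure)
    then have "emeasure \<mu> V \<le> ennreal (2 * measure \<mu> U)" using V_le by (simp add: ennreal_plus[symmetric] del: ennreal_plus)
    then show ?thesis unfolding measure_def by (intro enn2real_leI) auto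
  qed
  obtain N where N: "open N" "0 \<in> N" "\<And>v c. v \<in> N \<Longrightarrow> c \<in> U \<Longrightarrow> v + c \<in> V"
    using compact_in_open_translates[OF U(2) V(1,2)] by metis
  have "open {x. - x + q \<in> N} \<and> q \<in> {x. - x + q \<in> N}" for q
  proof -
    have "continuous_on UNIV (\<lambda>x. - x + q)" by (intro continuous_intros)
    then show ?thesis using N(2) open_vimage[OF N(1), of "\<lambda>x. - x + q"] by (simp add: vimage_def)
  qed
  then obtain P s where P: "finite P" "P \<subseteq> K" "\<And>x. x \<in> K \<Longrightarrow> s x \<in> P \<and> x \<in> {z. - z + s x \<in> N}"
    and s: "s \<in> borel \<rightarrow>\<^sub>M count_space UNIV"
    using finite_Borel_selection[OF assms(2), of "\<lambda>q. {x. - x + q \<in> N}"] by metis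
  have "averaging \<mu> p K U V W s"
  proof unfold_locales
    show "0 < measure \<mu> U" using U_pos U_fin by (simp add: measure_def enn2real_positive_iff)
    show "finite (s ` K)" using P by (intro finite_subset[OF _ P(1)]) auto
    show "- x + (s x + u) \<in> V" if "x \<in> K" "u \<in> U" for x u
      using N(3)[of "- x + s x" u] P(3)[OF that(1)] that(2) by (simp add: add.assoc)
  qed (use assms U V W V_le' s in auto)
  then show thesis using W(5) that by blast
qed

end

section \<open>The compactness criterion\<close>

context locally_compact_haar
begin

lemma tail_integral_eq:
  assumes "p \<ge> 1"
  shows "(LINT y:- K|\<mu>. cmod (f y) powr p) = Lp_norm \<mu> p (\<lambda>x. of_real (indicat_real (- K) x) * f x) powr p"
  unfolding Lp_norm_powr[OF assms] set_lebesgue_integral_def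
  using assms by (intro Bochner_Integration.integral_cong) (auto simp: indicator_def)

lemma sets_compl_compact: "compact K \<Longrightarrow> - K \<in> sets \<mu>"
  by (simp add: sets_eq borel_compact borel_comp)

lemma relatively_compact_imp_Lp_bounded:
  assumes p: "p \<ge> 1" and F: "F \<subseteq> Lp_space \<mu> p" and rc: "relatively_compact_in (Lp_topology \<mu> p) F"
  shows "Lp_bounded \<mu> p F"
proof -
  obtain G where G: "finite G" "G \<subseteq> Lp_fun \<mu> p"
    "\<And>c f. c \<in> F \<Longrightarrow> f \<in> c \<Longrightarrow> \<exists>g\<in>G. Lp_norm \<mu> p (\<lambda>x. f x - g x) < 1"
    using relatively_compact_finite_net[OF p F rc zero_less_one] by metis
  define B where "B = 1 + (\<Sum>g\<in>G. Lp_norm \<mu> p g)"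
  have "Lp_norm \<mu> p f \<le> B" if c: "c \<in> F" "f \<in> c" for c f
  proof -
    have f: "f \<in> Lp_fun \<mu> p" using c F Lp_space_in_fun by blast
    obtain g where g: "g \<in> G" "Lp_norm \<mu> p (\<lambda>x. f x - g x) < 1" using G(3)[OF c] by blast
    have gL: "g \<in> Lp_fun \<mu> p" using g(1) G(2) by blast
    have "Lp_norm \<mu> p g \<le> (\<Sum>g\<in>G. Lp_norm \<mu> p g)"
      using G(1) g(1) by (intro member_le_sum) auto
    then show ?thesis using Lp_norm_triangle_sub[OF p f gL] g(2) by (simp add: B_def)
  qed
  moreover have "B > 0" unfolding B_def by (intro add_pos_nonneg sum_nonneg) auto
  ultimately show ?thesis unfolding Lp_bounded_def by blast
qed

lemma relatively_compact_imp_Lp_equivanishing: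
  assumes p: "p \<ge> 1" and F: "F \<subseteq> Lp_space \<mu> p" and rc: "relatively_compact_in (Lp_topology \<mu> p) F"
  shows "Lp_equivanishing \<mu> p F"
  unfolding Lp_equivanishing_def
proof (intro allI impI)
  fix \<epsilon> :: real assume \<epsilon>: "\<epsilon> > 0"
  define \<delta> where "\<delta> = \<epsilon> powr (1 / p) / 2"
  have \<delta>: "\<delta> > 0" using \<epsilon> by (simp add: \<delta>_def)
  have \<delta>_eq: "(\<delta> + \<delta>) powr p = \<epsilon>" using \<epsilon> p by (simp add: \<delta>_def powr_powr)
  obtain G where G: "finite G" "G \<subseteq> Lp_fun \<mu> p"
    "\<And>c f. c \<in> F \<Longrightarrow> f \<in> c \<Longrightarrow> \<exists>g\<in>G. Lp_norm \<mu> p (\<lambda>x. f x - g x) < \<delta> / 2"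
    using relatively_compact_finite_net[OF p F rc half_gt_zero[OF \<delta>]] by metis
  have "\<exists>h. compactly_supported h \<and> Lp_norm \<mu> p (\<lambda>x. g x - h x) \<le> \<delta>" if "g \<in> G" for g
    using compactly_supported_dense[OF p _ \<delta>] G(2) that by (metis subsetD)
  then obtain h where h: "\<And>g. g \<in> G \<Longrightarrow> compactly_supported (h g)"
    "\<And>g. g \<in> G \<Longrightarrow> Lp_norm \<mu> p (\<lambda>x. g x - h g x) \<le> \<delta>"
    by metis
  have "\<exists>K. compact K \<and> (\<forall>x. x \<notin> K \<longrightarrow> h g x = 0)" if "g \<in> G" for g
    using h(1)[OF that] by (simp add: compactly_supported_def)
  then obtain L where L: "\<And>g. g \<in> G \<Longrightarrow> compact (L g)" "\<And>g x. g \<in> G \<Longrightarrow> x \<notin> L g \<Longrightarrow> h g x = 0"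
    by metis
  define K where "K = (\<Union>g\<in>G. L g)"
  have K: "compact K" unfolding K_def using G(1) L(1) by (intro compact_UN) auto
  show "\<exists>K. compact K \<and> (\<forall>c\<in>F. \<forall>f\<in>c. (LINT y:- K|\<mu>. cmod (f y) powr p) \<le> \<epsilon>)"
  proof (intro exI[of _ K] conjI ballI K)
    fix c f assume c: "c \<in> F" "f \<in> c"
    have f: "f \<in> Lp_fun \<mu> p" using c F Lp_space_in_fun by blast
    obtain g where g: "g \<in> G" "Lp_norm \<mu> p (\<lambda>x. f x - g x) < \<delta> / 2" using G(3)[OF c] by blast
    have gL: "g \<in> Lp_fun \<mu> p" using g(1) G(2) by blast
    have hL: "h g \<in> Lp_fun \<mu> p" using h(1)[OF g(1)] by (rule compactly_supported_in_Lp[OF p])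
    have off_K: "of_real (indicat_real (- K) x) * f x = of_real (indicat_real (- K) x) * (f x - h g x)" for x
      using L(2)[OF g(1), of x] g(1) by (cases "x \<in> K") (auto simp: K_def)
    have "Lp_norm \<mu> p (\<lambda>x. of_real (indicat_real (- K) x) * f x)
        = Lp_norm \<mu> p (\<lambda>x. of_real (indicat_real (- K) x) * (f x - h g x))"
      by (simp only: off_K)
    also have "\<dots> \<le> Lp_norm \<mu> p (\<lambda>x. f x - h g x)"
      by (rule Lp_indicator_mult(2)[OF p sets_compl_compact[OF K] Lp_fun_diff[OF p f hL]])
    also have "\<dots> \<le> Lp_norm \<mu> p (\<lambda>x. f x - g x) + Lp_norm \<mu> p (\<lambda>x. g x - h g x)"
      by (rule Lp_norm_triangle_diff[OF p f gL hL])
    also have "\<dots> \<le> \<delta> + \<delta>" using g(2) h(2)[OF g(1)] \<delta> by simp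
    finally have "Lp_norm \<mu> p (\<lambda>x. of_real (indicat_real (- K) x) * f x) powr p \<le> (\<delta> + \<delta>) powr p"
      using p by (intro powr_mono2) auto
    then show "(LINT y:- K|\<mu>. cmod (f y) powr p) \<le> \<epsilon>"
      unfolding tail_integral_eq[OF p] \<delta>_eq .
  qed
qed

text \<open>
  Both halves of equicontinuity pass from the finitely many centres of a net to the family, again
  by the three-term estimate.
\<close>
lemma equicontinuous_by_finite_net:
  fixes T :: "'a \<Rightarrow> 'a \<Rightarrow> 'a"
  assumes p: "p \<ge> 1" and F: "F \<subseteq> Lp_space \<mu> p" and rc: "relatively_compact_in (Lp_topology \<mu> p) F"
    and \<epsilon>: "\<epsilon> > 0" and C: "C > 0" and V: "open V" "0 \<in> V"
    and T: "\<And>x f. x \<in> V \<Longrightarrow> f \<in> Lp_fun \<mu> p \<Longrightarrow>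
      (\<lambda>y. f (T x y)) \<in> Lp_fun \<mu> p \<and> Lp_norm \<mu> p (\<lambda>y. f (T x y)) \<le> C * Lp_norm \<mu> p f"
    and cont: "\<And>g \<epsilon>. g \<in> Lp_fun \<mu> p \<Longrightarrow> \<epsilon> > 0 \<Longrightarrow>
      \<exists>U. open U \<and> 0 \<in> U \<and> (\<forall>x\<in>U. Lp_norm \<mu> p (\<lambda>y. g (T x y) - g y) \<le> \<epsilon>)"
  obtains U where "open U" "0 \<in> U"
    "\<And>c f x. c \<in> F \<Longrightarrow> f \<in> c \<Longrightarrow> x \<in> U \<Longrightarrow> Lp_norm \<mu> p (\<lambda>y. f (T x y) - f y) \<le> \<epsilon>"
proof -
  define \<delta> where "\<delta> = \<epsilon> / (2 * (C + 1))"
  have \<delta>: "\<delta> > 0" using \<epsilon> C by (simp add: \<delta>_def)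
  have \<delta>_eq: "(C + 1) * \<delta> = \<epsilon> / 2" using C by (simp add: \<delta>_def field_simps)
  have \<epsilon>2: "\<epsilon> / 2 > 0" using \<epsilon> by simp
  obtain G where G: "finite G" "G \<subseteq> Lp_fun \<mu> p"
    "\<And>c f. c \<in> F \<Longrightarrow> f \<in> c \<Longrightarrow> \<exists>g\<in>G. Lp_norm \<mu> p (\<lambda>x. f x - g x) < \<delta>"
    using relatively_compact_finite_net[OF p F rc \<delta>] by metis
  have "\<exists>U. open U \<and> 0 \<in> U \<and> (\<forall>x\<in>U. Lp_norm \<mu> p (\<lambda>y. g (T x y) - g y) \<le> \<epsilon> / 2)" if "g \<in> G" for g
    using cont[OF _ \<epsilon>2] G(2) that by (metis subsetD)
  then obtain U where U: "\<And>g. g \<in> G \<Longrightarrow> open (U g) \<and> 0 \<in> U g"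
    "\<And>g x. g \<in> G \<Longrightarrow> x \<in> U g \<Longrightarrow> Lp_norm \<mu> p (\<lambda>y. g (T x y) - g y) \<le> \<epsilon> / 2"
    by metis
  show thesis
  proof (rule that[of "V \<inter> (\<Inter>g\<in>G. U g)"])
    show "open (V \<inter> (\<Inter>g\<in>G. U g))" "0 \<in> V \<inter> (\<Inter>g\<in>G. U g)"
      using V U(1) G(1) by (auto intro!: open_Int open_INT)
    fix c f x assume c: "c \<in> F" "f \<in> c" and x: "x \<in> V \<inter> (\<Inter>g\<in>G. U g)"
    have f: "f \<in> Lp_fun \<mu> p" using c F Lp_space_in_fun by blast
    obtain g where g: "g \<in> G" "Lp_norm \<mu> p (\<lambda>x. f x - g x) < \<delta>" using G(3)[OF c] by blast
    have gL: "g \<in> Lp_fun \<mu> p" using g(1) G(2) by blast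
    have "Lp_norm \<mu> p (\<lambda>y. f (T x y) - f y)
        \<le> (C + 1) * Lp_norm \<mu> p (\<lambda>y. f y - g y) + Lp_norm \<mu> p (\<lambda>y. g (T x y) - g y)"
      using x by (intro Lp_translation_three_terms[OF p f gL] T) simp_all
    also have "\<dots> \<le> (C + 1) * \<delta> + \<epsilon> / 2"
      using C g U(2)[OF g(1)] x by (intro add_mono mult_left_mono) auto
    also have "\<dots> = \<epsilon>" using \<delta>_eq by simp
    finally show "Lp_norm \<mu> p (\<lambda>y. f (T x y) - f y) \<le> \<epsilon>" .
  qed
qed

lemma relatively_compact_imp_Lp_equicontinuous:
  assumes p: "p \<ge> 1" and F: "F \<subseteq> Lp_space \<mu> p" and rc: "relatively_compact_in (Lp_topology \<mu> p) F"
  shows "Lp_equicontinuous \<mu> p F"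
  unfolding Lp_equicontinuous_def left_translate_def right_translate_def
proof (intro allI impI)
  fix \<epsilon> :: real assume \<epsilon>: "\<epsilon> > 0"
  have left: "(\<lambda>y. f (x + y)) \<in> Lp_fun \<mu> p \<and> Lp_norm \<mu> p (\<lambda>y. f (x + y)) \<le> 1 * Lp_norm \<mu> p f"
    if "f \<in> Lp_fun \<mu> p" for f x
    using Lp_left_translation[OF that] by simp
  have "\<exists>U. open U \<and> 0 \<in> U \<and> (\<forall>x\<in>U. Lp_norm \<mu> p (\<lambda>y. g (x + y) - g y) \<le> \<epsilon>)"
    if "g \<in> Lp_fun \<mu> p" "\<epsilon> > 0" for g \<epsilon>
    using Lp_left_translation_continuous[OF p that] by metis
  from equicontinuous_by_finite_net[where T = "(+)", OF p F rc \<epsilon> zero_less_one open_UNIV UNIV_I left this]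
  obtain U1 where U1: "open U1" "0 \<in> U1"
    "\<And>c f x. c \<in> F \<Longrightarrow> f \<in> c \<Longrightarrow> x \<in> U1 \<Longrightarrow> Lp_norm \<mu> p (\<lambda>y. f (x + y) - f y) \<le> \<epsilon>"
    by metis
  obtain V W :: "'a set" where W: "open V" "compact W" "0 \<in> V" "V \<subseteq> W"
    using compact_nhd[OF lc open_UNIV UNIV_I, of 0] by metis
  obtain C where C: "C > 0" "\<And>w f. w \<in> W \<Longrightarrow> f \<in> Lp_fun \<mu> p \<Longrightarrow>
    (\<lambda>y. f (y + w)) \<in> Lp_fun \<mu> p \<and> Lp_norm \<mu> p (\<lambda>y. f (y + w)) \<le> C * Lp_norm \<mu> p f"
    using Lp_right_translation_bounded[OF p W(2)] by metis
  have right: "(\<lambda>y. f (y + x)) \<in> Lp_fun \<mu> p \<and> Lp_norm \<mu> p (\<lambda>y. f (y + x)) \<le> C * Lp_norm \<mu> p f"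
    if "x \<in> V" "f \<in> Lp_fun \<mu> p" for f x
    using C(2) W(4) that by blast
  have "\<exists>U. open U \<and> 0 \<in> U \<and> (\<forall>x\<in>U. Lp_norm \<mu> p (\<lambda>y. g (y + x) - g y) \<le> \<epsilon>)"
    if "g \<in> Lp_fun \<mu> p" "\<epsilon> > 0" for g \<epsilon>
    using Lp_right_translation_continuous[OF p that] by metis
  from equicontinuous_by_finite_net[where T = "\<lambda>x y. y + x", OF p F rc \<epsilon> C(1) W(1,3) right this]
  obtain U2 where U2: "open U2" "0 \<in> U2"
    "\<And>c f x. c \<in> F \<Longrightarrow> f \<in> c \<Longrightarrow> x \<in> U2 \<Longrightarrow> Lp_norm \<mu> p (\<lambda>y. f (y + x) - f y) \<le> \<epsilon>"
    by metis
  show "\<exists>U. open U \<and> 0 \<in> U \<and> (\<forall>c\<in>F. \<forall>f\<in>c.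
      (\<forall>x\<in>U. Lp_norm \<mu> p (\<lambda>y. f (x + y) - f y) \<le> \<epsilon>) \<and>
      (\<forall>x\<in>U. Lp_norm \<mu> p (\<lambda>y. f (y + x) - f y) \<le> \<epsilon>))"
  proof (intro exI[of _ "U1 \<inter> U2"] conjI ballI)
    show "open (U1 \<inter> U2)" "0 \<in> U1 \<inter> U2" using U1(1,2) U2(1,2) by auto
    fix c f x assume "c \<in> F" "f \<in> c" "x \<in> U1 \<inter> U2"
    then show "Lp_norm \<mu> p (\<lambda>y. f (x + y) - f y) \<le> \<epsilon>" "Lp_norm \<mu> p (\<lambda>y. f (y + x) - f y) \<le> \<epsilon>"
      using U1(3)[of c f x] U2(3)[of c f x] by simp_all
  qed
qed

text \<open>
  Up to a small error, every function of the family is its restriction to a compact set (by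
  equivanishing), hence its local average (by equicontinuity under right translations), and the
  local averages form a bounded set of finite dimension.
\<close>
theorem relatively_compact_if_bounded_equicontinuous_equivanishing:
  assumes p: "p \<ge> 1" and F: "F \<subseteq> Lp_space \<mu> p"
    and bounded: "Lp_bounded \<mu> p F" and equicont: "Lp_equicontinuous \<mu> p F"
    and equivan: "Lp_equivanishing \<mu> p F"
  shows "relatively_compact_in (Lp_topology \<mu> p) F"
proof (rule relatively_compactI_finite_net[OF p F])
  fix \<epsilon> :: real assume \<epsilon>: "\<epsilon> > 0"
  define \<tau> where "\<tau> = \<epsilon> / 8"
  have \<tau>: "\<tau> > 0" using \<epsilon> by (simp add: \<tau>_def)
  obtain B where B: "B > 0" "\<And>c f. c \<in> F \<Longrightarrow> f \<in> c \<Longrightarrow> Lp_norm \<mu> p f \<le> B"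
    using bounded unfolding Lp_bounded_def by metis
  obtain U0 where U0: "open U0" "0 \<in> U0"
    "\<And>c f x. c \<in> F \<Longrightarrow> f \<in> c \<Longrightarrow> x \<in> U0 \<Longrightarrow> Lp_norm \<mu> p (\<lambda>y. f (y + x) - f y) \<le> \<tau>"
    using equicont \<tau> unfolding Lp_equicontinuous_def right_translate_def by metis
  have "\<tau> powr p > 0" using \<tau> by simp
  then obtain K where compact_K: "compact K" and
    tail: "\<And>c f. c \<in> F \<Longrightarrow> f \<in> c \<Longrightarrow> (LINT y:- K|\<mu>. cmod (f y) powr p) \<le> \<tau> powr p"
    using equivan unfolding Lp_equivanishing_def by metis
  obtain U V W s where av: "averaging \<mu> p K U V W s" and W_U0: "W \<subseteq> U0"
    using averaging_exists[OF p compact_K U0(1,2)] by metis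
  interpret averaging \<mu> p K U V W s by (rule av)
  obtain G where G: "finite G" "G \<subseteq> Lp_fun \<mu> p"
    "\<And>f. f \<in> Lp_fun \<mu> p \<Longrightarrow> Lp_norm \<mu> p f \<le> B \<Longrightarrow> \<exists>g\<in>G. Lp_norm \<mu> p (\<lambda>x. smooth f x - g x) \<le> \<tau>"
    using smooth_finite_net[OF \<tau> B(1)] by metis
  have "\<exists>f\<in>c. \<exists>g\<in>G. Lp_norm \<mu> p (\<lambda>x. f x - g x) < \<epsilon>" if c: "c \<in> F" for c
  proof -
    obtain f where fc: "f \<in> c" using Lp_space_nonempty c F by blast
    have f: "f \<in> Lp_fun \<mu> p" using c fc F Lp_space_in_fun by blast
    obtain g where g: "g \<in> G" "Lp_norm \<mu> p (\<lambda>x. smooth f x - g x) \<le> \<tau>"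
      using G(3)[OF f B(2)[OF c fc]] by blast
    have gL: "g \<in> Lp_fun \<mu> p" using g(1) G(2) by blast
    have kL: "(\<lambda>x. of_real (indicat_real K x) * f x) \<in> Lp_fun \<mu> p"
      by (rule Lp_indicator_mult(1)[OF p sets_UVWK(4) f])
    have sL: "smooth f \<in> Lp_fun \<mu> p" by (rule smooth_bounded(1)[OF f B(1) B(2)[OF c fc]])
    have "(\<lambda>x. f x - of_real (indicat_real K x) * f x) = (\<lambda>x. of_real (indicat_real (- K) x) * f x)"
      by (auto simp: indicator_def fun_eq_iff)
    moreover have "Lp_norm \<mu> p (\<lambda>x. of_real (indicat_real (- K) x) * f x) \<le> \<tau>"
    proof (rule Lp_norm_leI[OF p less_imp_le[OF \<tau>]])
      show "(LINT x|\<mu>. cmod (of_real (indicat_real (- K) x) * f x) powr p) \<le> \<tau> powr p"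
        using tail[OF c fc] unfolding tail_integral_eq[OF p] Lp_norm_powr[OF p] .
    qed
    ultimately have 1: "Lp_norm \<mu> p (\<lambda>x. f x - of_real (indicat_real K x) * f x) \<le> \<tau>" by simp
    have 2: "Lp_norm \<mu> p (\<lambda>x. of_real (indicat_real K x) * f x - smooth f x) \<le> 2 * \<tau>"
      using U0(3)[OF c fc] W_U0 \<tau> by (intro smooth_close[OF f]) auto
    have "Lp_norm \<mu> p (\<lambda>x. f x - g x) \<le> \<tau> + (2 * \<tau> + \<tau>)"
      using Lp_norm_triangle_diff[OF p f kL gL] Lp_norm_triangle_diff[OF p kL sL gL] 1 2 g(2) by linarith
    also have "\<dots> < \<epsilon>" using \<epsilon> by (simp add: \<tau>_def)
    finally show ?thesis using fc g(1) by blast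
  qed
  then show "\<exists>G. finite G \<and> G \<subseteq> Lp_fun \<mu> p \<and> (\<forall>c\<in>F. \<exists>f\<in>c. \<exists>g\<in>G. Lp_norm \<mu> p (\<lambda>x. f x - g x) < \<epsilon>)"
    using G(1,2) by blast
qed

text \<open>
  A step \<open>x\<close> moves every \<open>f\<close> by at most \<open>1\<close>, so its \<open>n\<close>-th power \<open>z\<close> moves \<open>f\<close> by at most \<open>n\<close>. If \<open>z\<close>
  is not a difference of two points of \<open>K\<close>, then on \<open>K\<close> the translate of \<open>f\<close> by \<open>z\<close> only takes values
  that \<open>f\<close> has outside \<open>K\<close>, where \<open>f\<close> is small. As \<open>n\<close> depends on \<open>x\<close> and \<open>K\<close> but not on \<open>f\<close>,
  this bounds all \<open>f\<close> on \<open>K\<close>.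
\<close>
theorem Lp_bounded_if_escaping_powers:
  assumes p: "p \<ge> 1" and F: "F \<subseteq> Lp_space \<mu> p"
    and equicont: "Lp_equicontinuous \<mu> p F" and equivan: "Lp_equivanishing \<mu> p F"
    and escape: "\<And>U :: 'a set. open U \<Longrightarrow> 0 \<in> U \<Longrightarrow> \<exists>x\<in>U. \<not> (\<exists>K. compact K \<and> (\<forall>n. ((+) x ^^ n) 0 \<in> K))"
  shows "Lp_bounded \<mu> p F"
proof -
  obtain U where U: "open U" "0 \<in> U"
    "\<And>c f x. c \<in> F \<Longrightarrow> f \<in> c \<Longrightarrow> x \<in> U \<Longrightarrow> Lp_norm \<mu> p (\<lambda>y. f (x + y) - f y) \<le> 1"
    using equicont zero_less_one unfolding Lp_equicontinuous_def left_translate_def by metis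
  obtain K where K: "compact K"
    "\<And>c f. c \<in> F \<Longrightarrow> f \<in> c \<Longrightarrow> (LINT y:- K|\<mu>. cmod (f y) powr p) \<le> 1"
    using equivan zero_less_one unfolding Lp_equivanishing_def by metis
  define D where "D = (\<lambda>(x, y). x - y) ` (K \<times> K)"
  have "compact D" unfolding D_def using K(1) K(1) by (rule compact_diffset)
  then obtain x n where x: "x \<in> U" and n: "((+) x ^^ n) 0 \<notin> D"
    using escape[OF U(1,2)] by blast
  define z where "z = ((+) x ^^ n) 0"
  have off_K: "z + y \<notin> K" if "y \<in> K" for y
  proof
    assume "z + y \<in> K"
    then have "z \<in> D" unfolding D_def using that by (intro image_eqI[of _ _ "(z + y, y)"]) auto
    then show False using n by (simp add: z_def)
  qed
  have "Lp_norm \<mu> p f \<le> real n + 2" if c: "c \<in> F" "f \<in> c" for c f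
  proof -
    have f: "f \<in> Lp_fun \<mu> p" using c F Lp_space_in_fun by blast
    have steps: "Lp_norm \<mu> p (\<lambda>y. f (((+) x ^^ m) 0 + y) - f y) \<le> real m" for m
    proof (induction m)
      case 0
      then show ?case by (simp add: Lp_norm_zero)
    next
      case (Suc m)
      let ?w = "((+) x ^^ m) 0"
      have L: "(\<lambda>y. f (x + y) - f y) \<in> Lp_fun \<mu> p"
        by (rule Lp_fun_diff[OF p Lp_left_translation(1)[OF f] f])
      have "Lp_norm \<mu> p (\<lambda>y. f (x + ?w + y) - f y)
          \<le> Lp_norm \<mu> p (\<lambda>y. f (x + ?w + y) - f (?w + y)) + Lp_norm \<mu> p (\<lambda>y. f (?w + y) - f y)"
        by (rule Lp_norm_triangle_diff[OF p Lp_left_translation(1)[OF f] Lp_left_translation(1)[OF f] f])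
      also have "Lp_norm \<mu> p (\<lambda>y. f (x + ?w + y) - f (?w + y)) = Lp_norm \<mu> p (\<lambda>y. f (x + y) - f y)"
        using Lp_left_translation(2)[OF L, of ?w] by (simp add: add.assoc)
      also have "Lp_norm \<mu> p (\<lambda>y. f (x + y) - f y) + Lp_norm \<mu> p (\<lambda>y. f (?w + y) - f y) \<le> 1 + real m"
        using U(3)[OF c x] Suc.IH by (rule add_mono)
      finally show ?case by simp
    qed
    let ?t = "\<lambda>y. of_real (indicat_real (- K) y) * f y"
    have tL: "?t \<in> Lp_fun \<mu> p" by (rule Lp_indicator_mult(1)[OF p sets_compl_compact[OF K(1)] f])
    have t1: "Lp_norm \<mu> p ?t \<le> 1"
    proof (rule Lp_norm_leI[OF p zero_le_one])
      show "(LINT x|\<mu>. cmod (?t x) powr p) \<le> 1 powr p"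
        using K(2)[OF c] unfolding tail_integral_eq[OF p] Lp_norm_powr[OF p] by simp
    qed
    have zL: "(\<lambda>y. f (z + y) - f y) \<in> Lp_fun \<mu> p"
      by (rule Lp_fun_diff[OF p Lp_left_translation(1)[OF f] f])
    \<comment> \<open>The first summand dominates \<open>f\<close> outside \<open>K\<close>, the other two on \<open>K\<close>.\<close>
    define \<Phi> where "\<Phi> y = complex_of_real (cmod (?t y)) + of_real (cmod (f (z + y) - f y)) + of_real (cmod (?t (z + y)))" for y
    have abs_Lp: "(\<lambda>y. complex_of_real (cmod (g y))) \<in> Lp_fun \<mu> p"
      "Lp_norm \<mu> p (\<lambda>y. complex_of_real (cmod (g y))) = Lp_norm \<mu> p g" if "g \<in> Lp_fun \<mu> p" for g
      using that by (auto simp: Lp_fun_def Lp_norm_def)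
    note L1 = abs_Lp[OF tL] and L2 = abs_Lp[OF zL] and L3 = abs_Lp[OF Lp_left_translation(1)[OF tL], of z]
    have \<Phi>L: "\<Phi> \<in> Lp_fun \<mu> p"
      unfolding \<Phi>_def by (rule Lp_fun_add[OF p Lp_fun_add[OF p L1(1) L2(1)] L3(1)])
    have \<Phi>_cmod: "cmod (\<Phi> y) = cmod (?t y) + cmod (f (z + y) - f y) + cmod (?t (z + y))" for y
    proof -
      have "\<Phi> y = of_real (cmod (?t y) + cmod (f (z + y) - f y) + cmod (?t (z + y)))" by (simp add: \<Phi>_def)
      then show ?thesis by (simp only: norm_of_real) simp
    qed
    have "cmod (f y) \<le> cmod (\<Phi> y)" for y
    proof (cases "y \<in> K")
      case True
      have le: "cmod (f y) \<le> cmod (f (z + y)) + cmod (f (z + y) - f y)"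
        using norm_triangle_ineq4[of "f (z + y)" "f (z + y) - f y"] by simp
      from True have "cmod (?t (z + y)) = cmod (f (z + y))" using off_K[of y] by simp
      then show ?thesis
        unfolding \<Phi>_cmod using le norm_ge_zero[of "?t y"] by linarith
    next
      case False
      then have "cmod (?t y) = cmod (f y)" by simp
      then show ?thesis
        unfolding \<Phi>_cmod using norm_ge_zero[of "f (z + y) - f y"] norm_ge_zero[of "?t (z + y)"] by linarith
    qed
    then have "Lp_norm \<mu> p f \<le> Lp_norm \<mu> p \<Phi>"
      by (rule Lp_fun_mono(2)[OF p Lp_fun_measurable[OF f] \<Phi>L])
    also have "\<dots> \<le> Lp_norm \<mu> p ?t + Lp_norm \<mu> p (\<lambda>y. f (z + y) - f y) + Lp_norm \<mu> p (\<lambda>y. ?t (z + y))"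
      unfolding \<Phi>_def
      using Lp_norm_triangle[OF p Lp_fun_add[OF p L1(1) L2(1)] L3(1)] Lp_norm_triangle[OF p L1(1) L2(1)]
      unfolding L1(2) L2(2) L3(2) by linarith
    also have "\<dots> \<le> 1 + real n + 1"
      using t1 steps[of n] Lp_left_translation(2)[OF tL, of z] unfolding z_def by (intro add_mono) auto
    finally show ?thesis by simp
  qed
  moreover have "real n + 2 > 0" by simp
  ultimately show ?thesis unfolding Lp_bounded_def by blast
qed

end

theorem theorem14:
  fixes \<mu> :: "'a::{topological_group_add,t2_space} measure" and p :: real
  assumes "locally_compact_space (euclidean :: 'a topology)"
    and "left_haar_measure \<mu>"
    and "1 \<le> p"
  shows
    "(\<forall>F. F \<subseteq> Lp_space \<mu> p \<longrightarrow>
        (relatively_compact_in (Lp_topology \<mu> p) F \<longleftrightarrow>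
           Lp_bounded \<mu> p F \<and> Lp_equicontinuous \<mu> p F \<and> Lp_equivanishing \<mu> p F)) \<and>
     ((\<forall>U::'a set. open U \<and> 0 \<in> U \<longrightarrow>
         (\<exists>x\<in>U. \<not> (\<exists>K. compact K \<and> (\<forall>n. ((+) x ^^ n) 0 \<in> K)))) \<longrightarrow>
      (\<forall>F. F \<subseteq> Lp_space \<mu> p \<longrightarrow>
        (relatively_compact_in (Lp_topology \<mu> p) F \<longleftrightarrow>
           Lp_equicontinuous \<mu> p F \<and> Lp_equivanishing \<mu> p F)))"
proof -
  interpret locally_compact_haar \<mu> using assms by unfold_locales
  have criterion: "relatively_compact_in (Lp_topology \<mu> p) F \<longleftrightarrow>
      Lp_bounded \<mu> p F \<and> Lp_equicontinuous \<mu> p F \<and> Lp_equivanishing \<mu> p F"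
    if F: "F \<subseteq> Lp_space \<mu> p" for F
    using relatively_compact_imp_Lp_bounded[OF assms(3) F] relatively_compact_imp_Lp_equicontinuous[OF assms(3) F]
      relatively_compact_imp_Lp_equivanishing[OF assms(3) F]
      relatively_compact_if_bounded_equicontinuous_equivanishing[OF assms(3) F]
    by argo
  show ?thesis
  proof (intro conjI allI impI)
    fix F assume F: "F \<subseteq> Lp_space \<mu> p"
    show "relatively_compact_in (Lp_topology \<mu> p) F \<longleftrightarrow>
      Lp_bounded \<mu> p F \<and> Lp_equicontinuous \<mu> p F \<and> Lp_equivanishing \<mu> p F"
      using criterion[OF F] .
  next
    fix F assume escape: "\<forall>U::'a set. open U \<and> 0 \<in> U \<longrightarrow>
        (\<exists>x\<in>U. \<not> (\<exists>K. compact K \<and> (\<forall>n. ((+) x ^^ n) 0 \<in> K)))" and F: "F \<subseteq> Lp_space \<mu> p"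
    have "Lp_bounded \<mu> p F" if "Lp_equicontinuous \<mu> p F" "Lp_equivanishing \<mu> p F"
      using escape by (intro Lp_bounded_if_escaping_powers[OF assms(3) F that]) simp
    then show "relatively_compact_in (Lp_topology \<mu> p) F \<longleftrightarrow>
      Lp_equicontinuous \<mu> p F \<and> Lp_equivanishing \<mu> p F"
      using criterion[OF F] by argo
  qed
qed

end
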